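(* Let $s\in(0,1)$, $u\in L^\infty(\mathbb R^n)$, $f\in C(B_1)$, and let $\mathcal L$ be a translation invariant operator with kernel comparable to the fractional Laplacian: $$\mathcal Lu(x)=\mathrm{P.V.}\int_{\mathbb R^n}(u(x)-u(x+y))K(y)\,dy$$ with $$K(y)=K(-y)\quad\text{and}\quad0<\lambda\le|y|^{n+2s}K(y)\le\Lambda\quad\text{in }\mathbb R^n.$$ Then $u$ solves $\mathcal Lu=f$ in $B_1$ in the distributional sense if and only if it does so in the viscosity sense.
   Context: $B_1$ is the unit ball of $\mathbb R^n$ centered at $0$. Distributional sense (standard notion): $\int_{\mathbb R^n}u\,\mathcal L\eta\,dx=\int_{B_1}f\eta\,dx$ for all $\eta\in C_c^\infty(B_1)$. Viscosity sense (standard notion): $u\in C(B_1)$ (as usual for elements of $L^\infty$, up to choosing a representative), and for every $x_\circ\in B_1$, every neighborhood $N\subset B_1$ of $x_\circ$, and every $v$ that is $C^2$ in $N$ with $v=u$ outside $N$ and $v(x_\circ)=u(x_\circ)$: if $v\ge u$ then $\mathcal Lv(x_\circ)\le f(x_\circ)$, and if $v\le u$ then $\mathcal Lv(x_\circ)\ge f(x_\circ)$. *)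

theory Defs
  imports "HOL-Analysis.Analysis"
begin

text \<open>
  The integral with values in \<open>[-\<infinity>, \<infinity>]\<close>. Extended values are needed because a viscosity test
  function is only \<open>C\<^sup>2\<close> in a neighbourhood \<open>N\<close> and may blow up non-integrably near the boundary
  of \<open>N\<close>. It then touches \<open>u\<close> from one side, so only one of the two parts below is infinite and
  the operator takes the value \<open>-\<infinity>\<close> (touching from above) or \<open>\<infinity>\<close> (touching from below), whereas
  the Bochner integral would default to \<open>0\<close>.
\<close>

definition ereal_integral :: "'a measure \<Rightarrow> ('a \<Rightarrow> real) \<Rightarrow> ereal" where
  "ereal_integral M g =
     enn2ereal (\<integral>\<^sup>+ y. ennreal (g y) \<partial>M) - enn2ereal (\<integral>\<^sup>+ y. ennreal (- g y) \<partial>M)"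

lemma ereal_integral_eq_integral:
  assumes "integrable M g"
  shows "ereal_integral M g = ereal (integral\<^sup>L M g)"
proof -
  have "enn2ereal (\<integral>\<^sup>+ y. ennreal (g y) \<partial>M) = ereal (enn2real (\<integral>\<^sup>+ y. ennreal (g y) \<partial>M))"
    and "enn2ereal (\<integral>\<^sup>+ y. ennreal (- g y) \<partial>M) = ereal (enn2real (\<integral>\<^sup>+ y. ennreal (- g y) \<partial>M))"
    using assms unfolding real_integrable_def
    by (metis enn2ereal_ennreal enn2real_nonneg ennreal_enn2real infinity_ennreal_def less_top)+
  then show ?thesis
    using real_lebesgue_integral_def[OF assms] by (simp add: ereal_integral_def)
qed

definition nonlocal_op :: "('a::euclidean_space \<Rightarrow> real) \<Rightarrow> ('a \<Rightarrow> real) \<Rightarrow> 'a \<Rightarrow> ereal" where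
  "nonlocal_op K v x =
     Lim (at_right 0)
       (\<lambda>\<epsilon>. ereal_integral lebesgue
         (\<lambda>y. indicator {y. \<epsilon> < norm y} y * ((v x - v (x + y)) * K y)))"

definition Linfty :: "('a::euclidean_space \<Rightarrow> real) \<Rightarrow> bool" where
  "Linfty u \<longleftrightarrow> u \<in> borel_measurable lebesgue \<and> (\<exists>C. AE x in lebesgue. \<bar>u x\<bar> \<le> C)"

text \<open>Intended for open \<open>S\<close>; the derivatives along \<open>Basis\<close> are the partial derivatives.\<close>

primrec Ck_on :: "nat \<Rightarrow> 'a::euclidean_space set \<Rightarrow> ('a \<Rightarrow> real) \<Rightarrow> bool" where
  "Ck_on 0 S g \<longleftrightarrow> continuous_on S g"
| "Ck_on (Suc k) S g \<longleftrightarrow>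
     (\<forall>x\<in>S. g differentiable (at x)) \<and>
     (\<forall>b\<in>Basis. Ck_on k S (\<lambda>x. frechet_derivative g (at x) b))"

definition test_function :: "'a::euclidean_space set \<Rightarrow> ('a \<Rightarrow> real) \<Rightarrow> bool" where
  "test_function \<Omega> \<eta> \<longleftrightarrow>
     (\<forall>k. Ck_on k UNIV \<eta>) \<and>
     compact (closure {x. \<eta> x \<noteq> 0}) \<and> closure {x. \<eta> x \<noteq> 0} \<subseteq> \<Omega>"

definition distributional_solution ::
  "('a::euclidean_space \<Rightarrow> real) \<Rightarrow> ('a \<Rightarrow> real) \<Rightarrow> ('a \<Rightarrow> real) \<Rightarrow> bool" where
  "distributional_solution K u f \<longleftrightarrow>
     (\<forall>\<eta>. test_function (ball 0 1) \<eta> \<longrightarrow>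
        (LINT x|lebesgue. u x * real_of_ereal (nonlocal_op K \<eta> x)) =
        (LINT x:ball 0 1|lebesgue. f x * \<eta> x))"

text \<open>
  The function \<open>w\<close> is the representative of the \<open>L\<^sup>\<infinity>\<close> class of \<open>u\<close> that is continuous in the ball.
\<close>

definition viscosity_solution ::
  "('a::euclidean_space \<Rightarrow> real) \<Rightarrow> ('a \<Rightarrow> real) \<Rightarrow> ('a \<Rightarrow> real) \<Rightarrow> bool" where
  "viscosity_solution K u f \<longleftrightarrow>
     (\<exists>w. (AE x in lebesgue. w x = u x) \<and> continuous_on (ball 0 1) w \<and>
        (\<forall>x0\<in>ball 0 1. \<forall>N v.
           open N \<and> x0 \<in> N \<and> N \<subseteq> ball 0 1 \<and> Ck_on 2 N v \<and>
           (\<forall>x. x \<notin> N \<longrightarrow> v x = w x) \<and> v x0 = w x0 \<longrightarrow>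
           ((\<forall>x. v x \<ge> w x) \<longrightarrow> nonlocal_op K v x0 \<le> ereal (f x0)) \<and>
           ((\<forall>x. v x \<le> w x) \<longrightarrow> nonlocal_op K v x0 \<ge> ereal (f x0))))"

end

theory Submission
  imports Defs
begin

text \<open>
  Both notions of solution are compared through the operators \<open>trunc_op r\<close>, in which only the jumps
  longer than \<open>r\<close> are kept. They act on all bounded measurable functions and are symmetric for the
  \<open>L\<^sup>2\<close> pairing. For fixed \<open>r\<close> they depend continuously on the function in a weighted \<open>L\<^sup>1\<close> norm,
  uniformly in the unit ball (\<open>trunc_integral_le_weighted\<close>, \<open>trunc_integral_shift_le\<close>). As \<open>r\<close> shrinks,
  all that matters is the second difference: where it is bounded above by \<open>2 A (norm z)\<^sup>2\<close>, the short
  jumps contribute at least \<open>- A * moment d\<close>, and \<open>moment d\<close> tends to \<open>0\<close> with \<open>d\<close>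
  (\<open>trunc_op_touching\<close>, \<open>moment_tendsto_0\<close>).

  From distributions to viscosity. Testing the equation with a translated mollifier shows that the
  mollifications of \<open>u\<close> solve mollified equations pointwise (\<open>mollify_solves\<close>). The difference of two
  of them is small in \<open>L\<^sup>1\<close>, while the operator applied to it stays bounded. At an interior maximum at
  which the difference exceeds some \<open>\<tau>\<close>, the jumps to points where it is small contribute about \<open>\<tau>\<close>
  times the mass of the truncated kernel, and this mass blows up as the truncation is removed
  (\<open>mass_unbounded\<close>). So the difference is uniformly small inside the ball
  (\<open>interior_maximum_bound\<close>), the mollifications converge locally uniformly, and their limit is a
  continuous representative of \<open>u\<close> (\<open>weak_solution_approximation\<close>). A function touching the limit from
  above touches the mollifications at nearby points after a quadratic perturbation; there their
  second differences are bounded above, and the equations pass to the limit as an inequality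
  (\<open>touching_inequality\<close>).

  From viscosity to distributions. Let \<open>w\<close> be the viscosity solution. The equation for \<open>trunc_op \<rho>\<close> with
  an additional penalty term \<open>(v - w) / (r - norm x)\<close> has a continuous solution \<open>v\<close> that equals \<open>w\<close>
  outside the ball of radius \<open>r\<close>; it is found by Banach's fixed point theorem
  (\<open>penalized_solution_exists\<close>). Doubling the variables compares \<open>w\<close> and \<open>v\<close>: at a maximum of
  \<open>w x - v y - (norm (x - y))\<^sup>2 / \<epsilon>\<close> the function \<open>w\<close> is touched by a paraboloid, which is an admissible
  test function, the equation for \<open>v\<close> holds pointwise, and the penalty has the favourable sign. Hence
  \<open>v\<close> tends to \<open>w\<close> uniformly as \<open>\<rho>\<close> tends to \<open>0\<close> (\<open>penalized_comparison\<close>). Moving \<open>trunc_op \<rho>\<close> to a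
  test function by symmetry and letting \<open>\<rho>\<close> tend to \<open>0\<close> gives the distributional equation
  (\<open>paraboloid_solution_weak\<close>).

  The remaining work relates this to the given definitions. Lebesgue measurable data are replaced by
  Borel representatives, for which Fubini's theorem applies to functions of \<open>x + z\<close>, and the
  principal value is shown to exist, possibly as an infinite value, for every viscosity test function
  (\<open>nonlocal_op_touching\<close>).
\<close>

section \<open>Lebesgue integrals on Euclidean space\<close>

lemma lborel_integrable_translate:
  fixes f :: "'a::euclidean_space \<Rightarrow> real"
  assumes "integrable lborel f"
  shows "integrable lborel (\<lambda>x. f (a + x))"
  using integrable_distr[of "(+) a" lborel borel f] assms by (simp add: lborel_distr_plus)

lemma lborel_integral_translate:
  fixes f :: "'a::euclidean_space \<Rightarrow> real"
  assumes "f \<in> borel_measurable borel"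
  shows "(LBINT x. f (a + x)) = (LBINT x. f x)"
  using integral_distr[of "(+) a" lborel borel f] assms by (simp add: lborel_distr_plus)

lemma lborel_distr_uminus': "distr lborel borel uminus = (lborel :: 'a::euclidean_space measure)"
  by (subst lborel_affine[of "-1" 0]) (auto simp: density_1 one_ennreal_def[symmetric])

lemma lborel_integral_reflect:
  fixes f :: "'a::euclidean_space \<Rightarrow> real"
  assumes "f \<in> borel_measurable borel"
  shows "(LBINT x. f (- x)) = (LBINT x. f x)"
  using integral_distr[of uminus lborel borel f] assms by (simp add: lborel_distr_uminus')

lemma AE_lborel_translate:
  fixes a :: "'a::euclidean_space"
  assumes "AE x in lborel. P x"
  shows "AE x in lborel. P (a + x)"
proof (rule AE_distrD[of "(+) a" lborel borel])
  show "AE x in distr lborel borel ((+) a). P x" unfolding lborel_distr_plus by (rule assms)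
qed simp

lemma AE_lborel_reflect:
  assumes "AE x :: 'a::euclidean_space in lborel. P x"
  shows "AE x :: 'a in lborel. P (- x)"
proof (rule AE_distrD[of uminus lborel borel])
  show "AE x :: 'a in distr lborel borel uminus. P x" unfolding lborel_distr_uminus' by (rule assms)
qed simp

text \<open>
  By regularity, \<open>A\<close> lies between a compact set \<open>C\<close> and an open set \<open>U\<close> with \<open>U - C\<close> of small measure.
  If \<open>norm a\<close> is less than the distance of \<open>C\<close> to the complement of \<open>U\<close>, then \<open>x\<close> and \<open>a + x\<close> can be
  separated by \<open>A\<close> only if one of them lies in \<open>U - C\<close>.
\<close>

lemma L1_translation_indicator:
  fixes A :: "'a::euclidean_space set"
  assumes A: "A \<in> sets lborel" "emeasure lborel A < \<infinity>" and e: "e > 0"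
  shows "\<exists>d>0. \<forall>a. norm a < d \<longrightarrow> (LBINT x. \<bar>indicator A (a + x) - indicator A x\<bar>) \<le> (e::real)"
proof -
  have AL: "A \<in> sets lebesgue" using A(1) by (rule sets_completionI_sets)
  obtain U where U: "open U" "A \<subseteq> U" "U - A \<in> lmeasurable" "emeasure lebesgue (U - A) < ennreal (e/6)"
    by (rule sets_lebesgue_outer_open[OF AL, of "e/6"]) (use e in simp, assumption)
  obtain T where T: "closed T" "T \<subseteq> A" "A - T \<in> lmeasurable" "emeasure lebesgue (A - T) < ennreal (e/12)"
    by (rule sets_lebesgue_inner_closed[OF AL, of "e/12"]) (use e in simp, assumption)
  have Tf: "emeasure lborel T < \<infinity>"
    using emeasure_mono[OF T(2) A(1)] A(2) by (rule le_less_trans)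
  have Tm: "T \<in> lmeasurable" using Tf T(1) by (auto simp: fmeasurable_def)
  define B where "B n = T - ball 0 (real n)" for n
  have "(\<lambda>n. measure lebesgue (B n)) \<longlonglongrightarrow> measure lebesgue (\<Inter>n. B n)"
  proof (rule Lim_measure_decseq)
    show "range B \<subseteq> sets lebesgue" using T(1) unfolding B_def by auto
    show "decseq B" unfolding decseq_def B_def by (auto simp: subset_iff)
    show "emeasure lebesgue (B i) \<noteq> \<infinity>" for i
    proof -
      have "emeasure lebesgue (B i) \<le> emeasure lebesgue T" 
        using T(1) by (intro emeasure_mono) (auto simp: B_def)
      also have "\<dots> < \<infinity>" using Tf T(1) by simp
      finally show ?thesis by simp
    qed
  qed
  moreover have "(\<Inter>n. B n) = {}"
  proof -
    have "x \<notin> B n" if "norm x < real n" for x n using that by (simp add: B_def)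
    then show ?thesis using reals_Archimedean2 by (metis INT_E UNIV_I ex_in_conv)
  qed
  ultimately have "(\<lambda>n. measure lebesgue (B n)) \<longlonglongrightarrow> 0" by simp
  then have "eventually (\<lambda>n. measure lebesgue (B n) < e/12) sequentially"
    using e by (intro order_tendstoD) auto
  then obtain n where n: "measure lebesgue (B n) < e/12" by (auto simp: eventually_sequentially)
  define C where "C = T \<inter> cball 0 (real n)"
  have C: "compact C" "C \<subseteq> U" "C \<subseteq> A" using T U unfolding C_def by auto
  have UC: "U - C \<subseteq> (U - A) \<union> (A - T) \<union> B n" unfolding C_def B_def by auto
  have Bm: "B n \<in> lmeasurable" using Tm unfolding B_def by (intro fmeasurable_Diff) auto
  have m1: "measure lebesgue (U - A) \<le> e/6" using U(3,4) e
    by (simp add: emeasure_eq_measure2 ennreal_less_iff)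
  have m2: "measure lebesgue (A - T) \<le> e/12" using T(3,4) e
    by (simp add: emeasure_eq_measure2 ennreal_less_iff)
  have "measure lebesgue (U - C) \<le> measure lebesgue ((U - A) \<union> (A - T) \<union> B n)"
    using UC U T Bm C by (intro measure_mono_fmeasurable fmeasurable.Un) 
      (auto simp: borel_compact borel_open)
  also have "\<dots> \<le> measure lebesgue (U - A) + measure lebesgue (A - T) + measure lebesgue (B n)"
    using U T Bm measure_Un_le[of "(U - A) \<union> (A - T)" lebesgue "B n"] measure_Un_le[of "U - A" lebesgue "A - T"]
    by (auto simp: fmeasurable_def)
  also have "\<dots> \<le> e/2" using m1 m2 n e by auto
  finally have mUC: "measure lborel (U - C) \<le> e/2" using U(1) C(1)
    by (metis borel_compact borel_open measure_completion sets.Diff sets_lborel)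
  have UCb: "U - C \<in> sets borel" using U C by (auto simp: borel_compact borel_open)
  have W: "(U - A) \<union> (A - T) \<union> B n \<in> lmeasurable"
    by (intro fmeasurable.Un U(3) T(3) Bm)
  have UCf: "emeasure lborel (U - C) < \<infinity>"
  proof -
    have "emeasure lebesgue (U - C) \<le> emeasure lebesgue ((U - A) \<union> (A - T) \<union> B n)"
      by (rule emeasure_mono[OF UC fmeasurableD[OF W]])
    also have "\<dots> < \<infinity>" 
      unfolding infinity_ennreal_def less_top[symmetric] by (rule fmeasurableD2[OF W])
    finally show ?thesis using UCb by simp
  qed
  obtain d where d0: "d > 0" "(\<Union>x\<in>C. ball x d) \<subseteq> U"
    by (rule compact_subset_open_imp_ball_epsilon_subset[OF C(1) U(1) C(2)])
  then have d: "d > 0" "\<And>x. x \<in> C \<Longrightarrow> ball x d \<subseteq> U" by auto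
  have I: "integrable lborel (indicator (U - C) :: 'a \<Rightarrow> real)"
    using UCb UCf by (intro integrable_real_indicator) auto
  show ?thesis
  proof (intro exI conjI allI impI)
    fix a :: 'a assume a: "norm a < d"
    have Am: "A \<in> sets borel" using A by simp
    have IA [simp]: "integrable lborel (indicator A :: 'a \<Rightarrow> real)" using A by (intro integrable_real_indicator)
    have "(LBINT x. \<bar>indicator A (a + x) - indicator A x\<bar>) \<le>
       (LBINT x. indicat_real (U - C) x + indicator (U - C) (a + x))"
    proof (rule integral_mono)
      show "integrable lborel (\<lambda>x. \<bar>indicator A (a + x) - indicator A x\<bar> :: real)"
        using lborel_integrable_translate[OF IA, of a] by simp
      show "integrable lborel (\<lambda>x. indicator (U - C) x + indicator (U - C) (a + x) :: real)"
        using lborel_integrable_translate[OF I, of a] I by simp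
      fix x
      have 1: "a + x \<in> U" if "x \<in> C" using d(2)[OF that] a by (auto simp: dist_norm subset_iff)
      have 2: "x \<in> U" if "a + x \<in> C" using d(2)[OF that] a by (auto simp: dist_norm subset_iff)
      show "\<bar>indicator A (a + x) - indicator A x\<bar> \<le> (indicator (U - C) x + indicator (U - C) (a + x) :: real)"
        using 1 2 subsetD[OF C(3), of x] subsetD[OF C(3), of "a + x"] subsetD[OF U(2), of x] subsetD[OF U(2), of "a + x"]
        by (cases "x \<in> C"; cases "a + x \<in> C"; cases "x \<in> A"; cases "a + x \<in> A"; simp add: indicator_def)
    qed
    also have "\<dots> = 2 * measure lborel (U - C)"
      using I UCb lborel_integral_translate[of "indicator (U - C) :: 'a \<Rightarrow> real" a]
        lborel_integrable_translate[OF I, of a] by simp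
    finally show "(LBINT x. \<bar>indicator A (a + x) - indicator A x\<bar>) \<le> e" using mUC by simp
  qed (rule d)
qed

lemma L1_translation_continuous:
  fixes f :: "'a::euclidean_space \<Rightarrow> real"
  assumes "integrable lborel f"
  shows "((\<lambda>a. LBINT x. \<bar>f (a + x) - f x\<bar>) \<longlongrightarrow> 0) (at 0)"
proof -
  have "\<forall>e>0. \<exists>d>0. \<forall>a. norm a < d \<longrightarrow> (LBINT x. \<bar>f (a + x) - f x\<bar>) \<le> e"
    using assms
  proof (induction rule: integrable_induct)
    case (base A c)
    show ?case
    proof (intro allI impI)
      fix e :: real assume "e > 0"
      then obtain d where d: "d > 0"
        "\<And>a. norm a < d \<Longrightarrow> (LBINT x. \<bar>indicator A (a + x) - indicator A x\<bar>) \<le> e / (\<bar>c\<bar> + 1)"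
        using L1_translation_indicator[OF base, of "e / (\<bar>c\<bar> + 1)"] by (auto simp: add_nonneg_pos)
      show "\<exists>d>0. \<forall>a. norm a < d \<longrightarrow>
          (LBINT x. \<bar>indicator A (a + x) *\<^sub>R c - indicator A x *\<^sub>R c\<bar>) \<le> e"
      proof (intro exI[of _ d] conjI allI impI d(1))
        fix a :: 'a assume a: "norm a < d"
        have "(LBINT x. \<bar>indicator A (a + x) *\<^sub>R c - indicator A x *\<^sub>R c\<bar>) =
           (LBINT x. \<bar>c\<bar> * \<bar>indicator A (a + x) - indicator A x\<bar>)"
          by (intro Bochner_Integration.integral_cong refl)
            (simp add: abs_mult[symmetric] algebra_simps)
        also have "\<dots> = \<bar>c\<bar> * (LBINT x. \<bar>indicator A (a + x) - indicator A x\<bar>)" by simp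
        also have "\<dots> \<le> \<bar>c\<bar> * (e / (\<bar>c\<bar> + 1))" using d(2)[OF a] by (intro mult_left_mono) auto
        also have "\<dots> \<le> e" using \<open>e > 0\<close> by (simp add: field_simps)
        finally show "(LBINT x. \<bar>indicator A (a + x) *\<^sub>R c - indicator A x *\<^sub>R c\<bar>) \<le> e" .
      qed
    qed
  next
    case (add f g)
    show ?case
    proof (intro allI impI)
      fix e :: real assume "e > 0"
      then have "e/2 > 0" by simp
      from add.IH(1)[rule_format, OF this] obtain d1 where d1: "d1 > 0"
        "\<And>a. norm a < d1 \<Longrightarrow> (LBINT x. \<bar>f (a + x) - f x\<bar>) \<le> e/2" by auto
      from add.IH(2)[rule_format, OF \<open>e/2 > 0\<close>] obtain d2 where d2: "d2 > 0"
        "\<And>a. norm a < d2 \<Longrightarrow> (LBINT x. \<bar>g (a + x) - g x\<bar>) \<le> e/2" by auto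
      show "\<exists>d>0. \<forall>a. norm a < d \<longrightarrow> (LBINT x. \<bar>f (a + x) + g (a + x) - (f x + g x)\<bar>) \<le> e"
      proof (intro exI[of _ "min d1 d2"] conjI allI impI)
        fix a :: 'a assume a: "norm a < min d1 d2"
        note int [simp] = add.hyps add.hyps[THEN lborel_integrable_translate, of a]
        have "(LBINT x. \<bar>f (a + x) + g (a + x) - (f x + g x)\<bar>) \<le>
           (LBINT x. \<bar>f (a + x) - f x\<bar> + \<bar>g (a + x) - g x\<bar>)"
          by (intro integral_mono) simp_all
        also have "\<dots> = (LBINT x. \<bar>f (a + x) - f x\<bar>) + (LBINT x. \<bar>g (a + x) - g x\<bar>)"
          by (intro Bochner_Integration.integral_add) simp_all
        also have "\<dots> \<le> e" using d1(2)[of a] d2(2)[of a] a by auto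
        finally show "(LBINT x. \<bar>f (a + x) + g (a + x) - (f x + g x)\<bar>) \<le> e" .
      qed (use d1 d2 in auto)
    qed
  next
    case (lim f s)
    show ?case
    proof (intro allI impI)
      fix e :: real assume "e > 0"
      have [measurable]: "f \<in> borel_measurable borel" "\<And>i. s i \<in> borel_measurable borel"
        using lim.hyps(1,4) by (auto dest: borel_measurable_integrable)
      have "(\<lambda>i. LBINT x. \<bar>s i x - f x\<bar>) \<longlonglongrightarrow> (\<integral>x. 0 \<partial>(lborel :: 'a measure))"
      proof (rule integral_dominated_convergence[where w="\<lambda>x. 3 * \<bar>f x\<bar>"])
        show "AE x in lborel. (\<lambda>i. \<bar>s i x - f x\<bar>) \<longlonglongrightarrow> 0"
          using lim.hyps(2) by (auto intro!: tendsto_rabs_zero LIM_zero)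
        show "AE x in lborel. norm \<bar>s i x - f x\<bar> \<le> 3 * \<bar>f x\<bar>" for i
        proof (intro AE_I2)
          fix x :: 'a
          show "norm \<bar>s i x - f x\<bar> \<le> 3 * \<bar>f x\<bar>" using lim.hyps(3)[of x i] by auto
        qed
      qed (use lim.hyps in auto)
      then have "eventually (\<lambda>i. (LBINT x. \<bar>s i x - f x\<bar>) < e/3) sequentially"
        using \<open>e > 0\<close> by (intro order_tendstoD) auto
      then obtain i where i: "(LBINT x. \<bar>s i x - f x\<bar>) < e/3" by (auto simp: eventually_sequentially)
      obtain d where d: "d > 0" "\<And>a. norm a < d \<Longrightarrow> (LBINT x. \<bar>s i (a + x) - s i x\<bar>) \<le> e/3"
        using lim.IH[of i, rule_format, of "e/3"] \<open>e > 0\<close> by auto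
      show "\<exists>d>0. \<forall>a. norm a < d \<longrightarrow> (LBINT x. \<bar>f (a + x) - f x\<bar>) \<le> e"
      proof (intro exI[of _ d] conjI allI impI d(1))
        fix a :: 'a assume a: "norm a < d"
        note int [simp] = lim.hyps(1)[of i] lim.hyps(4) lim.hyps(1)[of i, THEN lborel_integrable_translate, of a]
          lim.hyps(4)[THEN lborel_integrable_translate, of a]
        have "(LBINT x. \<bar>f (a + x) - f x\<bar>) \<le>
           (LBINT x. \<bar>s i (a + x) - f (a + x)\<bar> + \<bar>s i (a + x) - s i x\<bar> + \<bar>s i x - f x\<bar>)"
          by (intro integral_mono) simp_all
        also have "\<dots> = (LBINT x. \<bar>s i (a + x) - f (a + x)\<bar>) + 
            (LBINT x. \<bar>s i (a + x) - s i x\<bar>) + (LBINT x. \<bar>s i x - f x\<bar>)"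
          by simp
        also have "(LBINT x. \<bar>s i (a + x) - f (a + x)\<bar>) = (LBINT x. \<bar>s i x - f x\<bar>)"
          by (rule lborel_integral_translate[of "\<lambda>x. \<bar>s i x - f x\<bar>"]) measurable
        also have "\<dots> + (LBINT x. \<bar>s i (a + x) - s i x\<bar>) + (LBINT x. \<bar>s i x - f x\<bar>) \<le> e"
          using i d(2)[OF a] by auto
        finally show "(LBINT x. \<bar>f (a + x) - f x\<bar>) \<le> e" .
      qed
    qed
  qed
  then show ?thesis
  proof (intro tendstoI)
    fix e :: real
    assume *: "\<forall>e>0. \<exists>d>0. \<forall>a. norm a < d \<longrightarrow> (LBINT x. \<bar>f (a + x) - f x\<bar>) \<le> e" and "e > 0"
    then obtain d where d: "d > 0" "\<And>a. norm a < d \<Longrightarrow> (LBINT x. \<bar>f (a + x) - f x\<bar>) \<le> e/2"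
      by (meson half_gt_zero)
    have "dist (LBINT x. \<bar>f (a + x) - f x\<bar>) 0 < e" if "norm a < d" for a
      using d(2)[OF that] \<open>e > 0\<close> by simp
    then show "eventually (\<lambda>a. dist (LBINT x. \<bar>f (a + x) - f x\<bar>) 0 < e) (at 0)"
      unfolding eventually_at using d(1) by (intro exI[of _ d]) auto
  qed
qed

text \<open>
  A substitute for polar coordinates: the integrand is dominated by a sum of multiples of indicators
  of balls, whose volumes are known. Dyadic radii then handle powers of the norm at the origin and at
  infinity.
\<close>

lemma integrable_radial_layers:
  fixes g :: "'a::euclidean_space \<Rightarrow> real"
  assumes [measurable]: "g \<in> borel_measurable borel"
    and nn: "\<And>k. 0 \<le> c k" "\<And>k. 0 \<le> r k"
    and sm: "summable (\<lambda>k. c k * r k ^ DIM('a))"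
    and le: "AE z in lborel. g z = 0 \<or> (\<exists>k::nat. norm z \<le> r k \<and> \<bar>g z\<bar> \<le> c k)"
  shows "integrable lborel g"
proof (rule integrableI_bounded)
  have "(\<integral>\<^sup>+z. ennreal (norm (g z)) \<partial>lborel) \<le> (\<integral>\<^sup>+z. (\<Sum>k. ennreal (c k) * indicator (cball (0::'a) (r k)) z) \<partial>lborel)"
  proof (rule nn_integral_mono_AE, use le in eventually_elim)
    case (elim z)
    show ?case
    proof (cases "g z = 0")
      case False
      then obtain k where k: "norm z \<le> r k" "\<bar>g z\<bar> \<le> c k" using elim by auto
      have "ennreal (norm (g z)) \<le> ennreal (c k) * indicator (cball (0::'a) (r k)) z"
        using k by (auto simp: ennreal_leI)
      also have "\<dots> = (\<Sum>i\<in>{k}. ennreal (c i) * indicator (cball (0::'a) (r i)) z)"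
        by (simp only: sum.insert sum.empty finite.emptyI empty_iff not_False_eq_True add_0_right)
      also have "\<dots> \<le> (\<Sum>k. ennreal (c k) * indicator (cball (0::'a) (r k)) z)"
        by (rule sum_le_suminf) auto
      finally show ?thesis .
    qed auto
  qed
  also have "\<dots> = (\<Sum>k. \<integral>\<^sup>+z. ennreal (c k) * indicator (cball (0::'a) (r k)) z \<partial>lborel)"
    by (rule nn_integral_suminf) (intro borel_measurable_times_ennreal borel_measurable_const borel_measurable_indicator; simp)
  also have "\<dots> = (\<Sum>k. ennreal (unit_ball_vol (DIM('a)) * (c k * r k ^ DIM('a))))"
    using nn by (intro suminf_cong) (auto simp: nn_integral_cmult_indicator emeasure_cball ennreal_mult[symmetric] mult_ac)
  also have "\<dots> = ennreal (\<Sum>k. unit_ball_vol (DIM('a)) * (c k * r k ^ DIM('a)))"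
    using nn by (intro suminf_ennreal2 summable_mult sm) auto
  also have "\<dots> < \<infinity>" by simp
  finally show "(\<integral>\<^sup>+z. ennreal (norm (g z)) \<partial>lborel) < \<infinity>" .
qed simp

lemma integrable_decaying_weight:
  assumes "p > real DIM('a)"
  shows "integrable lborel (\<lambda>z::'a::euclidean_space. (1 + norm z) powr - p)"
proof (rule integrable_radial_layers[where c="\<lambda>k. 2 powr p * (2 ^ k) powr - p" and r="\<lambda>k. 2 ^ k"])
  have "(\<lambda>k. 2 powr p * (2 ^ k) powr - p * (2 ^ k) ^ DIM('a)) = (\<lambda>k. 2 powr p * ((2 powr (DIM('a) - p)) ^ k))"
  proof
    fix k
    have "(2 ^ k) powr - p * (2 ^ k) ^ DIM('a) = (2 powr (DIM('a) - p)) ^ k"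
      by (simp add: powr_realpow[symmetric] powr_powr powr_add[symmetric] algebra_simps)
    then show "2 powr p * (2 ^ k) powr - p * (2 ^ k) ^ DIM('a) = 2 powr p * ((2 powr (DIM('a) - p)) ^ k)"
      by (simp add: mult.assoc)
  qed
  moreover have "(2::real) powr (real DIM('a) - p) < 1" using assms by (simp add: powr_less_one)
  ultimately show "summable (\<lambda>k. 2 powr p * (2 ^ k) powr - p * (2 ^ k) ^ DIM('a))"
    by (simp add: summable_mult summable_geometric)
  show "AE z::'a in lborel. (1 + norm z) powr - p = 0 \<or>
      (\<exists>k. norm z \<le> 2 ^ k \<and> \<bar>(1 + norm z) powr - p\<bar> \<le> 2 powr p * (2 ^ k) powr - p)"
  proof (intro AE_I2 disjI2)
    fix z :: 'a
    have ex: "\<exists>k. norm z \<le> 2 ^ k" by (metis less_imp_le one_less_numeral_iff real_arch_pow semiring_norm(76))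
    define k where "k = (LEAST k. norm z \<le> 2 ^ k)"
    have k: "norm z \<le> 2 ^ k" unfolding k_def using ex by (rule LeastI_ex)
    have p: "p > 0" using assms by (meson less_trans of_nat_0_less_iff DIM_positive)
    have "2 ^ k / 2 \<le> 1 + norm z"
    proof (cases k)
      case 0 then show ?thesis by simp
    next
      case (Suc j)
      then have "\<not> norm z \<le> 2 ^ j" using not_less_Least[of j "\<lambda>k. norm z \<le> 2 ^ k"] by (auto simp: k_def)
      then show ?thesis using Suc by simp
    qed
    then have "(1 + norm z) powr - p \<le> (2 ^ k / 2) powr - p" using p by (intro powr_mono2') auto
    also have "\<dots> = 2 powr p * (2 ^ k) powr - p" by (simp add: powr_divide powr_minus field_simps)
    finally show "\<exists>k. norm z \<le> 2 ^ k \<and> \<bar>(1 + norm z) powr - p\<bar> \<le> 2 powr p * (2 ^ k) powr - p"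
      using k by (intro exI[of _ k]) auto
  qed
qed auto

lemma integrable_norm_powr_cball:
  assumes "q > - real DIM('a)" 
  shows "integrable lborel (\<lambda>z::'a::euclidean_space. indicator (cball 0 1) z * norm z powr q)"
proof (rule integrable_radial_layers[where c="\<lambda>k. 2 powr \<bar>q\<bar> * ((1/2) ^ k) powr q" and r="\<lambda>k. (1/2) ^ k"])
  have "(\<lambda>k. 2 powr \<bar>q\<bar> * ((1/2) ^ k) powr q * ((1/2) ^ k) ^ DIM('a)) = (\<lambda>k. 2 powr \<bar>q\<bar> * (((1/2) powr (DIM('a) + q)) ^ k))"
  proof
    fix k
    have "((1/2) ^ k) powr q * ((1/2) ^ k) ^ DIM('a) = ((1/2::real) powr (DIM('a) + q)) ^ k"
      by (simp add: powr_realpow[symmetric] powr_powr powr_add[symmetric] algebra_simps)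
    then show "2 powr \<bar>q\<bar> * ((1/2) ^ k) powr q * ((1/2) ^ k) ^ DIM('a) = 2 powr \<bar>q\<bar> * (((1/2) powr (DIM('a) + q)) ^ k)"
      by (simp add: mult.assoc)
  qed
  moreover have "(1/2::real) powr (real DIM('a) + q) < 1" using assms
    powr_less_one[of 2 "- (real DIM('a) + q)"] by (simp add: powr_minus powr_divide)
  ultimately show "summable (\<lambda>k. 2 powr \<bar>q\<bar> * ((1/2) ^ k) powr q * ((1/2) ^ k) ^ DIM('a))"
    by (simp add: summable_mult summable_geometric)
  show "AE z::'a in lborel. indicator (cball 0 1) z * norm z powr q = 0 \<or>
      (\<exists>k. norm z \<le> (1/2) ^ k \<and> \<bar>indicator (cball 0 1) z * norm z powr q\<bar> \<le> 2 powr \<bar>q\<bar> * ((1/2) ^ k) powr q)"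
  proof (intro AE_I2)
    fix z :: 'a
    show "indicator (cball 0 1) z * norm z powr q = 0 \<or>
      (\<exists>k. norm z \<le> (1/2) ^ k \<and> \<bar>indicator (cball 0 1) z * norm z powr q\<bar> \<le> 2 powr \<bar>q\<bar> * ((1/2) ^ k) powr q)"
    proof (cases "z = 0 \<or> norm z > 1")
      case False
      then have z: "norm z > 0" "norm z \<le> 1" by auto
      have ex: "\<exists>k. (1/2) ^ Suc k < norm z" 
      proof -
        obtain n where "(1/2) ^ n < norm z" using real_arch_pow_inv[OF z(1), of "1/2"] by auto
        moreover have "(1/2::real) ^ Suc n \<le> (1/2) ^ n" by simp
        ultimately show ?thesis by (intro exI[of _ n]) linarith
      qed
      define k where "k = (LEAST k. (1/2) ^ Suc k < norm z)"
      have k: "(1/2) ^ Suc k < norm z" unfolding k_def using ex by (rule LeastI_ex)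
      have k2: "norm z \<le> (1/2) ^ k"
      proof (cases k)
        case 0 then show ?thesis using z by simp
      next
        case (Suc j)
        then have "\<not> (1/2) ^ Suc j < norm z" using not_less_Least[of j "\<lambda>k. (1/2) ^ Suc k < norm z"] by (auto simp: k_def)
        then show ?thesis using Suc by simp
      qed
      have "norm z powr q \<le> 2 powr \<bar>q\<bar> * ((1/2) ^ k) powr q"
      proof (cases "q \<ge> 0")
        case True
        have "norm z powr q \<le> 1 * ((1/2) ^ k) powr q" using True k2 z by (simp add: powr_mono2)
        also have "\<dots> \<le> 2 powr \<bar>q\<bar> * ((1/2) ^ k) powr q" by (intro mult_right_mono ge_one_powr_ge_zero) auto
        finally show ?thesis .
      next
        case False
        have "norm z powr q \<le> ((1/2) ^ Suc k) powr q" using False k z by (intro powr_mono2') auto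
        also have "\<dots> = 2 powr \<bar>q\<bar> * ((1/2) ^ k) powr q" using False
          by (simp add: powr_mult powr_minus powr_divide field_simps)
        finally show ?thesis .
      qed
      then show ?thesis using k2 z by (intro disjI2 exI[of _ k]) auto
    qed auto
  qed
qed (auto intro!: borel_measurable_times borel_measurable_indicator)

section \<open>Functions of class C2 and mollifiers\<close>

lemma linear_functional_bound:
  fixes F :: "'a::euclidean_space \<Rightarrow> real"
  assumes F: "bounded_linear F" and B: "\<And>b. b \<in> Basis \<Longrightarrow> \<bar>F b\<bar> \<le> B"
  shows "\<bar>F h\<bar> \<le> real DIM('a) * B * norm h"
proof -
  interpret bounded_linear F by (rule F)
  have "F h = F (\<Sum>b\<in>Basis. (h \<bullet> b) *\<^sub>R b)" by (simp add: euclidean_representation)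
  also have "\<dots> = (\<Sum>b\<in>Basis. (h \<bullet> b) * F b)" by (simp add: sum scaleR)
  finally have "\<bar>F h\<bar> \<le> (\<Sum>b\<in>Basis. \<bar>(h \<bullet> b) * F b\<bar>)" by simp
  also have "\<dots> \<le> (\<Sum>b\<in>(Basis::'a set). norm h * B)"
    by (intro sum_mono) (auto simp: abs_mult Basis_le_norm B intro!: mult_mono)
  finally show ?thesis by (simp add: mult_ac)
qed

text \<open>
  The derivative of \<open>t \<mapsto> v (x + t z) + v (x - t z)\<close> is the difference of the gradients at two points of
  distance at most \<open>2 * norm z\<close>, applied to \<open>z\<close>. The dimension enters twice, in passing from
  bounds on second partial derivatives to a Lipschitz bound for each first partial derivative, and
  then to a bound for the whole gradient.
\<close>

lemma second_difference_bound:
  fixes v :: "'a::euclidean_space \<Rightarrow> real"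
  assumes S: "convex S"
    and d1: "\<And>x. x \<in> S \<Longrightarrow> v differentiable (at x)"
    and d2: "\<And>b x. b \<in> Basis \<Longrightarrow> x \<in> S \<Longrightarrow> (\<lambda>x. frechet_derivative v (at x) b) differentiable (at x)"
    and B: "\<And>b b' x. b \<in> Basis \<Longrightarrow> b' \<in> Basis \<Longrightarrow> x \<in> S \<Longrightarrow>
       \<bar>frechet_derivative (\<lambda>x. frechet_derivative v (at x) b) (at x) b'\<bar> \<le> B"
    and xz: "x + z \<in> S" "x - z \<in> S"
  shows "\<bar>v (x + z) + v (x - z) - 2 * v x\<bar> \<le> (2 * (real DIM('a))\<^sup>2 * B) * (norm z)\<^sup>2"
proof -
  define D where "D p = frechet_derivative v (at p)" for p
  have Dv: "(v has_derivative D p) (at p)" if "p \<in> S" for p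
    using d1[OF that] unfolding D_def by (simp add: frechet_derivative_works)
  have lip: "\<bar>D p b - D q b\<bar> \<le> (real DIM('a) * B) * norm (p - q)" if "b \<in> Basis" "p \<in> S" "q \<in> S" for b p q
  proof -
    have "norm (D p b - D q b) \<le> (real DIM('a) * B) * norm (p - q)"
    proof (rule differentiable_bound[OF S])
      fix y assume y: "y \<in> S"
      show "((\<lambda>p. D p b) has_derivative frechet_derivative (\<lambda>p. D p b) (at y)) (at y within S)"
        using d2[OF that(1) y] unfolding D_def frechet_derivative_works
        by (rule has_derivative_at_withinI)
      then have bl: "bounded_linear (frechet_derivative (\<lambda>p. D p b) (at y))"
        by (rule has_derivative_bounded_linear)
      show "onorm (frechet_derivative (\<lambda>p. D p b) (at y)) \<le> real DIM('a) * B"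
      proof (rule onorm_le)
        show "norm (frechet_derivative (\<lambda>p. D p b) (at y) h) \<le> real DIM('a) * B * norm h" for h
          unfolding real_norm_def 
          by (rule linear_functional_bound[OF bl]) (use B[OF that(1) _ y] in \<open>simp add: D_def\<close>)
      qed
    qed (use that in auto)
    then show ?thesis by simp
  qed
  have seg: "x + t *\<^sub>R z \<in> S" "x - t *\<^sub>R z \<in> S" if "0 \<le> t" "t \<le> 1" for t
  proof -
    have "x + t *\<^sub>R z = ((1 + t) / 2) *\<^sub>R (x + z) + ((1 - t) / 2) *\<^sub>R (x - z)"
      "x - t *\<^sub>R z = ((1 - t) / 2) *\<^sub>R (x + z) + ((1 + t) / 2) *\<^sub>R (x - z)"
      by (auto intro!: euclidean_eqI[where 'a='a] simp: inner_add_left inner_diff_left field_simps)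
    then show "x + t *\<^sub>R z \<in> S" "x - t *\<^sub>R z \<in> S"
      using convexD[OF S xz(1,2), of "(1 + t)/2" "(1 - t)/2"] convexD[OF S xz(1,2), of "(1 - t)/2" "(1 + t)/2"] that
      by (simp_all add: add_divide_distrib[symmetric])
  qed
  have "\<exists>t\<in>{0<..<1}. (v (x + 1 *\<^sub>R z) + v (x - 1 *\<^sub>R z)) - (v (x + 0 *\<^sub>R z) + v (x - 0 *\<^sub>R z))
     = (\<lambda>h. D (x + t *\<^sub>R z) (h *\<^sub>R z) + D (x - t *\<^sub>R z) (- (h *\<^sub>R z))) (1 - 0)"
  proof (rule mvt_simple)
    fix t :: real assume t: "0 \<le> t" "t \<le> 1"
    have 1: "((\<lambda>t. v (x + t *\<^sub>R z)) has_derivative (\<lambda>h. D (x + t *\<^sub>R z) (h *\<^sub>R z))) (at t within {0..1})"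
      by (rule has_derivative_compose[where f="\<lambda>t. x + t *\<^sub>R z" and g=v, OF _ Dv])
         (auto intro!: derivative_eq_intros seg t)
    have 2: "((\<lambda>t. v (x - t *\<^sub>R z)) has_derivative (\<lambda>h. D (x - t *\<^sub>R z) (- (h *\<^sub>R z)))) (at t within {0..1})"
      by (rule has_derivative_compose[where f="\<lambda>t. x - t *\<^sub>R z" and g=v, OF _ Dv])
         (auto intro!: derivative_eq_intros seg t)
    show "((\<lambda>t. v (x + t *\<^sub>R z) + v (x - t *\<^sub>R z)) has_derivative
       (\<lambda>h. D (x + t *\<^sub>R z) (h *\<^sub>R z) + D (x - t *\<^sub>R z) (- (h *\<^sub>R z)))) (at t within {0..1})"
      by (rule has_derivative_add[OF 1 2])
  qed simp
  then obtain t where t: "0 < t" "t < 1" 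
    and eq: "v (x + z) + v (x - z) - 2 * v x = D (x + t *\<^sub>R z) z + D (x - t *\<^sub>R z) (- z)" by auto
  have inS: "x + t *\<^sub>R z \<in> S" "x - t *\<^sub>R z \<in> S" using seg t by auto
  have bl: "bounded_linear (D (x + t *\<^sub>R z))" "bounded_linear (D (x - t *\<^sub>R z))"
    using Dv inS has_derivative_bounded_linear by blast+
  have "D (x - t *\<^sub>R z) (- z) = - D (x - t *\<^sub>R z) z"
    using bl(2) by (simp add: linear_neg bounded_linear.linear)
  then have eq2: "v (x + z) + v (x - z) - 2 * v x = D (x + t *\<^sub>R z) z - D (x - t *\<^sub>R z) z" using eq by simp
  have "\<bar>D (x + t *\<^sub>R z) z - D (x - t *\<^sub>R z) z\<bar> \<le> real DIM('a) * (real DIM('a) * B * (2 * norm z)) * norm z"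
  proof (rule linear_functional_bound[where F="\<lambda>h. D (x + t *\<^sub>R z) h - D (x - t *\<^sub>R z) h"])
    show "bounded_linear (\<lambda>h. D (x + t *\<^sub>R z) h - D (x - t *\<^sub>R z) h)" using bl by (rule bounded_linear_sub)
    fix b :: 'a assume b: "b \<in> Basis"
    have nn: "0 \<le> B" using B[OF b b inS(1)] by linarith
    have "\<bar>D (x + t *\<^sub>R z) b - D (x - t *\<^sub>R z) b\<bar> \<le> real DIM('a) * B * norm ((x + t *\<^sub>R z) - (x - t *\<^sub>R z))"
      by (rule lip[OF b inS])
    also have "\<dots> \<le> real DIM('a) * B * (2 * norm z)"
    proof (rule mult_left_mono)
      have "(x + t *\<^sub>R z) - (x - t *\<^sub>R z) = (2 * t) *\<^sub>R z"
        by (rule euclidean_eqI) (simp add: inner_simps)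
      then show "norm ((x + t *\<^sub>R z) - (x - t *\<^sub>R z)) \<le> 2 * norm z"
        using t by (simp add: mult_left_le_one_le)
    qed (use nn in simp)
    finally show "\<bar>D (x + t *\<^sub>R z) b - D (x - t *\<^sub>R z) b\<bar> \<le> real DIM('a) * B * (2 * norm z)" .
  qed
  then show ?thesis unfolding eq2 by (simp add: power2_eq_square mult_ac)
qed

lemma Ck_on_2_iff:
  "Ck_on 2 S v \<longleftrightarrow> (\<forall>x\<in>S. v differentiable (at x)) \<and>
     (\<forall>b\<in>Basis. (\<forall>x\<in>S. (\<lambda>x. frechet_derivative v (at x) b) differentiable (at x)) \<and>
       (\<forall>b'\<in>Basis. continuous_on S (\<lambda>x. frechet_derivative (\<lambda>x. frechet_derivative v (at x) b) (at x) b')))"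
  by (simp add: numeral_2_eq_2)

lemma bounded_second_partials_on_compact:
  fixes v :: "'a::euclidean_space \<Rightarrow> real"
  assumes C: "compact C" and v: "Ck_on 2 C v"
  obtains B where "\<And>b b' x. b \<in> Basis \<Longrightarrow> b' \<in> Basis \<Longrightarrow> x \<in> C \<Longrightarrow>
       \<bar>frechet_derivative (\<lambda>x. frechet_derivative v (at x) b) (at x) b'\<bar> \<le> B"
proof -
  define H where "H b b' x = frechet_derivative (\<lambda>x. frechet_derivative v (at x) b) (at x) b'" for b b' x
  have "\<exists>M. \<forall>x\<in>C. \<bar>H b b' x\<bar> \<le> M" if "b \<in> Basis" "b' \<in> Basis" for b b'
  proof -
    have "continuous_on C (H b b')" using v that unfolding Ck_on_2_iff H_def by blast
    then have "bounded (H b b' ` C)" using C compact_continuous_image compact_imp_bounded by blast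
    then show ?thesis by (auto simp: bounded_iff)
  qed
  then obtain M where M: "\<And>b b' x. b \<in> Basis \<Longrightarrow> b' \<in> Basis \<Longrightarrow> x \<in> C \<Longrightarrow> \<bar>H b b' x\<bar> \<le> M b b'" by metis
  define B where "B = Max ((\<lambda>(b, b'). M b b') ` (Basis \<times> Basis))"
  have "\<bar>H b b' x\<bar> \<le> B" if "b \<in> Basis" "b' \<in> Basis" "x \<in> C" for b b' x
  proof -
    have "M b b' \<le> B" unfolding B_def using that by (intro Max_ge) auto
    then show ?thesis using M[OF that] by linarith
  qed
  then show ?thesis using that unfolding H_def by blast
qed

lemma Ck_on_subset: "Ck_on k S v \<Longrightarrow> T \<subseteq> S \<Longrightarrow> Ck_on k T v"
  by (induction k arbitrary: v) (auto intro: continuous_on_subset)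

lemma C2_second_difference_local:
  fixes v :: "'a::euclidean_space \<Rightarrow> real"
  assumes "open N" "x0 \<in> N" "Ck_on 2 N v"
  obtains r A where "r > 0" "A \<ge> 0" "cball x0 r \<subseteq> N"
    "\<And>x z. x + z \<in> cball x0 r \<Longrightarrow> x - z \<in> cball x0 r \<Longrightarrow>
       \<bar>v (x + z) + v (x - z) - 2 * v x\<bar> \<le> A * (norm z)\<^sup>2"
proof -
  obtain r where r: "r > 0" "cball x0 r \<subseteq> N" using assms open_contains_cball by blast
  have C: "Ck_on 2 (cball x0 r) v" using assms(3) r(2) by (rule Ck_on_subset)
  obtain B where B: "\<And>b b' x. b \<in> Basis \<Longrightarrow> b' \<in> Basis \<Longrightarrow> x \<in> cball x0 r \<Longrightarrow>
       \<bar>frechet_derivative (\<lambda>x. frechet_derivative v (at x) b) (at x) b'\<bar> \<le> B"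
    using bounded_second_partials_on_compact[OF compact_cball C] by blast
  define A where "A = 2 * (real DIM('a))\<^sup>2 * \<bar>B\<bar>"
  show ?thesis
  proof (rule that[of r A])
    fix x z assume "x + z \<in> cball x0 r" "x - z \<in> cball x0 r"
    then show "\<bar>v (x + z) + v (x - z) - 2 * v x\<bar> \<le> A * (norm z)\<^sup>2"
      unfolding A_def using C B unfolding Ck_on_2_iff
      by (intro second_difference_bound[where S="cball x0 r"]) (auto intro: order_trans[OF _ abs_ge_self])
  qed (use r in \<open>auto simp: A_def\<close>)
qed

lemma test_function_second_difference:
  fixes \<eta> :: "'a::euclidean_space \<Rightarrow> real"
  assumes "test_function \<Omega> \<eta>"
  obtains A where "A \<ge> 0" "\<And>x z. \<bar>\<eta> (x + z) + \<eta> (x - z) - 2 * \<eta> x\<bar> \<le> A * (norm z)\<^sup>2"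
proof -
  define C where "C = closure {x. \<eta> x \<noteq> 0}"
  have C: "compact C" and C2: "Ck_on 2 UNIV \<eta>" using assms unfolding test_function_def C_def by auto
  obtain B where B: "\<And>b b' x. b \<in> Basis \<Longrightarrow> b' \<in> Basis \<Longrightarrow> x \<in> C \<Longrightarrow>
       \<bar>frechet_derivative (\<lambda>x. frechet_derivative \<eta> (at x) b) (at x) b'\<bar> \<le> B"
    using bounded_second_partials_on_compact[OF C Ck_on_subset[OF C2]] by blast
  have op: "open (- C)" unfolding C_def by (intro open_Compl closed_closure)
  have z0: "\<eta> x = 0" if "x \<in> - C" for x using that subsetD[OF closure_subset, of x "{x. \<eta> x \<noteq> 0}"] by (auto simp: C_def)
  have z1: "frechet_derivative \<eta> (at x) = (\<lambda>_. 0)" if "x \<in> - C" for x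
  proof -
    have "(\<eta> has_derivative (\<lambda>_. 0)) (at x)"
      by (rule has_derivative_transform_within_open[OF has_derivative_const op that]) (simp add: z0)
    then show ?thesis using frechet_derivative_at by metis
  qed
  have z2: "frechet_derivative (\<lambda>x. frechet_derivative \<eta> (at x) b) (at x) = (\<lambda>_. 0)" if "x \<in> - C" for x b
  proof -
    have "((\<lambda>x. frechet_derivative \<eta> (at x) b) has_derivative (\<lambda>_. 0)) (at x)"
      by (rule has_derivative_transform_within_open[OF has_derivative_const op that]) (simp add: z1)
    then show ?thesis using frechet_derivative_at by metis
  qed
  have B2: "\<bar>frechet_derivative (\<lambda>x. frechet_derivative \<eta> (at x) b) (at x) b'\<bar> \<le> \<bar>B\<bar>"
    if "b \<in> Basis" "b' \<in> Basis" for b b' x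
    using B[OF that, of x] z2[of x b] by (cases "x \<in> C") auto
  show ?thesis
  proof (rule that[of "2 * (real DIM('a))\<^sup>2 * \<bar>B\<bar>"])
    show "\<bar>\<eta> (x + z) + \<eta> (x - z) - 2 * \<eta> x\<bar> \<le> 2 * (real DIM('a))\<^sup>2 * \<bar>B\<bar> * (norm z)\<^sup>2" for x z
      using C2 B2 unfolding Ck_on_2_iff
      by (intro second_difference_bound[where S=UNIV]) auto
  qed simp
qed

lemma test_function_basics:
  fixes \<eta> :: "'a::euclidean_space \<Rightarrow> real"
  assumes "test_function \<Omega> \<eta>"
  shows "continuous_on UNIV \<eta>" "\<exists>M. \<forall>x. \<bar>\<eta> x\<bar> \<le> M" "\<And>x. x \<notin> \<Omega> \<Longrightarrow> \<eta> x = 0"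
proof -
  have "Ck_on 0 UNIV \<eta>" using assms unfolding test_function_def by blast
  then show c: "continuous_on UNIV \<eta>" by simp
  define C where "C = closure {x. \<eta> x \<noteq> 0}"
  have C: "compact C" "C \<subseteq> \<Omega>" using assms unfolding test_function_def C_def by auto
  have z0: "\<eta> x = 0" if "x \<notin> C" for x using that subsetD[OF closure_subset, of x "{x. \<eta> x \<noteq> 0}"] by (auto simp: C_def)
  show "\<eta> x = 0" if "x \<notin> \<Omega>" for x using that C z0 by blast
  have "bounded (\<eta> ` C)" using compact_continuous_image[OF continuous_on_subset[OF c]] C compact_imp_bounded by blast
  then obtain M where M: "\<And>x. x \<in> C \<Longrightarrow> \<bar>\<eta> x\<bar> \<le> M" by (auto simp: bounded_iff)
  have "\<bar>\<eta> x\<bar> \<le> \<bar>M\<bar>" for x using M[of x] z0[of x] by (cases "x \<in> C") auto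
  then show "\<exists>M. \<forall>x. \<bar>\<eta> x\<bar> \<le> M" by blast
qed

text \<open>
  For \<open>p = 1\<close> this is the standard smooth function vanishing to infinite order at \<open>0\<close>. The polynomial
  factor makes the family closed under differentiation.
\<close>

definition flat_exp :: "real poly \<Rightarrow> real \<Rightarrow> real" where
  "flat_exp p t = (if t > 0 then poly p (1 / t) * exp (- (1 / t)) else 0)"

lemma poly_mult_exp_tendsto_0: "((\<lambda>x::real. poly p x * exp (- x)) \<longlongrightarrow> 0) at_top"
proof -
  have "((\<lambda>x::real. \<Sum>i\<le>degree p. coeff p i * (x ^ i / exp x)) \<longlongrightarrow> (\<Sum>i\<le>degree p. coeff p i * 0)) at_top"
    by (intro tendsto_sum tendsto_mult tendsto_const tendsto_power_div_exp_0)
  then show ?thesis by (simp add: poly_altdef exp_minus field_simps sum_divide_distrib)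
qed

lemma flat_exp_has_derivative:
  "(flat_exp p has_real_derivative flat_exp ([:0, 0, 1:] * (p - pderiv p)) t) (at t)"
proof -
  consider "t > 0" | "t < 0" | "t = 0" by linarith
  then show ?thesis
  proof cases
    case 1
    have "((\<lambda>t. poly p (1 / t) * exp (- (1 / t))) has_real_derivative 
       flat_exp ([:0, 0, 1:] * (p - pderiv p)) t) (at t)"
      using 1 unfolding flat_exp_def
      by (auto intro!: derivative_eq_intros poly_DERIV[THEN DERIV_chain2] simp: power2_eq_square divide_simps)
         (simp add: algebra_simps)
    then show ?thesis
      by (rule has_field_derivative_transform_within_open[where S="{0<..}"]) (use 1 in \<open>auto simp: flat_exp_def\<close>)
  next
    case 2
    have "((\<lambda>_. 0) has_real_derivative flat_exp ([:0, 0, 1:] * (p - pderiv p)) t) (at t)"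
      using 2 by (simp add: flat_exp_def)
    then show ?thesis
      by (rule has_field_derivative_transform_within_open[where S="{..<0}"]) (use 2 in \<open>auto simp: flat_exp_def\<close>)
  next
    case 3
    have "((\<lambda>h. flat_exp p h / h) \<longlongrightarrow> 0) (at 0)"
    proof (rule filterlim_split_at)
      have "((\<lambda>h. 0) \<longlongrightarrow> (0::real)) (at_left 0)" by simp
      then show "((\<lambda>h. flat_exp p h / h) \<longlongrightarrow> 0) (at_left 0)"
        by (rule Lim_transform_eventually) (auto simp: flat_exp_def eventually_at_filter)
      have "((\<lambda>x. poly ([:0,1:] * p) (inverse x) * exp (- inverse x)) \<longlongrightarrow> 0) (at_right 0)"
        using filterlim_compose[OF poly_mult_exp_tendsto_0 filterlim_inverse_at_top_right] .
      then show "((\<lambda>h. flat_exp p h / h) \<longlongrightarrow> 0) (at_right 0)"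
        by (rule Lim_transform_eventually) (auto simp: flat_exp_def eventually_at_filter field_simps)
    qed
    then show ?thesis using 3 by (simp add: DERIV_def flat_exp_def)
  qed
qed

text \<open>
  Every member has its partial derivatives in the same set, so a single differentiability statement
  yields derivatives of all orders without computing any of them.
\<close>

inductive_set bump_algebra :: "real \<Rightarrow> 'a \<Rightarrow> ('a::euclidean_space \<Rightarrow> real) set" for e c where
  const: "(\<lambda>x. a) \<in> bump_algebra e c"
| coord: "(\<lambda>x. (x - c) \<bullet> b) \<in> bump_algebra e c"
| flat: "(\<lambda>x. flat_exp p (e\<^sup>2 - (x - c) \<bullet> (x - c))) \<in> bump_algebra e c"
| add: "f \<in> bump_algebra e c \<Longrightarrow> g \<in> bump_algebra e c \<Longrightarrow> (\<lambda>x. f x + g x) \<in> bump_algebra e c"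
| mult: "f \<in> bump_algebra e c \<Longrightarrow> g \<in> bump_algebra e c \<Longrightarrow> (\<lambda>x. f x * g x) \<in> bump_algebra e c"

lemma bump_algebra_derivative:
  assumes "f \<in> bump_algebra e c"
  shows "\<exists>f'. (\<forall>x. (f has_derivative f' x) (at x)) \<and> (\<forall>b. (\<lambda>x. f' x b) \<in> bump_algebra e c)"
  using assms
proof induction
  case (const a)
  show ?case by (rule exI[of _ "\<lambda>_ _. 0"]) (auto intro: bump_algebra.const)
next
  case (coord b)
  show ?case by (rule exI[of _ "\<lambda>_ h. h \<bullet> b"]) (auto intro: bump_algebra.const intro!: derivative_eq_intros)
next
  case (flat p)
  let ?q = "[:0, 0, 1:] * (p - pderiv p)"
  show ?case
  proof (rule exI[of _ "\<lambda>x h. flat_exp ?q (e\<^sup>2 - (x - c) \<bullet> (x - c)) * (- 2 * ((x - c) \<bullet> h))"], intro conjI allI)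
    fix x
    have "((\<lambda>x. e\<^sup>2 - (x - c) \<bullet> (x - c)) has_derivative (\<lambda>h. - 2 * ((x - c) \<bullet> h))) (at x)"
      by (auto intro!: derivative_eq_intros simp: inner_commute)
    from has_derivative_compose[OF this flat_exp_has_derivative[of p, unfolded has_field_derivative_def]]
    show "((\<lambda>x. flat_exp p (e\<^sup>2 - (x - c) \<bullet> (x - c))) has_derivative
       (\<lambda>h. flat_exp ?q (e\<^sup>2 - (x - c) \<bullet> (x - c)) * (- 2 * ((x - c) \<bullet> h)))) (at x)" .
  next
    fix b
    show "(\<lambda>x. flat_exp ?q (e\<^sup>2 - (x - c) \<bullet> (x - c)) * (- 2 * ((x - c) \<bullet> b))) \<in> bump_algebra e c"
      by (intro bump_algebra.mult bump_algebra.flat bump_algebra.const bump_algebra.coord)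
  qed
next
  case (add f g)
  then obtain f' g' where "\<forall>x. (f has_derivative f' x) (at x)" "\<forall>b. (\<lambda>x. f' x b) \<in> bump_algebra e c"
    "\<forall>x. (g has_derivative g' x) (at x)" "\<forall>b. (\<lambda>x. g' x b) \<in> bump_algebra e c" by blast
  then show ?case
    by (intro exI[of _ "\<lambda>x h. f' x h + g' x h"]) (auto intro: bump_algebra.intros has_derivative_add)
next
  case (mult f g)
  then obtain f' g' where fg: "\<forall>x. (f has_derivative f' x) (at x)" "\<forall>b. (\<lambda>x. f' x b) \<in> bump_algebra e c"
    "\<forall>x. (g has_derivative g' x) (at x)" "\<forall>b. (\<lambda>x. g' x b) \<in> bump_algebra e c" by blast
  with mult.hyps have "(\<lambda>x. f x * g' x b + f' x b * g x) \<in> bump_algebra e c" for b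
    by (intro bump_algebra.add[OF bump_algebra.mult bump_algebra.mult]) auto
  moreover have "((\<lambda>x. f x * g x) has_derivative (\<lambda>h. f x * g' x h + f' x h * g x)) (at x)" for x
    using fg by (intro has_derivative_mult) auto
  ultimately show ?case by (intro exI[of _ "\<lambda>x h. f x * g' x h + f' x h * g x"]) auto
qed

lemma bump_algebra_smooth: "f \<in> bump_algebra e c \<Longrightarrow> Ck_on k UNIV f"
proof (induction k arbitrary: f)
  case 0
  then obtain f' where "\<And>x. (f has_derivative f' x) (at x)" using bump_algebra_derivative by blast
  then show ?case by (auto intro!: continuous_at_imp_continuous_on dest: has_derivative_continuous)
next
  case (Suc k)
  then obtain f' where f': "\<And>x. (f has_derivative f' x) (at x)" "\<And>b. (\<lambda>x. f' x b) \<in> bump_algebra e c"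
    using bump_algebra_derivative by blast
  have "frechet_derivative f (at x) = f' x" for x using frechet_derivative_at[OF f'(1)] by simp
  then show ?case using f' Suc.IH by (auto simp: differentiable_def)
qed

lemma mollifier_exists:
  fixes e :: real
  assumes e: "e > 0"
  obtains \<phi> :: "'a::euclidean_space \<Rightarrow> real" where
    "continuous_on UNIV \<phi>" "\<And>x. \<phi> x \<ge> 0" "\<And>x. norm x \<ge> e \<Longrightarrow> \<phi> x = 0"
    "integrable lborel \<phi>" "integral\<^sup>L lborel \<phi> = 1"
    "\<And>c \<Omega>. cball c e \<subseteq> \<Omega> \<Longrightarrow> test_function \<Omega> (\<lambda>x. \<phi> (x - c))"
proof -
  define \<psi> :: "'a \<Rightarrow> real" where "\<psi> x = flat_exp 1 (e\<^sup>2 - x \<bullet> x)" for x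
  have eq: "\<psi> (x - c) = flat_exp 1 (e\<^sup>2 - (x - c) \<bullet> (x - c))" for x c by (simp add: \<psi>_def)
  have mem: "(\<lambda>x. \<psi> (x - c) * a) \<in> bump_algebra e c" for c a
    unfolding eq by (intro bump_algebra.intros)
  have cont: "continuous_on UNIV \<psi>" using bump_algebra_smooth[OF mem[of 0 1], of 0] by simp
  have nn: "\<psi> x \<ge> 0" for x by (simp add: \<psi>_def flat_exp_def)
  have supp: "\<psi> x = 0 \<longleftrightarrow> norm x \<ge> e" for x
  proof -
    have "e\<^sup>2 \<le> (norm x)\<^sup>2 \<longleftrightarrow> e \<le> norm x" using e by (simp add: abs_le_square_iff[symmetric])
    then show ?thesis by (auto simp: \<psi>_def flat_exp_def power2_norm_eq_inner)
  qed
  have "integrable lborel (\<lambda>x. indicator (cball 0 e) x *\<^sub>R \<psi> x)"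
    by (intro borel_integrable_compact continuous_on_subset[OF cont]) auto
  also have "(\<lambda>x. indicator (cball 0 e) x *\<^sub>R \<psi> x) = \<psi>"
    using supp by (force simp: indicator_def)
  finally have int: "integrable lborel \<psi>" .
  have "integral\<^sup>L lborel \<psi> \<noteq> 0"
  proof
    assume "integral\<^sup>L lborel \<psi> = 0"
    then have "AE x in lborel. \<psi> x = 0" using integral_nonneg_eq_0_iff_AE[OF int] nn by auto
    then have "AE x::'a in lborel. x \<notin> ball 0 e" by (simp add: supp not_less)
    then have "ball 0 e \<in> null_sets (lborel :: 'a measure)" by (simp add: AE_iff_null_sets)
    then show False using e by (simp add: null_sets_def emeasure_ball ennreal_eq_0_iff)
        (metis less_irrefl mult_pos_pos unit_ball_vol_pos of_nat_0_le_iff zero_less_power not_less)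
  qed
  then have pos: "integral\<^sup>L lborel \<psi> > 0" using integral_nonneg_AE[of \<psi> lborel] nn by (simp add: less_le)
  show ?thesis
  proof (rule that[of "\<lambda>x. \<psi> x * (1 / integral\<^sup>L lborel \<psi>)"])
    show "test_function \<Omega> (\<lambda>x. \<psi> (x - c) * (1 / integral\<^sup>L lborel \<psi>))" if "cball c e \<subseteq> \<Omega>" for c \<Omega>
    proof -
      have "{x. \<psi> (x - c) * (1 / integral\<^sup>L lborel \<psi>) \<noteq> 0} \<subseteq> cball c e"
      proof
        fix x assume "x \<in> {x. \<psi> (x - c) * (1 / integral\<^sup>L lborel \<psi>) \<noteq> 0}"
        then have "\<psi> (x - c) \<noteq> 0" by simp
        then show "x \<in> cball c e" by (simp add: supp dist_norm norm_minus_commute)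
      qed
      then have sub: "closure {x. \<psi> (x - c) * (1 / integral\<^sup>L lborel \<psi>) \<noteq> 0} \<subseteq> cball c e"
        by (rule closure_minimal) simp
      moreover have "compact (closure {x. \<psi> (x - c) * (1 / integral\<^sup>L lborel \<psi>) \<noteq> 0})"
        using bounded_subset[OF bounded_cball sub] closed_closure compact_eq_bounded_closed by blast
      ultimately show ?thesis unfolding test_function_def
        using bump_algebra_smooth[OF mem[of c]] that by blast
    qed
  qed (use cont nn supp int pos in \<open>auto intro!: continuous_intros\<close>)
qed

lemma Ck_on_cong:
  assumes S: "open S" and eq: "\<And>x. x \<in> S \<Longrightarrow> g x = h x"
  shows "Ck_on k S g \<longleftrightarrow> Ck_on k S h"
  using eq
proof (induction k arbitrary: g h)
  case 0
  then show ?case by (simp cong: continuous_on_cong)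
next
  case (Suc k)
  have der: "(g has_derivative D) (at x) \<longleftrightarrow> (h has_derivative D) (at x)" if "x \<in> S" for x D
    using has_derivative_transform_within_open[OF _ S that, of g D UNIV h]
      has_derivative_transform_within_open[OF _ S that, of h D UNIV g] Suc.prems by auto
  then have "frechet_derivative g (at x) = frechet_derivative h (at x)" if "x \<in> S" for x
    using that by (simp add: frechet_derivative_def)
  then have "Ck_on k S (\<lambda>x. frechet_derivative g (at x) b) = Ck_on k S (\<lambda>x. frechet_derivative h (at x) b)" for b
    by (intro Suc.IH) simp
  moreover have "g differentiable (at x) \<longleftrightarrow> h differentiable (at x)" if "x \<in> S" for x
    using der[OF that] by (simp add: differentiable_def)
  ultimately show ?case by auto
qed

lemma Ck_on_2_paraboloid:
  fixes q x :: "'a::euclidean_space"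
  shows "Ck_on 2 S (\<lambda>y. c + q \<bullet> (y - x) + a * (norm (y - x))\<^sup>2)"
proof -
  let ?Q = "\<lambda>y. c + q \<bullet> (y - x) + a * (norm (y - x))\<^sup>2"
  have D: "(?Q has_derivative (\<lambda>h. q \<bullet> h + 2 * a * ((y - x) \<bullet> h))) (at y)" for y
    unfolding power2_norm_eq_inner
    by (auto intro!: derivative_eq_intros simp: inner_commute algebra_simps)
  have D': "frechet_derivative ?Q (at y) = (\<lambda>h. q \<bullet> h + 2 * a * ((y - x) \<bullet> h))" for y
    using frechet_derivative_at[OF D] by simp
  have E: "((\<lambda>y. q \<bullet> b + 2 * a * ((y - x) \<bullet> b)) has_derivative (\<lambda>h. 2 * a * (h \<bullet> b))) (at y)" for y b
    by (auto intro!: derivative_eq_intros)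
  have E': "frechet_derivative (\<lambda>y. q \<bullet> b + 2 * a * ((y - x) \<bullet> b)) (at y) = (\<lambda>h. 2 * a * (h \<bullet> b))" for y b
    using frechet_derivative_at[OF E] by simp
  show ?thesis
    unfolding Ck_on_2_iff D' E' using D E by (auto simp: differentiable_def)
qed

lemma Ck_on_uminus:
  assumes S: "open S" and v: "Ck_on k S v"
  shows "Ck_on k S (\<lambda>x. - v x)"
  using v
proof (induction k arbitrary: v)
  case 0
  then show ?case by (simp add: continuous_on_minus)
next
  case (Suc k)
  have d: "v differentiable (at x)" if "x \<in> S" for x using Suc.prems that by simp
  have "frechet_derivative (\<lambda>x. - v x) (at x) = (\<lambda>h. - frechet_derivative v (at x) h)" if "x \<in> S" for x
    using frechet_derivative_at[OF has_derivative_minus[OF d[OF that, unfolded frechet_derivative_works]]] by simp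
  then have "Ck_on k S (\<lambda>x. frechet_derivative (\<lambda>x. - v x) (at x) b) \<longleftrightarrow> Ck_on k S (\<lambda>x. - frechet_derivative v (at x) b)" for b
    by (intro Ck_on_cong[OF S]) simp
  moreover have "Ck_on k S (\<lambda>x. - frechet_derivative v (at x) b)" if "b \<in> Basis" for b
    using Suc.prems that by (intro Suc.IH) simp
  ultimately show ?case using d by (simp add: differentiable_minus)
qed

text \<open>
  The last clause makes the translates admissible in the distributional formulation.
\<close>

definition mollifier :: "real \<Rightarrow> ('a::euclidean_space \<Rightarrow> real) \<Rightarrow> bool" where
  "mollifier e \<phi> \<longleftrightarrow> continuous_on UNIV \<phi> \<and> (\<forall>x. 0 \<le> \<phi> x) \<and> (\<forall>x. e \<le> norm x \<longrightarrow> \<phi> x = 0) \<and>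
     integrable lborel \<phi> \<and> integral\<^sup>L lborel \<phi> = 1 \<and>
     (\<forall>c \<Omega>. cball c e \<subseteq> \<Omega> \<longrightarrow> test_function \<Omega> (\<lambda>x. \<phi> (x - c)))"

lemma mollifierD:
  assumes "mollifier e \<phi>"
  shows "continuous_on UNIV \<phi>" "0 \<le> \<phi> x" "e \<le> norm x \<Longrightarrow> \<phi> x = 0" "integrable lborel \<phi>"
    "integral\<^sup>L lborel \<phi> = 1" "cball c e \<subseteq> \<Omega> \<Longrightarrow> test_function \<Omega> (\<lambda>x. \<phi> (x - c))" "\<phi> \<in> borel_measurable borel"
  using assms unfolding mollifier_def by (auto intro: borel_measurable_continuous_onI)

lemma ex_mollifier: "0 < e \<Longrightarrow> \<exists>\<phi> :: 'a::euclidean_space \<Rightarrow> real. mollifier e \<phi>"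
  unfolding mollifier_def by (rule mollifier_exists[of e]) blast+

section \<open>Bounded functions, convolutions and mollification\<close>

definition bounded_borel :: "real \<Rightarrow> ('a::euclidean_space \<Rightarrow> real) \<Rightarrow> bool" where
  "bounded_borel M w \<longleftrightarrow> w \<in> borel_measurable borel \<and> (\<forall>x. \<bar>w x\<bar> \<le> M)"

lemma bounded_borelD:
  assumes "bounded_borel M w"
  shows "w \<in> borel_measurable borel" "\<bar>w x\<bar> \<le> M"
  using assms unfolding bounded_borel_def by auto

lemma bounded_borel_nonneg: "bounded_borel M w \<Longrightarrow> 0 \<le> M"
  unfolding bounded_borel_def by (meson abs_ge_zero order_trans)

lemma bounded_borel_translate: "bounded_borel M w \<Longrightarrow> bounded_borel M (\<lambda>z. w (a + z))"
  unfolding bounded_borel_def by auto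

lemma bounded_borel_reflect: "bounded_borel M w \<Longrightarrow> bounded_borel M (\<lambda>z. w (a - z))"
  unfolding bounded_borel_def by auto

lemma bounded_borel_uminus: "bounded_borel M w \<Longrightarrow> bounded_borel M (\<lambda>z. - w z)"
  unfolding bounded_borel_def by auto

lemma bounded_borel_diff: "bounded_borel M w \<Longrightarrow> bounded_borel M' w' \<Longrightarrow> bounded_borel (M + M') (\<lambda>z. w z - w' z)"
  unfolding bounded_borel_def by (auto intro: order_trans[OF abs_triangle_ineq4 add_mono])

lemma bounded_borel_add: "bounded_borel M w \<Longrightarrow> bounded_borel M' w' \<Longrightarrow> bounded_borel (M + M') (\<lambda>z. w z + w' z)"
  unfolding bounded_borel_def by (auto intro: order_trans[OF abs_triangle_ineq add_mono])

lemma integrable_bounded_mult: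
  fixes k :: "'a::euclidean_space \<Rightarrow> real"
  assumes w: "bounded_borel M w" and k: "integrable lborel k"
  shows "integrable lborel (\<lambda>z. w z * k z)"
proof (rule Bochner_Integration.integrable_bound)
  show "integrable lborel (\<lambda>z. M * k z)" using k by simp
  have [measurable]: "w \<in> borel_measurable borel" "k \<in> borel_measurable borel"
    using w k by (auto simp: bounded_borel_def dest: borel_measurable_integrable)
  show "(\<lambda>z. w z * k z) \<in> borel_measurable lborel" by measurable
  have "\<bar>w z\<bar> \<le> \<bar>M\<bar>" for z using bounded_borelD(2)[OF w, of z] by linarith
  then show "AE z in lborel. norm (w z * k z) \<le> norm (M * k z)"
    by (intro AE_I2) (simp add: abs_mult mult_right_mono)
qed

lemma integral_abs_bounded_mult_le:
  fixes k :: "'a::euclidean_space \<Rightarrow> real"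
  assumes w: "bounded_borel M w" and k: "integrable lborel k" and kn: "\<And>z. 0 \<le> k z"
  shows "\<bar>LBINT z. w z * k z\<bar> \<le> M * integral\<^sup>L lborel k"
proof -
  have "\<bar>LBINT z. w z * k z\<bar> \<le> (LBINT z. \<bar>w z * k z\<bar>)" by (rule integral_abs_bound)
  also have "\<dots> \<le> (LBINT z. M * k z)"
  proof (rule integral_mono)
    show "integrable lborel (\<lambda>z. \<bar>w z * k z\<bar>)" using integrable_bounded_mult[OF w k] by simp
    show "\<bar>w z * k z\<bar> \<le> M * k z" for z
      using bounded_borelD(2)[OF w, of z] kn[of z] by (simp add: abs_mult mult_right_mono)
  qed (use k in simp)
  finally show ?thesis by simp
qed

lemma bounded_borel_abs: "bounded_borel M w \<Longrightarrow> bounded_borel M (\<lambda>z. \<bar>w z\<bar>)"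
  unfolding bounded_borel_def by auto

lemma bounded_times_product_integrable:
  fixes F :: "'a::euclidean_space \<Rightarrow> 'a \<Rightarrow> real"
  assumes F: "(\<lambda>(x, y). F x y) \<in> borel_measurable (lborel \<Otimes>\<^sub>M lborel)" and M: "\<And>x y. \<bar>F x y\<bar> \<le> M"
    and a: "integrable lborel a" and b: "integrable lborel b"
  shows "integrable (lborel \<Otimes>\<^sub>M lborel) (\<lambda>(x, y). F x y * (a x * b y))"
proof (rule lborel_pair.Fubini_integrable)
  have [measurable]: "a \<in> borel_measurable borel" "b \<in> borel_measurable borel"
    using a b by (auto dest: borel_measurable_integrable)
  note [measurable] = F
  have Fx: "bounded_borel M (F x)" for x
  proof -
    have "(\<lambda>y. (\<lambda>(x, y). F x y) (x, y)) \<in> borel_measurable lborel"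
      by (rule measurable_compose[OF _ F]) simp
    then show ?thesis using M by (simp add: bounded_borel_def)
  qed
  show *: "(\<lambda>(x, y). F x y * (a x * b y)) \<in> borel_measurable (lborel \<Otimes>\<^sub>M lborel)"
  proof -
    have "(\<lambda>p. (\<lambda>(x, y). F x y) p * (a (fst p) * b (snd p))) \<in> borel_measurable (lborel \<Otimes>\<^sub>M lborel)" by measurable
    then show ?thesis by (simp add: case_prod_beta')
  qed
  show "AE x in lborel. integrable lborel (\<lambda>y. case (x, y) of (x, y) \<Rightarrow> F x y * (a x * b y))"
  proof (rule AE_I2)
    fix x
    have "integrable lborel (\<lambda>y. a x * (F x y * b y))" by (intro integrable_mult_right integrable_bounded_mult[OF Fx b])
    then show "integrable lborel (\<lambda>y. case (x, y) of (x, y) \<Rightarrow> F x y * (a x * b y))" by (simp add: mult_ac)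
  qed
  show "integrable lborel (\<lambda>x. LBINT y. norm (case (x, y) of (x, y) \<Rightarrow> F x y * (a x * b y)))"
  proof (rule Bochner_Integration.integrable_bound)
    show "integrable lborel (\<lambda>x. (M * (LBINT y. \<bar>b y\<bar>)) * \<bar>a x\<bar>)" using a by simp
    have "(\<lambda>p. norm ((\<lambda>(x, y). F x y * (a x * b y)) p)) \<in> borel_measurable (lborel \<Otimes>\<^sub>M lborel)" using * by measurable
    then show "(\<lambda>x. LBINT y. norm (case (x, y) of (x, y) \<Rightarrow> F x y * (a x * b y))) \<in> borel_measurable lborel"
      by measurable
    show "AE x in lborel. norm (LBINT y. norm (case (x, y) of (x, y) \<Rightarrow> F x y * (a x * b y)))
       \<le> norm ((M * (LBINT y. \<bar>b y\<bar>)) * \<bar>a x\<bar>)"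
    proof (rule AE_I2)
      fix x
      have "bounded_borel M (\<lambda>y. \<bar>F x y\<bar>)" using Fx[of x] by (auto simp: bounded_borel_def)
      then have le: "\<bar>LBINT y. \<bar>F x y\<bar> * \<bar>b y\<bar>\<bar> \<le> M * (LBINT y. \<bar>b y\<bar>)"
        by (rule integral_abs_bounded_mult_le) (use b in auto)
      have "(LBINT y. norm (case (x, y) of (x, y) \<Rightarrow> F x y * (a x * b y))) = (LBINT y. \<bar>a x\<bar> * (\<bar>F x y\<bar> * \<bar>b y\<bar>))"
        by (intro Bochner_Integration.integral_cong refl) (simp add: abs_mult mult_ac)
      also have "\<dots> = \<bar>a x\<bar> * (LBINT y. \<bar>F x y\<bar> * \<bar>b y\<bar>)" by (rule integral_mult_right_zero)
      finally show "norm (LBINT y. norm (case (x, y) of (x, y) \<Rightarrow> F x y * (a x * b y)))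
         \<le> norm ((M * (LBINT y. \<bar>b y\<bar>)) * \<bar>a x\<bar>)"
        using mult_left_mono[OF order_trans[OF le abs_ge_self], of "\<bar>a x\<bar>"]
        by (simp add: abs_mult mult_ac)
    qed
  qed
qed

lemma shifted_product_integrable:
  fixes u \<eta> k :: "'a::euclidean_space \<Rightarrow> real"
  assumes u: "bounded_borel M u" and \<eta>: "integrable lborel \<eta>" and k: "integrable lborel k"
  shows "integrable (lborel \<Otimes>\<^sub>M lborel) (\<lambda>(z, x). u x * \<eta> (x + z) * k z)"
proof (rule lborel_pair.Fubini_integrable)
  have [measurable]: "u \<in> borel_measurable borel" "\<eta> \<in> borel_measurable borel" "k \<in> borel_measurable borel"
    using u \<eta> k by (auto simp: bounded_borel_def dest: borel_measurable_integrable)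
  have \<eta>s: "integrable lborel (\<lambda>x. \<eta> (x + z))" for z
    using lborel_integrable_translate[OF \<eta>, of z] by (simp add: add.commute)
  have M: "0 \<le> M" using u by (rule bounded_borel_nonneg)
  show "(\<lambda>(z, x). u x * \<eta> (x + z) * k z) \<in> borel_measurable (lborel \<Otimes>\<^sub>M lborel)" by measurable
  show "AE z in lborel. integrable lborel (\<lambda>x. case (z, x) of (z, x) \<Rightarrow> u x * \<eta> (x + z) * k z)"
    using integrable_bounded_mult[OF u \<eta>s] by simp
  have n: "norm (case (z, x) of (z, x) \<Rightarrow> u x * \<eta> (x + z) * k z) = \<bar>u x\<bar> * \<bar>\<eta> (x + z)\<bar> * \<bar>k z\<bar>" for z x
    by (simp add: abs_mult)
  show "integrable lborel (\<lambda>z. LBINT x. norm (case (z, x) of (z, x) \<Rightarrow> u x * \<eta> (x + z) * k z))"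
    unfolding n
  proof (rule Bochner_Integration.integrable_bound)
    show "integrable lborel (\<lambda>z. (M * (LBINT x. \<bar>\<eta> x\<bar>)) * \<bar>k z\<bar>)" using k by simp
    show "(\<lambda>z. LBINT x. \<bar>u x\<bar> * \<bar>\<eta> (x + z)\<bar> * \<bar>k z\<bar>) \<in> borel_measurable lborel" by measurable
    show "AE z in lborel. norm (LBINT x. \<bar>u x\<bar> * \<bar>\<eta> (x + z)\<bar> * \<bar>k z\<bar>) \<le> norm ((M * (LBINT x. \<bar>\<eta> x\<bar>)) * \<bar>k z\<bar>)"
    proof (rule AE_I2)
      fix z
      have "\<bar>LBINT x. \<bar>u x\<bar> * \<bar>\<eta> (x + z)\<bar>\<bar> \<le> M * (LBINT x. \<bar>\<eta> (x + z)\<bar>)"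
        by (rule integral_abs_bounded_mult_le[OF bounded_borel_abs[OF u]]) (use \<eta>s in auto)
      also have "(LBINT x. \<bar>\<eta> (x + z)\<bar>) = (LBINT x. \<bar>\<eta> x\<bar>)"
        using lborel_integral_translate[of "\<lambda>x. \<bar>\<eta> x\<bar>" z] by (simp add: add.commute)
      finally show "norm (LBINT x. \<bar>u x\<bar> * \<bar>\<eta> (x + z)\<bar> * \<bar>k z\<bar>) \<le> norm ((M * (LBINT x. \<bar>\<eta> x\<bar>)) * \<bar>k z\<bar>)"
        using M by (simp add: abs_mult mult_right_mono)
    qed
  qed
qed

text \<open>
  The three forms pair \<open>u\<close> with an average of \<open>\<eta>\<close>, average the correlation of \<open>u\<close> with \<open>\<eta>\<close>, and pair
  an average of \<open>u\<close> with \<open>\<eta>\<close>. The first two give the equation of a mollification, the outer two the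
  symmetry of the truncated operators.
\<close>

lemma convolution_Fubini:
  fixes u \<eta> k :: "'a::euclidean_space \<Rightarrow> real"
  assumes u: "bounded_borel M u" and \<eta>: "integrable lborel \<eta>" and k: "integrable lborel k"
  shows "(LBINT x. u x * (LBINT z. \<eta> (x + z) * k z)) = (LBINT z. (LBINT x. u (x - z) * \<eta> x) * k z)"
    and "(LBINT z. (LBINT x. u (x - z) * \<eta> x) * k z) = (LBINT x. (LBINT z. u (x - z) * k z) * \<eta> x)"
proof -
  have [measurable]: "u \<in> borel_measurable borel" "\<eta> \<in> borel_measurable borel"
    using u \<eta> by (auto simp: bounded_borel_def dest: borel_measurable_integrable)
  have shift: "(LBINT x. u x * \<eta> (x + z)) = (LBINT x. u (x - z) * \<eta> x)" for z
    using lborel_integral_translate[of "\<lambda>x. u (x - z) * \<eta> x" z] by (simp add: add.commute)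
  have F: "integrable (lborel \<Otimes>\<^sub>M lborel) (\<lambda>(x, z). u x * \<eta> (x + z) * k z)"
    using lborel_pair.integrable_product_swap[OF shifted_product_integrable[OF u \<eta> k]] by (simp add: case_prod_beta')
  have "integrable (lborel \<Otimes>\<^sub>M lborel) (\<lambda>(z, x). u (x - z) * (k z * \<eta> x))"
    by (rule bounded_times_product_integrable[OF _ bounded_borelD(2)[OF u] k \<eta>]) measurable
  then have G: "integrable (lborel \<Otimes>\<^sub>M lborel) (\<lambda>(z, x). u (x - z) * \<eta> x * k z)" by (simp add: mult_ac)
  have "(LBINT x. u x * (LBINT z. \<eta> (x + z) * k z)) = (LBINT x. (LBINT z. u x * \<eta> (x + z) * k z))"
    by (simp add: mult.assoc)
  also have "\<dots> = (LBINT z. (LBINT x. u x * \<eta> (x + z) * k z))"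
    by (rule lborel_pair.Fubini_integral[symmetric]) (rule F)
  also have "\<dots> = (LBINT z. (LBINT x. u (x - z) * \<eta> x) * k z)" by (simp add: shift)
  finally show "(LBINT x. u x * (LBINT z. \<eta> (x + z) * k z)) = (LBINT z. (LBINT x. u (x - z) * \<eta> x) * k z)" .
  have "(LBINT z. (LBINT x. u (x - z) * \<eta> x) * k z) = (LBINT z. (LBINT x. u (x - z) * \<eta> x * k z))" by simp
  also have "\<dots> = (LBINT x. (LBINT z. u (x - z) * \<eta> x * k z))"
    by (rule lborel_pair.Fubini_integral[symmetric]) (rule G)
  also have "\<dots> = (LBINT x. (LBINT z. (u (x - z) * k z) * \<eta> x))" by (simp add: mult_ac)
  also have "\<dots> = (LBINT x. (LBINT z. u (x - z) * k z) * \<eta> x)" by simp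
  finally show "(LBINT z. (LBINT x. u (x - z) * \<eta> x) * k z) = (LBINT x. (LBINT z. u (x - z) * k z) * \<eta> x)" .
qed

text \<open>
  The integrand is at most \<open>\<bar>(w k) (a + z) - (w k) z\<bar> + M * \<bar>k (a + z) - k z\<bar>\<close>, so translations of the
  merely bounded function \<open>w\<close> are controlled by translations of the integrable functions \<open>w k\<close> and \<open>k\<close>.
\<close>

lemma weighted_translation_continuous:
  fixes w k :: "'a::euclidean_space \<Rightarrow> real"
  assumes w: "bounded_borel M w" and k: "integrable lborel k" and kn: "\<And>z. 0 \<le> k z"
  shows "((\<lambda>a. LBINT z. \<bar>w (a + z) - w z\<bar> * k z) \<longlongrightarrow> 0) (at 0)"
proof (rule tendsto_sandwich)
  let ?h = "\<lambda>z. w z * k z"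
  have h: "integrable lborel ?h" by (rule integrable_bounded_mult[OF w k])
  show "\<forall>\<^sub>F a in at 0. 0 \<le> (LBINT z. \<bar>w (a + z) - w z\<bar> * k z)"
    using kn by (intro always_eventually allI integral_nonneg_AE AE_I2) auto
  show "\<forall>\<^sub>F a in at 0. (LBINT z. \<bar>w (a + z) - w z\<bar> * k z) \<le>
     (LBINT z. \<bar>?h (a + z) - ?h z\<bar>) + M * (LBINT z. \<bar>k (a + z) - k z\<bar>)"
  proof (intro always_eventually allI)
    fix a
    have d: "integrable lborel (\<lambda>z. \<bar>?h (a + z) - ?h z\<bar>)" "integrable lborel (\<lambda>z. \<bar>k (a + z) - k z\<bar>)"
      using lborel_integrable_translate[OF h, of a] h lborel_integrable_translate[OF k, of a] k by auto
    have "bounded_borel (M + M) (\<lambda>z. \<bar>w (a + z) - w z\<bar>)"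
      using bounded_borel_diff[OF bounded_borel_translate[OF w, of a] w] by (auto simp: bounded_borel_def)
    from integrable_bounded_mult[OF this k]
    have "(LBINT z. \<bar>w (a + z) - w z\<bar> * k z) \<le> (LBINT z. \<bar>?h (a + z) - ?h z\<bar> + M * \<bar>k (a + z) - k z\<bar>)"
    proof (rule integral_mono)
      show "integrable lborel (\<lambda>z. \<bar>?h (a + z) - ?h z\<bar> + M * \<bar>k (a + z) - k z\<bar>)"
        using d by simp
      fix z
      have "\<bar>w (a + z) - w z\<bar> * k z = \<bar>(?h (a + z) - ?h z) - w (a + z) * (k (a + z) - k z)\<bar>"
      proof -
        have "\<bar>w (a + z) - w z\<bar> * k z = \<bar>(w (a + z) - w z) * k z\<bar>" using kn[of z] by (simp add: abs_mult)
        then show ?thesis by (simp add: algebra_simps)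
      qed
      also have "\<dots> \<le> \<bar>?h (a + z) - ?h z\<bar> + \<bar>w (a + z)\<bar> * \<bar>k (a + z) - k z\<bar>"
        unfolding abs_mult[symmetric] by (rule abs_triangle_ineq4)
      also have "\<dots> \<le> \<bar>?h (a + z) - ?h z\<bar> + M * \<bar>k (a + z) - k z\<bar>"
        using bounded_borelD(2)[OF w] by (intro add_left_mono mult_right_mono) auto
      finally show "\<bar>w (a + z) - w z\<bar> * k z \<le> \<bar>?h (a + z) - ?h z\<bar> + M * \<bar>k (a + z) - k z\<bar>" .
    qed
    then show "(LBINT z. \<bar>w (a + z) - w z\<bar> * k z) \<le>
     (LBINT z. \<bar>?h (a + z) - ?h z\<bar>) + M * (LBINT z. \<bar>k (a + z) - k z\<bar>)"
      using d by simp
  qed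
  show "((\<lambda>a. (LBINT z. \<bar>?h (a + z) - ?h z\<bar>) + M * (LBINT z. \<bar>k (a + z) - k z\<bar>)) \<longlongrightarrow> 0) (at 0)"
    by (intro tendsto_add_zero tendsto_mult_right_zero L1_translation_continuous h k)
qed simp

definition mollify :: "('a::euclidean_space \<Rightarrow> real) \<Rightarrow> ('a \<Rightarrow> real) \<Rightarrow> 'a \<Rightarrow> real" where
  "mollify \<phi> u y = (LBINT x. u (y + x) * \<phi> x)"

lemma mollify_bounded_borel:
  assumes \<phi>: "mollifier e \<phi>" and u: "bounded_borel M u"
  shows "bounded_borel M (mollify \<phi> u)"
  unfolding bounded_borel_def
proof (intro conjI allI)
  note [measurable] = bounded_borelD(1)[OF u] mollifierD(7)[OF \<phi>]
  show "mollify \<phi> u \<in> borel_measurable borel" unfolding mollify_def[abs_def] by measurable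
  show "\<bar>mollify \<phi> u x\<bar> \<le> M" for x
    using integral_abs_bounded_mult_le[OF bounded_borel_translate[OF u, of x] mollifierD(4)[OF \<phi>] mollifierD(2)[OF \<phi>]]
      mollifierD(5)[OF \<phi>] unfolding mollify_def by simp
qed

lemma mollify_alt:
  assumes \<phi>: "mollifier e \<phi>" and u: "bounded_borel M u"
  shows "mollify \<phi> u y = (LBINT x. u x * \<phi> (x - y))"
proof -
  note [measurable] = bounded_borelD(1)[OF u] mollifierD(7)[OF \<phi>]
  show ?thesis unfolding mollify_def
    using lborel_integral_translate[of "\<lambda>x. u x * \<phi> (x - y)" y] by simp
qed

lemma mollify_continuous:
  assumes \<phi>: "mollifier e \<phi>" and u: "bounded_borel M u"
  shows "continuous_on UNIV (mollify \<phi> u)"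
proof (intro continuous_at_imp_continuous_on ballI)
  fix y :: 'a
  note [measurable] = bounded_borelD(1)[OF u] mollifierD(7)[OF \<phi>]
  have int: "integrable lborel (\<lambda>x. \<phi> (x - y))" for y
    using lborel_integrable_translate[OF mollifierD(4)[OF \<phi>], of "- y"] by simp
  have "\<bar>mollify \<phi> u y' - mollify \<phi> u y\<bar> \<le> M * (LBINT x. \<bar>\<phi> (- (y' - y) + x) - \<phi> x\<bar>)" for y'
  proof -
    have "mollify \<phi> u y' - mollify \<phi> u y = (LBINT x. u x * (\<phi> (x - y') - \<phi> (x - y)))"
      unfolding mollify_alt[OF \<phi> u] using integrable_bounded_mult[OF u int] by (simp add: right_diff_distrib)
    also have "\<bar>\<dots>\<bar> \<le> (LBINT x. \<bar>u x * (\<phi> (x - y') - \<phi> (x - y))\<bar>)" by (rule integral_abs_bound)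
    also have "\<dots> \<le> (LBINT x. M * \<bar>\<phi> (x - y') - \<phi> (x - y)\<bar>)"
    proof (rule integral_mono)
      have "integrable lborel (\<lambda>x. \<phi> (x - y') - \<phi> (x - y))" using int by simp
      from integrable_bounded_mult[OF u this]
      show "integrable lborel (\<lambda>x. \<bar>u x * (\<phi> (x - y') - \<phi> (x - y))\<bar>)" by simp
      show "integrable lborel (\<lambda>x. M * \<bar>\<phi> (x - y') - \<phi> (x - y)\<bar>)" using int by simp
      show "\<bar>u x * (\<phi> (x - y') - \<phi> (x - y))\<bar> \<le> M * \<bar>\<phi> (x - y') - \<phi> (x - y)\<bar>" for x
        unfolding abs_mult by (intro mult_right_mono bounded_borelD(2)[OF u]) simp
    qed
    also have "\<dots> = M * (LBINT x. \<bar>\<phi> (x - y') - \<phi> (x - y)\<bar>)" by simp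
    also have "(LBINT x. \<bar>\<phi> (x - y') - \<phi> (x - y)\<bar>) = (LBINT x. \<bar>\<phi> ((y + x) - y') - \<phi> ((y + x) - y)\<bar>)"
      by (rule lborel_integral_translate[symmetric]) measurable
    finally show ?thesis by (simp add: algebra_simps)
  qed
  then have le: "norm (mollify \<phi> u y' - mollify \<phi> u y) \<le> M * (LBINT x. \<bar>\<phi> (- (y' - y) + x) - \<phi> x\<bar>)" for y' by simp
  have "filterlim (\<lambda>y'. - (y' - y)) (at 0) (at y)"
    by (auto simp: filterlim_at eventually_at_filter intro!: tendsto_eq_intros)
  then have "((\<lambda>y'. M * (LBINT x. \<bar>\<phi> (- (y' - y) + x) - \<phi> x\<bar>)) \<longlongrightarrow> 0) (at y)"
    by (intro tendsto_mult_right_zero filterlim_compose[OF L1_translation_continuous[OF mollifierD(4)[OF \<phi>]]])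
  then have "((\<lambda>y'. mollify \<phi> u y' - mollify \<phi> u y) \<longlongrightarrow> 0) (at y)"
    by (rule Lim_null_comparison[rotated]) (use le in \<open>auto intro!: always_eventually\<close>)
  then show "isCont (mollify \<phi> u) y" unfolding isCont_def by (simp add: LIM_zero_iff)
qed

text \<open>
  Taken with \<open>c = 0\<close> this bounds the mollified right-hand sides, with \<open>c = f y\<close> it gives their
  convergence.
\<close>

lemma mollified_average_near:
  fixes f :: "'a::euclidean_space \<Rightarrow> real"
  assumes \<phi>: "mollifier e \<phi>" and f: "continuous_on (ball 0 1) f" and sub: "ball x e \<subseteq> ball 0 1"
    and near: "\<And>z. z \<in> ball x e \<Longrightarrow> \<bar>f z - c\<bar> \<le> b" and b: "0 \<le> b"
  shows "\<bar>(LBINT z. indicator (ball 0 1) z * (f z * \<phi> (z - x))) - c\<bar> \<le> b"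
proof -
  have int: "integrable lborel (\<lambda>z. \<phi> (z - x))"
    using lborel_integrable_translate[OF mollifierD(4)[OF \<phi>], of "- x"] by simp
  have one: "(LBINT z. \<phi> (z - x)) = 1"
    using lborel_integral_translate[OF mollifierD(7)[OF \<phi>], of "- x"] mollifierD(5)[OF \<phi>] by simp
  define h where "h z = indicator (ball x e) z *\<^sub>R (f z - c)" for z
  have hb: "bounded_borel b h"
    unfolding bounded_borel_def
  proof (intro conjI allI)
    show "h \<in> borel_measurable borel" unfolding h_def
      by (rule borel_measurable_continuous_on_indicator)
        (auto intro!: continuous_on_diff continuous_on_subset[OF f sub])
    show "\<bar>h z\<bar> \<le> b" for z using near[of z] b by (auto simp: h_def indicator_def)
  qed
  have eq: "indicator (ball 0 1) z * (f z * \<phi> (z - x)) = h z * \<phi> (z - x) + c * \<phi> (z - x)" for z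
  proof (cases "z \<in> ball x e")
    case True
    then show ?thesis using sub by (auto simp: h_def algebra_simps subset_iff)
  next
    case False
    then have "\<phi> (z - x) = 0" by (intro mollifierD(3)[OF \<phi>]) (simp add: dist_norm norm_minus_commute)
    then show ?thesis by simp
  qed
  have "(LBINT z. indicator (ball 0 1) z * (f z * \<phi> (z - x))) = (LBINT z. h z * \<phi> (z - x)) + c"
    unfolding eq using integrable_bounded_mult[OF hb int] int one by simp
  moreover have "\<bar>LBINT z. h z * \<phi> (z - x)\<bar> \<le> b"
    using integral_abs_bounded_mult_le[OF hb int mollifierD(2)[OF \<phi>]] one by simp
  ultimately show ?thesis by simp
qed

section \<open>Kernels comparable to the fractional Laplacian\<close>

text \<open>
  Since \<open>0 powr a = 0\<close>, the bounds at the origin say that \<open>K 0 = 0\<close>.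
\<close>

locale levy_kernel =
  fixes K :: "'a::euclidean_space \<Rightarrow> real" and s lam Lam :: real
  assumes s_pos: "0 < s" and s_less: "s < 1" and lam_pos: "0 < lam"
    and K_borel [measurable]: "K \<in> borel_measurable borel"
    and K_sym: "K (- y) = K y"
    and K_lower: "lam * norm y powr - (real DIM('a) + 2 * s) \<le> K y"
    and K_upper: "K y \<le> Lam * norm y powr - (real DIM('a) + 2 * s)"
begin

definition weight :: "'a \<Rightarrow> real" where
  "weight z = (1 + norm z) powr - (real DIM('a) + 2 * s)"

definition trunc_kernel :: "real \<Rightarrow> 'a \<Rightarrow> real" where
  "trunc_kernel r z = indicator {z. r < norm z} z * K z"

definition trunc_op :: "real \<Rightarrow> ('a \<Rightarrow> real) \<Rightarrow> 'a \<Rightarrow> real" where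
  "trunc_op r v x = (LBINT z. (v x - v (x + z)) * trunc_kernel r z)"

definition mass :: "real \<Rightarrow> real" where
  "mass r = integral\<^sup>L lborel (trunc_kernel r)"

definition moment :: "real \<Rightarrow> real" where
  "moment r = (LBINT z. indicator (cball 0 r) z * (norm z)\<^sup>2 * K z)"

abbreviation trunc_avg :: "real \<Rightarrow> ('a \<Rightarrow> real) \<Rightarrow> 'a \<Rightarrow> real" where
  "trunc_avg r v x \<equiv> LBINT z. v (x + z) * trunc_kernel r z"

abbreviation weighted_norm :: "('a \<Rightarrow> real) \<Rightarrow> real" where
  "weighted_norm g \<equiv> LBINT z. \<bar>g z\<bar> * weight z"

text \<open>
  The limit is taken along a fixed sequence of radii, which suffices for one-sided bounds and keeps
  dominated convergence sequential.
\<close>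

abbreviation op_tendsto :: "('a \<Rightarrow> real) \<Rightarrow> 'a \<Rightarrow> real \<Rightarrow> bool" where
  "op_tendsto v x l \<equiv> (\<lambda>n. trunc_op (1 / real (Suc n)) v x) \<longlonglongrightarrow> l"

definition dom_const :: "real \<Rightarrow> real" where
  "dom_const d = Lam * (1 + 2 / d) powr (real DIM('a) + 2 * s)"

lemma K_nonneg: "0 \<le> K y"
  using K_lower[of y] lam_pos by (meson less_imp_le mult_nonneg_nonneg order_trans powr_ge_zero)

lemma lam_le_Lam: "lam \<le> Lam"
proof -
  obtain b :: 'a where b: "b \<in> Basis" using nonempty_Basis by blast
  show ?thesis using K_lower[of b] K_upper[of b] b by simp
qed

lemma Lam_pos: "0 < Lam"
  using lam_le_Lam lam_pos by simp

lemma weight_pos: "0 < weight z"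
  unfolding weight_def by (simp add: add_nonneg_eq_0_iff)

lemma weight_nonneg: "0 \<le> weight z"
  using weight_pos[of z] by simp

lemma weight_integrable: "integrable lborel weight"
proof -
  have "weight = (\<lambda>z. (1 + norm z) powr - (real DIM('a) + 2 * s))" by (simp add: weight_def fun_eq_iff)
  then show ?thesis using integrable_decaying_weight[where 'a='a, of "real DIM('a) + 2 * s"] s_pos by simp
qed

lemma weight_borel [measurable]: "weight \<in> borel_measurable borel"
  unfolding weight_def by measurable

lemma trunc_kernel_nonneg: "0 \<le> trunc_kernel r z"
  by (simp add: trunc_kernel_def K_nonneg)

lemma trunc_kernel_sym: "trunc_kernel r (- z) = trunc_kernel r z"
  by (simp add: trunc_kernel_def K_sym indicator_def)

lemma trunc_kernel_borel [measurable]: "trunc_kernel r \<in> borel_measurable borel"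
proof -
  have "{z::'a. r < norm z} \<in> sets borel" by measurable
  then show ?thesis unfolding trunc_kernel_def by measurable
qed

lemma dom_const_nonneg: "0 \<le> dom_const d"
  unfolding dom_const_def using Lam_pos by simp

text \<open>
  If \<open>norm (z - y)\<close> exceeds \<open>d\<close>, it is comparable to \<open>1 + norm z\<close> uniformly in \<open>y\<close> in the unit ball. So one
  integrable weight dominates all translates of the truncated kernel that occur below.
\<close>

lemma trunc_kernel_le_weight:
  assumes d: "0 < d" and y: "norm y \<le> 1"
  shows "trunc_kernel d (z - y) \<le> dom_const d * weight z"
proof (cases "d < norm (z - y)")
  case True
  let ?p = "real DIM('a) + 2 * s"
  have "1 + norm z \<le> 1 + (norm (z - y) + norm y)" using norm_triangle_ineq[of "z - y" y] by simp
  also have "\<dots> \<le> norm (z - y) + 2" using y by simp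
  also have "2 \<le> (2 / d) * norm (z - y)" using True d by (simp add: field_simps)
  finally have le: "(1 + norm z) / (1 + 2 / d) \<le> norm (z - y)" using d by (simp add: field_simps)
  have "trunc_kernel d (z - y) \<le> Lam * norm (z - y) powr - ?p"
    using True K_upper[of "z - y"] by (simp add: trunc_kernel_def)
  also have "\<dots> \<le> Lam * ((1 + norm z) / (1 + 2 / d)) powr - ?p"
    using le d Lam_pos s_pos by (intro mult_left_mono powr_mono2') (auto simp: add_pos_nonneg)
  also have "((1 + norm z) / (1 + 2 / d)) powr - ?p = (1 + 2 / d) powr ?p * weight z"
  proof -
    have "((1 + norm z) / (1 + 2 / d)) powr - q = (1 + 2 / d) powr q * (1 + norm z) powr - q" for q
      using d by (subst powr_divide) (auto simp: powr_minus divide_inverse)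
    then show ?thesis by (simp only: weight_def)
  qed
  finally show ?thesis by (simp add: dom_const_def mult.assoc)
next
  case False
  then show ?thesis using dom_const_nonneg[of d] weight_nonneg[of z] by (simp add: trunc_kernel_def)
qed

lemma trunc_kernel_integrable:
  assumes "0 < d"
  shows "integrable lborel (trunc_kernel d)"
proof (rule Bochner_Integration.integrable_bound)
  show "integrable lborel (\<lambda>z. dom_const d * weight z)" using weight_integrable by simp
  show "AE z in lborel. norm (trunc_kernel d z) \<le> norm (dom_const d * weight z)"
    using trunc_kernel_le_weight[OF assms, of 0] trunc_kernel_nonneg
    by (intro AE_I2) (simp add: dom_const_nonneg weight_nonneg)
qed simp

lemma mass_nonneg: "0 \<le> mass d"
  unfolding mass_def using trunc_kernel_nonneg by simp

lemma moment_integrable_1: "integrable lborel (\<lambda>z. indicator (cball 0 1) z * (norm z)\<^sup>2 * K z)"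
proof (rule Bochner_Integration.integrable_bound)
  let ?p = "real DIM('a) + 2 * s"
  show "integrable lborel (\<lambda>z::'a. Lam * (indicator (cball 0 1) z * norm z powr (2 - ?p)))"
    using s_less by (intro integrable_mult_right integrable_norm_powr_cball) simp
  show "(\<lambda>z. indicator (cball 0 1) z * (norm z)\<^sup>2 * K z) \<in> borel_measurable lborel"
    by (simp add: borel_measurable_indicator borel_measurable_times)
  show "AE z in lborel. norm (indicator (cball 0 1) z * (norm z)\<^sup>2 * K z) \<le>
       norm (Lam * (indicator (cball 0 1) z * norm z powr (2 - ?p)))"
  proof (rule AE_I2)
    fix z :: 'a
    have "(norm z)\<^sup>2 * K z \<le> Lam * norm z powr (2 - ?p)"
    proof (cases "z = 0")
      case False
      have "(norm z)\<^sup>2 * K z \<le> (norm z)\<^sup>2 * (Lam * norm z powr - ?p)"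
        by (intro mult_left_mono K_upper) auto
      also have "\<dots> = Lam * (norm z powr 2 * norm z powr - ?p)" using False by (simp add: powr_numeral)
      also have "norm z powr 2 * norm z powr - ?p = norm z powr (2 - ?p)"
        by (simp only: powr_add[symmetric] diff_conv_add_uminus)
      finally show ?thesis .
    qed simp
    then show "norm (indicator (cball 0 1) z * (norm z)\<^sup>2 * K z) \<le>
       norm (Lam * (indicator (cball 0 1) z * norm z powr (2 - ?p)))"
      using K_nonneg[of z] Lam_pos by (simp add: indicator_def abs_mult)
  qed
qed

lemma moment_integrable:
  assumes "r \<le> 1"
  shows "integrable lborel (\<lambda>z. indicator (cball 0 r) z * (norm z)\<^sup>2 * K z)"
proof (rule Bochner_Integration.integrable_bound[OF moment_integrable_1])
  show "(\<lambda>z. indicator (cball 0 r) z * (norm z)\<^sup>2 * K z) \<in> borel_measurable lborel"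
    by (simp add: borel_measurable_indicator borel_measurable_times)
  show "AE z in lborel. norm (indicator (cball 0 r) z * (norm z)\<^sup>2 * K z) \<le>
       norm (indicator (cball 0 1) z * (norm z)\<^sup>2 * K z)"
    using assms K_nonneg by (intro AE_I2) (simp add: indicator_def)
qed

lemma moment_nonneg: "0 \<le> moment r"
  unfolding moment_def using K_nonneg by (intro integral_nonneg_AE AE_I2) (simp add: indicator_def)

lemma moment_mono: "r \<le> r' \<Longrightarrow> r' \<le> 1 \<Longrightarrow> moment r \<le> moment r'"
  unfolding moment_def using K_nonneg by (intro integral_mono moment_integrable) (auto simp: indicator_def)

lemma moment_seq_tendsto_0: "(\<lambda>n. moment (1 / real (Suc n))) \<longlonglongrightarrow> 0"
proof -
  have "(\<lambda>n. LBINT z. indicator (cball 0 (1 / real (Suc n))) z * (norm z)\<^sup>2 * K z) \<longlonglongrightarrow> (\<integral>z. 0 \<partial>(lborel :: 'a measure))"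
  proof (rule integral_dominated_convergence[OF _ _ moment_integrable_1])
    show "AE z in lborel. norm (indicator (cball 0 (1 / real (Suc n))) z * (norm z)\<^sup>2 * K z) \<le>
       indicator (cball 0 1) z * (norm z)\<^sup>2 * K z" for n
    proof (rule AE_I2)
      fix z :: 'a
      have "cball (0::'a) (1 / real (Suc n)) \<subseteq> cball 0 1" by (intro subset_cball) simp
      then have "indicator (cball (0::'a) (1 / real (Suc n))) z \<le> (indicator (cball 0 1) z :: real)"
        by (auto simp: indicator_def)
      then show "norm (indicator (cball 0 (1 / real (Suc n))) z * (norm z)\<^sup>2 * K z) \<le>
       indicator (cball 0 1) z * (norm z)\<^sup>2 * K z"
        using K_nonneg[of z] by (simp add: mult_right_mono)
    qed
    show "AE z in lborel. (\<lambda>n. indicator (cball 0 (1 / real (Suc n))) z * (norm z)\<^sup>2 * K z) \<longlonglongrightarrow> 0"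
    proof (rule AE_I2)
      fix z :: 'a
      show "(\<lambda>n. indicator (cball 0 (1 / real (Suc n))) z * (norm z)\<^sup>2 * K z) \<longlonglongrightarrow> 0"
      proof (cases "z = 0")
        case False
        then obtain n where n: "1 / real (Suc n) < norm z" using nat_approx_posE[of "norm z"] by (metis zero_less_norm_iff)
        have "\<forall>\<^sub>F m in sequentially. indicator (cball 0 (1 / real (Suc m))) z * (norm z)\<^sup>2 * K z = 0"
          using eventually_ge_at_top[of n]
        proof eventually_elim
          case (elim m)
          then have "1 / real (Suc m) \<le> 1 / real (Suc n)" by (simp add: frac_le)
          then have "z \<notin> cball 0 (1 / real (Suc m))" using n by simp
          then show ?case by simp
        qed
        then show ?thesis by (rule tendsto_eventually)
      qed simp
    qed
  qed (simp_all add: borel_measurable_indicator borel_measurable_times)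
  then show ?thesis unfolding moment_def by simp
qed

lemma moment_tendsto_0: "(moment \<longlongrightarrow> 0) (at_right 0)"
proof (rule tendstoI)
  fix e :: real assume "e > 0"
  then have "\<forall>\<^sub>F n in sequentially. moment (1 / real (Suc n)) < e"
    using moment_seq_tendsto_0 by (intro order_tendstoD) auto
  then obtain n where n: "moment (1 / real (Suc n)) < e" by (auto simp: eventually_sequentially)
  have "\<forall>\<^sub>F r in at_right 0. r \<in> {0<..<1 / real (Suc n)}"
    by (rule eventually_at_right_real) simp
  then show "\<forall>\<^sub>F r in at_right 0. dist (moment r) 0 < e"
  proof eventually_elim
    case (elim r)
    then have "moment r \<le> moment (1 / real (Suc n))" by (intro moment_mono) auto
    then show ?case using n moment_nonneg[of r] by simp
  qed
qed

text \<open>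
  The annulus between the radii \<open>d\<close> and \<open>2 d\<close> alone carries a mass of order \<open>d powr (- 2 s)\<close>.
\<close>

lemma mass_unbounded: "\<exists>d. 0 < d \<and> d \<le> 1 \<and> M \<le> mass d"
proof -
  let ?p = "real DIM('a) + 2 * s"
  define V where "V = unit_ball_vol (real DIM('a))"
  have V: "V > 0" unfolding V_def by simp
  define c where "c = lam * 2 powr - ?p * V"
  have c: "c > 0" unfolding c_def using lam_pos V by simp
  \<comment> \<open>The mass outside radius \<open>d\<close> is at least \<open>c * d powr - (2 * s)\<close>, which for the radius below is \<open>c * B \<ge> M\<close>.\<close>
  define B where "B = max 1 (M / c)"
  define d where "d = B powr - (1 / (2 * s))"
  have B: "B \<ge> 1" "M / c \<le> B" unfolding B_def by auto
  have d0: "d > 0" unfolding d_def using B by simp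
  have d1: "d \<le> 1"
  proof -
    have "B powr - (1 / (2 * s)) \<le> 1 powr - (1 / (2 * s))" using B s_pos by (intro powr_mono2') auto
    then show ?thesis by (simp add: d_def)
  qed
  have dB: "d powr - (2 * s) = B" unfolding d_def powr_powr using s_pos B by simp
  define A where "A = ball (0::'a) (2 * d) - cball 0 d"
  have Am: "A \<in> sets borel" unfolding A_def by simp
  have Af: "emeasure lborel A < \<infinity>"
    using emeasure_mono[of A "ball 0 (2 * d)" lborel] emeasure_lborel_ball_finite[of "0::'a" "2 * d"]
    unfolding A_def by (auto intro: le_less_trans)
  have "measure lborel A = measure lborel (ball (0::'a) (2 * d)) - measure lborel (cball (0::'a) d)"
    unfolding A_def using d0 emeasure_lborel_ball_finite[of "0::'a" "2 * d"]
    by (intro measure_Diff) (auto simp: less_top)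
  also have "\<dots> = V * ((2 * d) ^ DIM('a) - d ^ DIM('a))"
    unfolding V_def using d0 by (simp add: content_ball content_cball algebra_simps)
  also have "\<dots> \<ge> V * d ^ DIM('a)"
  proof (rule mult_left_mono)
    have "2 * d ^ DIM('a) \<le> 2 ^ DIM('a) * d ^ DIM('a)"
      using d0 power_increasing[of 1 "DIM('a)" "2::real"] DIM_positive[where 'a='a]
      by (intro mult_right_mono) auto
    then show "d ^ DIM('a) \<le> (2 * d) ^ DIM('a) - d ^ DIM('a)" by (simp add: power_mult_distrib)
  qed (use V in simp)
  finally have mA: "V * d ^ DIM('a) \<le> measure lborel A" .
  have "M \<le> c * B" using B(2) c by (simp add: field_simps)
  also have "\<dots> = (lam * (2 * d) powr - ?p) * (V * d ^ DIM('a))"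
  proof -
    have "d powr - ?p * d ^ DIM('a) = d powr - (2 * s)"
      using d0 by (simp add: powr_realpow[symmetric] powr_add[symmetric])
    then show ?thesis unfolding c_def dB[symmetric] using d0 by (simp add: powr_mult)
  qed
  also have "\<dots> \<le> (lam * (2 * d) powr - ?p) * measure lborel A"
    using mA lam_pos by (intro mult_left_mono) auto
  also have "\<dots> = (LBINT z. (lam * (2 * d) powr - ?p) * indicator A z)"
    using Am by simp
  also have "\<dots> \<le> mass d"
    unfolding mass_def
  proof (rule integral_mono[OF _ trunc_kernel_integrable[OF d0]])
    show "integrable lborel (\<lambda>z. (lam * (2 * d) powr - ?p) * indicator A z)"
      using Am Af by (intro integrable_mult_right integrable_real_indicator) auto
    fix z :: 'a
    show "(lam * (2 * d) powr - ?p) * indicator A z \<le> trunc_kernel d z"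
    proof (cases "z \<in> A")
      case True
      then have z: "d < norm z" "norm z \<le> 2 * d" unfolding A_def by auto
      have "lam * (2 * d) powr - ?p \<le> lam * norm z powr - ?p"
        using z d0 s_pos lam_pos by (intro mult_left_mono powr_mono2') auto
      also have "\<dots> \<le> K z" by (rule K_lower)
      finally show ?thesis using z True by (simp add: trunc_kernel_def)
    qed (simp add: trunc_kernel_nonneg)
  qed
  finally show ?thesis using d0 d1 by blast
qed

lemma trunc_avg_integrable:
  assumes "bounded_borel M v" "0 < d"
  shows "integrable lborel (\<lambda>z. v (x + z) * trunc_kernel d z)"
  by (rule integrable_bounded_mult[OF bounded_borel_translate[OF assms(1)] trunc_kernel_integrable[OF assms(2)]])

lemma trunc_op_integrable:
  assumes "bounded_borel M v" "0 < d"
  shows "integrable lborel (\<lambda>z. (v x - v (x + z)) * trunc_kernel d z)"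
  using trunc_avg_integrable[OF assms] trunc_kernel_integrable[OF assms(2)] by (simp add: left_diff_distrib)

lemma trunc_op_eq:
  assumes v: "bounded_borel M v" and d: "0 < d"
  shows "trunc_op d v x = v x * mass d - (trunc_avg d v x)"
  using integrable_bounded_mult[OF bounded_borel_translate[OF v, of x] trunc_kernel_integrable[OF d]]
    trunc_kernel_integrable[OF d]
  unfolding trunc_op_def mass_def by (simp add: left_diff_distrib)

lemma trunc_op_uminus: "trunc_op d (\<lambda>x. - v x) x = - trunc_op d v x"
proof -
  have "trunc_op d (\<lambda>x. - v x) x = (LBINT z. - ((v x - v (x + z)) * trunc_kernel d z))"
    unfolding trunc_op_def by (intro Bochner_Integration.integral_cong) (auto simp: algebra_simps)
  then show ?thesis unfolding trunc_op_def by simp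
qed

lemma trunc_integral_le_weighted:
  assumes g: "bounded_borel M g" and d: "0 < d" and x: "norm x \<le> 1"
  shows "\<bar>trunc_avg d g x\<bar> \<le> dom_const d * (weighted_norm g)"
proof -
  note [measurable] = bounded_borelD(1)[OF g]
  have ga: "bounded_borel M (\<lambda>z. \<bar>g z\<bar>)" using g by (auto simp: bounded_borel_def)
  have k: "integrable lborel (\<lambda>z. trunc_kernel d (z - x))"
    using lborel_integrable_translate[OF trunc_kernel_integrable[OF d], of "- x"] by simp
  have "\<bar>trunc_avg d g x\<bar> \<le> (LBINT z. \<bar>g (x + z) * trunc_kernel d z\<bar>)"
    by (rule integral_abs_bound)
  also have "\<dots> = (LBINT z. \<bar>g (x + z)\<bar> * trunc_kernel d ((x + z) - x))"
    by (simp add: abs_mult trunc_kernel_nonneg)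
  also have "\<dots> = (LBINT z. \<bar>g z\<bar> * trunc_kernel d (z - x))"
    by (rule lborel_integral_translate[of "\<lambda>z. \<bar>g z\<bar> * trunc_kernel d (z - x)"]) measurable
  also have "\<dots> \<le> (LBINT z. \<bar>g z\<bar> * (dom_const d * weight z))"
    using trunc_kernel_le_weight[OF d x]
    by (intro integral_mono integrable_bounded_mult[OF ga] k mult_left_mono integrable_mult_right weight_integrable) auto
  also have "\<dots> = dom_const d * (weighted_norm g)" by (simp only: mult.left_commute[of _ "dom_const d"] integral_mult_right_zero)
  finally show ?thesis .
qed

definition shift_modulus :: "('a \<Rightarrow> real) \<Rightarrow> 'a \<Rightarrow> real" where
  "shift_modulus w a = (LBINT z. \<bar>w (a + z) - w z\<bar> * weight z)"

lemma shift_modulus_tendsto_0: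
  assumes "bounded_borel M w"
  shows "(shift_modulus w \<longlongrightarrow> 0) (at 0)"
  unfolding shift_modulus_def[abs_def]
  by (rule weighted_translation_continuous[OF assms weight_integrable weight_nonneg])

lemma shift_modulus_small:
  assumes w: "bounded_borel M w" and e: "0 < e"
  shows "\<exists>d>0. \<forall>a. norm a < d \<longrightarrow> shift_modulus w a < e"
proof -
  have "\<forall>\<^sub>F a in at 0. shift_modulus w a < e"
    using shift_modulus_tendsto_0[OF w] e by (intro order_tendstoD) auto
  then obtain d where d: "d > 0" "\<And>a. a \<noteq> 0 \<Longrightarrow> norm a < d \<Longrightarrow> shift_modulus w a < e"
    unfolding eventually_at by auto
  have "shift_modulus w a < e" if "norm a < d" for a
    using d(2)[of a] that e by (cases "a = 0") (auto simp: shift_modulus_def)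
  then show ?thesis using d(1) by blast
qed

lemma trunc_integral_shift_le:
  assumes v: "bounded_borel M v" and d: "0 < d" and y: "norm y \<le> 1"
  shows "\<bar>(trunc_avg d v x) - (trunc_avg d v y)\<bar>
    \<le> dom_const d * shift_modulus v (x - y)"
proof -
  note int = trunc_avg_integrable[OF v d]
  have "bounded_borel (M + M) (\<lambda>z. v ((x - y) + z) - v z)"
    by (rule bounded_borel_diff[OF bounded_borel_translate[OF v] v])
  from trunc_integral_le_weighted[OF this d y]
  have "\<bar>LBINT z. (v ((x - y) + (y + z)) - v (y + z)) * trunc_kernel d z\<bar> \<le> dom_const d * shift_modulus v (x - y)"
    unfolding shift_modulus_def .
  also have "(LBINT z. (v ((x - y) + (y + z)) - v (y + z)) * trunc_kernel d z)
     = (trunc_avg d v x) - (trunc_avg d v y)"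
    using int by (simp add: left_diff_distrib)
  finally show ?thesis .
qed

lemma trunc_integral_continuous:
  assumes v: "bounded_borel M v" and d: "0 < d"
  shows "continuous_on (ball 0 1) (\<lambda>x. trunc_avg d v x)"
proof (intro continuous_at_imp_continuous_on ballI)
  fix y :: 'a assume "y \<in> ball 0 1"
  then have y: "norm y \<le> 1" by simp
  have "((\<lambda>x. dom_const d * shift_modulus v (x - y)) \<longlongrightarrow> 0) (at y)"
    using shift_modulus_tendsto_0[OF v] by (intro tendsto_mult_right_zero LIM_offset_zero_cancel[where a=y]) simp
  then have "((\<lambda>x. (trunc_avg d v x) - (trunc_avg d v y)) \<longlongrightarrow> 0) (at y)"
    by (rule Lim_null_comparison[rotated]) (use trunc_integral_shift_le[OF v d y] in \<open>auto intro!: always_eventually\<close>)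
  then show "isCont (\<lambda>x. trunc_avg d v x) y"
    unfolding isCont_def by (simp add: LIM_zero_iff)
qed

lemma trunc_op_symmetrized:
  assumes v: "bounded_borel M v" and r: "0 < r"
  shows "trunc_op r v x = (LBINT z. (2 * v x - v (x + z) - v (x - z)) * trunc_kernel r z) / 2"
proof -
  note [measurable] = bounded_borelD(1)[OF v]
  note int = integrable_bounded_mult[OF bounded_borel_translate[OF v, of x] trunc_kernel_integrable[OF r]]
    integrable_bounded_mult[OF bounded_borel_reflect[OF v, of x] trunc_kernel_integrable[OF r]]
    trunc_kernel_integrable[OF r]
  have "trunc_op r v x = (LBINT z. (v x - v (x + - z)) * trunc_kernel r (- z))"
    unfolding trunc_op_def by (rule lborel_integral_reflect[symmetric]) measurable
  also have "\<dots> = (LBINT z. (v x - v (x - z)) * trunc_kernel r z)" by (simp add: trunc_kernel_sym)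
  finally have "2 * trunc_op r v x = (LBINT z. (v x - v (x + z)) * trunc_kernel r z) + (LBINT z. (v x - v (x - z)) * trunc_kernel r z)"
    by (simp add: trunc_op_def)
  also have "\<dots> = (LBINT z. (v x - v (x + z)) * trunc_kernel r z + (v x - v (x - z)) * trunc_kernel r z)"
    using int by (intro Bochner_Integration.integral_add[symmetric]) (simp_all add: left_diff_distrib)
  also have "\<dots> = (LBINT z. (2 * v x - v (x + z) - v (x - z)) * trunc_kernel r z)"
    by (intro Bochner_Integration.integral_cong refl) (simp add: algebra_simps)
  finally show ?thesis by simp
qed

text \<open>
  The difference of the two operators is an integral of the symmetrized second difference over jumps
  of length between \<open>r\<close> and \<open>d\<close>. A one-sided bound on second differences at \<open>x\<close> is thus all the
  regularity that a maximum principle for truncated operators requires, and the error does not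
  depend on \<open>r\<close>.
\<close>

lemma trunc_op_touching:
  assumes v: "bounded_borel M v" and r: "0 < r" "r \<le> d" "d \<le> 1"
    and sd: "\<And>z. norm z \<le> d \<Longrightarrow> v (x + z) + v (x - z) - 2 * v x \<le> 2 * A * (norm z)\<^sup>2"
    and A: "0 \<le> A"
  shows "trunc_op d v x - A * moment d \<le> trunc_op r v x"
proof -
  have d: "0 < d" using r by simp
  let ?S = "\<lambda>z. 2 * v x - v (x + z) - v (x - z)"
  have "bounded_borel (\<bar>2 * v x\<bar> + M + M) ?S"
    by (rule bounded_borel_diff[OF bounded_borel_diff[OF _ bounded_borel_translate[OF v]] bounded_borel_reflect[OF v]])
      (simp add: bounded_borel_def)
  note int = integrable_bounded_mult[OF this trunc_kernel_integrable]
  have "- 2 * A * moment d = (LBINT z. (- 2 * A) * (indicator (cball 0 d) z * (norm z)\<^sup>2 * K z))"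
    by (simp only: moment_def integral_mult_right_zero)
  also have "\<dots> \<le> (LBINT z. ?S z * trunc_kernel r z - ?S z * trunc_kernel d z)"
  proof (rule integral_mono)
    show "integrable lborel (\<lambda>z. (- 2 * A) * (indicator (cball 0 d) z * (norm z)\<^sup>2 * K z))"
      using moment_integrable[OF r(3)] by (rule integrable_mult_right)
    show "integrable lborel (\<lambda>z. ?S z * trunc_kernel r z - ?S z * trunc_kernel d z)"
      using int r d by simp
    fix z :: 'a
    show "(- 2 * A) * (indicator (cball 0 d) z * (norm z)\<^sup>2 * K z) \<le> ?S z * trunc_kernel r z - ?S z * trunc_kernel d z"
    proof (cases "norm z \<le> d")
      case True
      have S: "- (2 * A * (norm z)\<^sup>2) \<le> ?S z" using sd[OF True] by simp
      show ?thesis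
      proof (cases "r < norm z")
        case True' : True
        have "- (2 * A * (norm z)\<^sup>2) * K z \<le> ?S z * K z" using S K_nonneg by (rule mult_right_mono)
        then show ?thesis using True True' by (simp add: trunc_kernel_def mult_ac)
      next
        case False
        have "0 \<le> A * ((norm z)\<^sup>2 * K z)" using A K_nonneg[of z] by simp
        then show ?thesis using True False r by (simp add: trunc_kernel_def mult_ac)
      qed
    next
      case False
      then show ?thesis using r by (simp add: trunc_kernel_def)
    qed
  qed
  also have "\<dots> = (LBINT z. ?S z * trunc_kernel r z) - (LBINT z. ?S z * trunc_kernel d z)"
    using int r d by (intro Bochner_Integration.integral_diff) auto
  finally show ?thesis
    unfolding trunc_op_symmetrized[OF v r(1)] trunc_op_symmetrized[OF v d] by simp
qed

section \<open>The operator on test functions\<close>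

text \<open>
  The symmetric form of the principal value: for functions with quadratic second differences the
  integrand is absolutely integrable at the origin.
\<close>

definition sym_op :: "('a \<Rightarrow> real) \<Rightarrow> 'a \<Rightarrow> real" where
  "sym_op v x = (LBINT z. (2 * v x - v (x + z) - v (x - z)) * K z) / 2"

lemma trunc_op_approximates:
  assumes v: "bounded_borel M v" and r: "0 < r" "r \<le> 1"
    and sd: "\<And>z. norm z \<le> 1 \<Longrightarrow> \<bar>v (x + z) + v (x - z) - 2 * v x\<bar> \<le> 2 * A * (norm z)\<^sup>2"
  shows "\<bar>trunc_op r v x - sym_op v x\<bar> \<le> A * moment r"
proof -
  let ?S = "\<lambda>z. 2 * v x - v (x + z) - v (x - z)"
  have S: "bounded_borel (\<bar>2 * v x\<bar> + M + M) ?S"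
    by (rule bounded_borel_diff[OF bounded_borel_diff[OF _ bounded_borel_translate[OF v]] bounded_borel_reflect[OF v]])
      (simp add: bounded_borel_def)
  note [measurable] = bounded_borelD(1)[OF S]
  have i1: "integrable lborel (\<lambda>z. ?S z * trunc_kernel r z)"
    by (rule integrable_bounded_mult[OF S trunc_kernel_integrable[OF r(1)]])
  have le: "\<bar>?S z * (K z - trunc_kernel r z)\<bar> \<le> 2 * A * (indicator (cball 0 r) z * (norm z)\<^sup>2 * K z)" for z
  proof (cases "norm z \<le> r")
    case True
    then have "\<bar>?S z\<bar> * K z \<le> (2 * A * (norm z)\<^sup>2) * K z"
      using sd[of z] r by (intro mult_right_mono K_nonneg) (simp add: abs_le_iff)
    then show ?thesis using True K_nonneg[of z] by (simp add: trunc_kernel_def abs_mult mult_ac)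
  qed (simp add: trunc_kernel_def)
  have m: "integrable lborel (\<lambda>z. 2 * A * (indicator (cball 0 r) z * (norm z)\<^sup>2 * K z))"
    using moment_integrable[OF r(2)] by (rule integrable_mult_right)
  have i2: "integrable lborel (\<lambda>z. ?S z * (K z - trunc_kernel r z))"
  proof (rule Bochner_Integration.integrable_bound[OF m])
    show "AE z in lborel. norm (?S z * (K z - trunc_kernel r z)) \<le> norm (2 * A * (indicator (cball 0 r) z * (norm z)\<^sup>2 * K z))"
      unfolding real_norm_def by (rule AE_I2) (rule order_trans[OF le abs_ge_self])
  qed measurable
  have "(LBINT z. ?S z * K z) = (LBINT z. ?S z * trunc_kernel r z + ?S z * (K z - trunc_kernel r z))"
    by (simp add: right_diff_distrib)
  also have "\<dots> = (LBINT z. ?S z * trunc_kernel r z) + (LBINT z. ?S z * (K z - trunc_kernel r z))"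
    by (rule Bochner_Integration.integral_add[OF i1 i2])
  finally have "trunc_op r v x - sym_op v x = - (LBINT z. ?S z * (K z - trunc_kernel r z)) / 2"
    unfolding sym_op_def trunc_op_symmetrized[OF v r(1)] by (simp add: field_simps)
  also have "\<bar>\<dots>\<bar> = \<bar>LBINT z. ?S z * (K z - trunc_kernel r z)\<bar> / 2" by simp
  also have "\<bar>LBINT z. ?S z * (K z - trunc_kernel r z)\<bar> \<le> (LBINT z. \<bar>?S z * (K z - trunc_kernel r z)\<bar>)"
    by (rule integral_abs_bound)
  also have "\<dots> \<le> (LBINT z. 2 * A * (indicator (cball 0 r) z * (norm z)\<^sup>2 * K z))"
    by (intro integral_mono integrable_abs i2 m le)
  also have "\<dots> = 2 * A * moment r" by (simp only: moment_def integral_mult_right_zero)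
  finally show ?thesis by simp
qed

lemma test_function_bounded_borel:
  assumes "test_function \<Omega> (\<eta> :: 'a \<Rightarrow> real)"
  obtains M where "bounded_borel M \<eta>"
proof -
  obtain M where "\<forall>x. \<bar>\<eta> x\<bar> \<le> M" using test_function_basics(2)[OF assms] by blast
  moreover have "\<eta> \<in> borel_measurable borel"
    using test_function_basics(1)[OF assms] by (rule borel_measurable_continuous_onI)
  ultimately show ?thesis using that unfolding bounded_borel_def by blast
qed

lemma trunc_op_test_tendsto:
  assumes "test_function \<Omega> \<eta>"
  shows "((\<lambda>r. trunc_op r \<eta> x) \<longlongrightarrow> sym_op \<eta> x) (at_right 0)"
proof -
  obtain A where A: "A \<ge> 0" "\<And>x z. \<bar>\<eta> (x + z) + \<eta> (x - z) - 2 * \<eta> x\<bar> \<le> A * (norm z)\<^sup>2"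
    using test_function_second_difference[OF assms] by blast
  obtain M where M: "bounded_borel M \<eta>" using test_function_bounded_borel[OF assms] .
  have "\<forall>\<^sub>F r in at_right 0. r \<in> {0<..<1::real}" by (rule eventually_at_right_real) simp
  then have "\<forall>\<^sub>F r in at_right 0. norm (trunc_op r \<eta> x - sym_op \<eta> x) \<le> (A / 2) * moment r"
  proof eventually_elim
    case (elim r)
    have "\<bar>\<eta> (x + z) + \<eta> (x - z) - 2 * \<eta> x\<bar> \<le> 2 * (A / 2) * (norm z)\<^sup>2" for z
      using A(2)[of x z] by simp
    then show ?case using trunc_op_approximates[OF M, of r x "A / 2"] elim by simp
  qed
  moreover have "((\<lambda>r. (A / 2) * moment r) \<longlongrightarrow> 0) (at_right 0)"
    by (intro tendsto_mult_right_zero moment_tendsto_0)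
  ultimately have "((\<lambda>r. trunc_op r \<eta> x - sym_op \<eta> x) \<longlongrightarrow> 0) (at_right 0)"
    by (rule Lim_null_comparison)
  then show ?thesis by (simp add: LIM_zero_iff)
qed

text \<open>
  Near the support the second difference gives a uniform bound. Far from it only jumps into the support
  contribute, and all of them have length comparable to \<open>norm x\<close>.
\<close>

lemma trunc_op_test_bound:
  assumes t: "test_function (ball 0 1) \<eta>"
  obtains C where "\<And>r x. 0 < r \<Longrightarrow> r \<le> 1 \<Longrightarrow> \<bar>trunc_op r \<eta> x\<bar> \<le> C * weight x"
proof -
  let ?p = "real DIM('a) + 2 * s"
  obtain A where A: "A \<ge> 0" "\<And>x z. \<bar>\<eta> (x + z) + \<eta> (x - z) - 2 * \<eta> x\<bar> \<le> A * (norm z)\<^sup>2"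
    using test_function_second_difference[OF t] by blast
  obtain M where M: "bounded_borel M \<eta>" using test_function_bounded_borel[OF t] .
  have M0: "0 \<le> M" using M by (rule bounded_borel_nonneg)
  note [measurable] = bounded_borelD(1)[OF M]
  define D where "D = 2 * M * mass 1 + (A / 2) * moment 1"
  have D: "0 \<le> D" unfolding D_def using A M0 mass_nonneg moment_nonneg by simp
  have near: "\<bar>trunc_op r \<eta> x\<bar> \<le> D" if r: "0 < r" "r \<le> 1" for r x
  proof -
    have le: "\<bar>trunc_op 1 \<eta> x\<bar> \<le> 2 * M * mass 1"
    proof -
      have "bounded_borel M (\<lambda>z. \<eta> x)" using M by (simp add: bounded_borel_def)
      from integral_abs_bounded_mult_le[OF bounded_borel_diff[OF this bounded_borel_translate[OF M, of x]] trunc_kernel_integrable[of 1]]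
      show ?thesis unfolding trunc_op_def mass_def by (simp add: trunc_kernel_nonneg)
    qed
    have "trunc_op 1 \<eta> x - A / 2 * moment 1 \<le> trunc_op r \<eta> x"
      by (rule trunc_op_touching[OF M]) (use r A in \<open>auto simp: abs_le_iff\<close>)
    moreover have "trunc_op 1 (\<lambda>x. - \<eta> x) x - A / 2 * moment 1 \<le> trunc_op r (\<lambda>x. - \<eta> x) x"
    proof (rule trunc_op_touching[OF bounded_borel_uminus[OF M]])
      fix z show "- \<eta> (x + z) + - \<eta> (x - z) - 2 * - \<eta> x \<le> 2 * (A / 2) * (norm z)\<^sup>2"
        using A(2)[of x z] by (simp add: abs_le_iff)
    qed (use r A in auto)
    ultimately show ?thesis using le unfolding trunc_op_uminus D_def by (simp add: abs_le_iff)
  qed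
  define V where "V = measure lborel (ball (0::'a) 1)"
  have V: "V \<ge> 0" unfolding V_def by simp
  have far: "\<bar>trunc_op r \<eta> x\<bar> \<le> (M * Lam * 3 powr ?p * V) * weight x" if r: "0 < r" "r \<le> 1" and x: "2 \<le> norm x" for r x
  proof -
    have z0: "\<eta> y = 0" if "1 \<le> norm y" for y using test_function_basics(3)[OF t, of y] that by simp
    have Bint: "integrable lborel (\<lambda>z. indicator (ball 0 1) (x + z) * (M * (Lam * 3 powr ?p * weight x)))"
    proof -
      have "integrable lborel (indicator (ball (0::'a) 1) :: 'a \<Rightarrow> real)"
        using emeasure_lborel_ball_finite[of "0::'a" 1] by (intro integrable_real_indicator) auto
      then show ?thesis by (intro integrable_mult_left lborel_integrable_translate)
    qed
    have "trunc_op r \<eta> x = - (trunc_avg r \<eta> x)"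
      using trunc_op_eq[OF M r(1), of x] z0[of x] x by simp
    also have "\<bar>\<dots>\<bar> \<le> (LBINT z. \<bar>\<eta> (x + z) * trunc_kernel r z\<bar>)" by simp
    also have "\<dots> \<le> (LBINT z. indicator (ball 0 1) (x + z) * (M * (Lam * 3 powr ?p * weight x)))"
    proof (rule integral_mono[OF _ Bint])
      show "integrable lborel (\<lambda>z. \<bar>\<eta> (x + z) * trunc_kernel r z\<bar>)"
        by (intro integrable_abs trunc_avg_integrable[OF M r(1)])
      fix z
      show "\<bar>\<eta> (x + z) * trunc_kernel r z\<bar> \<le> indicator (ball 0 1) (x + z) * (M * (Lam * 3 powr ?p * weight x))"
      proof (cases "norm (x + z) < 1")
        case True
        have "norm x \<le> norm (x + z) + norm z" using norm_triangle_ineq4[of "x + z" z] by simp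
        then have nz: "(1 + norm x) / 3 \<le> norm z" using True x by simp
        have "trunc_kernel r z \<le> K z" using K_nonneg by (simp add: trunc_kernel_def indicator_def)
        also have "\<dots> \<le> Lam * norm z powr - ?p" by (rule K_upper)
        also have "\<dots> \<le> Lam * ((1 + norm x) / 3) powr - ?p"
          using nz Lam_pos s_pos by (intro mult_left_mono powr_mono2') (auto intro: add_pos_nonneg)
        also have "((1 + norm x) / 3) powr - ?p = 3 powr ?p * weight x"
        proof -
          have "((1 + norm x) / 3) powr - q = 3 powr q * (1 + norm x) powr - q" for q
            by (subst powr_divide) (auto simp: powr_minus divide_inverse)
          then show ?thesis by (simp only: weight_def)
        qed
        finally have "trunc_kernel r z \<le> Lam * 3 powr ?p * weight x" by (simp add: mult.assoc)
        then have "\<bar>\<eta> (x + z)\<bar> * trunc_kernel r z \<le> M * (Lam * 3 powr ?p * weight x)"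
          using bounded_borelD(2)[OF M] M0 trunc_kernel_nonneg by (intro mult_mono) auto
        then show ?thesis using True trunc_kernel_nonneg[of r z] by (simp add: abs_mult)
      qed (simp add: z0)
    qed
    also have "\<dots> = (LBINT z. indicator (ball (0::'a) 1) (x + z)) * (M * (Lam * 3 powr ?p * weight x))"
      by (rule integral_mult_left_zero)
    also have "(LBINT z. indicator (ball (0::'a) 1) (x + z)) = V"
      unfolding V_def using lborel_integral_translate[OF borel_measurable_indicator[of "ball (0::'a) 1" borel], of x]
      by simp
    finally show ?thesis by (simp add: mult_ac)
  qed
  show ?thesis
  proof (rule that[of "D * 3 powr ?p + M * Lam * 3 powr ?p * V"])
    fix r :: real and x :: 'a assume r: "0 < r" "r \<le> 1"
    have nn: "0 \<le> M * Lam * 3 powr ?p * V * weight x" "0 \<le> D * 3 powr ?p * weight x"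
      using M0 Lam_pos V D weight_nonneg[of x] by auto
    show "\<bar>trunc_op r \<eta> x\<bar> \<le> (D * 3 powr ?p + M * Lam * 3 powr ?p * V) * weight x"
    proof (cases "norm x \<le> 2")
      case True
      have "3 powr - ?p \<le> weight x" unfolding weight_def
        using True s_pos by (intro powr_mono2') (auto intro: add_pos_nonneg)
      then have "3 powr ?p * 3 powr - ?p \<le> 3 powr ?p * weight x" by (rule mult_left_mono) simp
      then have "1 \<le> 3 powr ?p * weight x" by (simp add: powr_minus del: minus_add_distrib)
      then have "D \<le> D * 3 powr ?p * weight x" using D mult_left_mono[of 1 "3 powr ?p * weight x" D] by (simp add: mult_ac)
      then show ?thesis using near[OF r, of x] nn by (simp add: distrib_right)
    next
      case False
      then show ?thesis using far[OF r, of x] nn by (simp add: distrib_right)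
    qed
  qed
qed

lemma trunc_op_borel:
  assumes "bounded_borel M v" "0 < r"
  shows "trunc_op r v \<in> borel_measurable borel"
proof -
  note [measurable] = bounded_borelD(1)[OF assms(1)]
  show ?thesis unfolding trunc_op_def[abs_def] by measurable
qed

text \<open>
  The function paired with the operator may change with the radius, as penalized solutions do.
\<close>

lemma trunc_pairing_tendsto:
  assumes t: "test_function (ball 0 1) \<eta>" and u: "bounded_borel M u"
    and un: "\<And>n. bounded_borel M (un n)" "\<And>x. (\<lambda>n. un n x) \<longlonglongrightarrow> u x"
    and r: "\<And>n. 0 < r n" "\<And>n. r n \<le> 1" "r \<longlonglongrightarrow> 0"
  shows "(\<lambda>n. LBINT x. un n x * trunc_op (r n) \<eta> x) \<longlonglongrightarrow> (LBINT x. u x * sym_op \<eta> x)"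
proof -
  obtain C where C: "\<And>r x. 0 < r \<Longrightarrow> r \<le> 1 \<Longrightarrow> \<bar>trunc_op r \<eta> x\<bar> \<le> C * weight x"
    using trunc_op_test_bound[OF t] by blast
  obtain N where N: "bounded_borel N \<eta>" using test_function_bounded_borel[OF t] .
  note [measurable] = trunc_op_borel[OF N r(1)] bounded_borelD(1)[OF u] bounded_borelD(1)[OF un(1)] bounded_borelD(1)[OF N]
  have "filterlim r (at_right 0) sequentially"
    using r by (intro tendsto_imp_filterlim_at_right) auto
  then have lim: "(\<lambda>n. trunc_op (r n) \<eta> x) \<longlonglongrightarrow> sym_op \<eta> x" for x
    by (rule filterlim_compose[OF trunc_op_test_tendsto[OF t]])
  show ?thesis
  proof (rule integral_dominated_convergence)
    show "integrable lborel (\<lambda>x. M * (C * weight x))" using weight_integrable by simp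
    show "AE x in lborel. (\<lambda>n. un n x * trunc_op (r n) \<eta> x) \<longlonglongrightarrow> u x * sym_op \<eta> x"
      by (intro AE_I2 tendsto_mult un lim)
    show "AE x in lborel. norm (un n x * trunc_op (r n) \<eta> x) \<le> M * (C * weight x)" for n
      using bounded_borelD(2)[OF un(1)] bounded_borel_nonneg[OF u] C[OF r(1,2)]
      by (intro AE_I2) (auto simp: abs_mult intro!: mult_mono)
    show "(\<lambda>x. u x * sym_op \<eta> x) \<in> borel_measurable lborel"
      unfolding sym_op_def[abs_def] by measurable
  qed measurable
qed

section \<open>Mollified equations and interior maxima\<close>

lemma mollify_weighted_close:
  assumes \<phi>: "mollifier e \<phi>" and u: "bounded_borel M u"
    and small: "\<And>a. norm a < e \<Longrightarrow> shift_modulus u a \<le> \<sigma>"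
  shows "(weighted_norm (\<lambda>y. mollify \<phi> u y - u y)) \<le> \<sigma>"
proof -
  note [measurable] = bounded_borelD(1)[OF u] mollifierD(7)[OF \<phi>]
  let ?F = "\<lambda>y x. \<bar>u (y + x) - u y\<bar>"
  have F: "bounded_borel (M + M) (?F y)" for y
  proof -
    have "bounded_borel M (\<lambda>_. u y)" using u by (simp add: bounded_borel_def)
    from bounded_borel_diff[OF bounded_borel_translate[OF u, of y] this]
    show ?thesis by (auto simp: bounded_borel_def)
  qed
  have prod: "integrable (lborel \<Otimes>\<^sub>M lborel) (\<lambda>(y, x). ?F y x * (weight y * \<phi> x))"
    by (rule bounded_times_product_integrable[where M="M + M", OF _ bounded_borelD(2)[OF F] weight_integrable mollifierD(4)[OF \<phi>]])
       measurable
  have "(weighted_norm (\<lambda>y. mollify \<phi> u y - u y)) \<le> (LBINT y. (LBINT x. ?F y x * (weight y * \<phi> x)))"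
  proof (rule integral_mono)
    have "bounded_borel (M + M) (\<lambda>y. \<bar>mollify \<phi> u y - u y\<bar>)"
      using bounded_borel_diff[OF mollify_bounded_borel[OF \<phi> u] u] by (auto simp: bounded_borel_def)
    then show "integrable lborel (\<lambda>y. \<bar>mollify \<phi> u y - u y\<bar> * weight y)"
      by (rule integrable_bounded_mult[OF _ weight_integrable])
    show "integrable lborel (\<lambda>y. LBINT x. ?F y x * (weight y * \<phi> x))"
      using lborel_pair.integrable_fst[OF prod] by simp
    fix y
    have int: "integrable lborel (\<lambda>x. u (y + x) * \<phi> x)"
      by (rule integrable_bounded_mult[OF bounded_borel_translate[OF u] mollifierD(4)[OF \<phi>]])
    have "mollify \<phi> u y - u y = (LBINT x. (u (y + x) - u y) * \<phi> x)"
      using int mollifierD(4,5)[OF \<phi>] by (simp add: mollify_def left_diff_distrib)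
    also have "\<bar>\<dots>\<bar> \<le> (LBINT x. \<bar>(u (y + x) - u y) * \<phi> x\<bar>)" by (rule integral_abs_bound)
    also have "\<dots> = (LBINT x. ?F y x * \<phi> x)" by (simp add: abs_mult mollifierD(2)[OF \<phi>])
    finally have "\<bar>mollify \<phi> u y - u y\<bar> * weight y \<le> (LBINT x. ?F y x * \<phi> x) * weight y"
      by (rule mult_right_mono[OF _ weight_nonneg])
    also have "\<dots> = (LBINT x. ?F y x * \<phi> x * weight y)" by (rule integral_mult_left_zero[symmetric])
    finally show "\<bar>mollify \<phi> u y - u y\<bar> * weight y \<le> (LBINT x. ?F y x * (weight y * \<phi> x))" by (simp add: mult_ac)
  qed
  also have "\<dots> = (LBINT x. (LBINT y. ?F y x * (weight y * \<phi> x)))"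
    by (rule lborel_pair.Fubini_integral[symmetric]) (rule prod)
  also have "\<dots> \<le> (LBINT x. \<sigma> * \<phi> x)"
  proof (rule integral_mono)
    show "integrable lborel (\<lambda>x. LBINT y. ?F y x * (weight y * \<phi> x))"
      using lborel_pair.integrable_snd[OF prod] by simp
    show "integrable lborel (\<lambda>x. \<sigma> * \<phi> x)" using mollifierD(4)[OF \<phi>] by simp
    fix x
    have "(LBINT y. ?F y x * (weight y * \<phi> x)) = (LBINT y. (?F y x * weight y) * \<phi> x)" by (simp add: mult_ac)
    also have "\<dots> = shift_modulus u x * \<phi> x" unfolding shift_modulus_def by (simp add: add.commute)
    also have "\<dots> \<le> \<sigma> * \<phi> x"
      using small[of x] mollifierD(2,3)[OF \<phi>, of x] by (cases "norm x < e") (auto intro: mult_right_mono)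
    finally show "(LBINT y. ?F y x * (weight y * \<phi> x)) \<le> \<sigma> * \<phi> x" .
  qed
  also have "\<dots> = \<sigma>" using mollifierD(5)[OF \<phi>] by simp
  finally show ?thesis .
qed

definition weak_solution :: "('a \<Rightarrow> real) \<Rightarrow> ('a \<Rightarrow> real) \<Rightarrow> bool" where
  "weak_solution u f \<longleftrightarrow> (\<forall>\<eta>. test_function (ball 0 1) \<eta> \<longrightarrow>
     (LBINT x. u x * sym_op \<eta> x) = (LBINT x. indicator (ball 0 1) x * (f x * \<eta> x)))"

lemma average_integrable:
  assumes \<eta>: "integrable lborel \<eta>" and r: "0 < r"
  shows "integrable lborel (\<lambda>x. trunc_avg r \<eta> x)"
proof -
  have "bounded_borel 1 (\<lambda>_::'a. 1)" by (simp add: bounded_borel_def)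
  from lborel_pair.integrable_snd[OF shifted_product_integrable[OF this \<eta> trunc_kernel_integrable[OF r]]]
  show ?thesis by simp
qed

text \<open>
  Fubini's theorem moves the truncated operator from the translated mollifier to the mollification, so
  the equation tested against that mollifier becomes a pointwise one.
\<close>

lemma trunc_op_mollify:
  assumes \<phi>: "mollifier e \<phi>" and u: "bounded_borel M u" and r: "0 < r"
  shows "(LBINT x. u x * trunc_op r (\<lambda>x. \<phi> (x - x0)) x) = trunc_op r (mollify \<phi> u) x0"
proof -
  note [measurable] = bounded_borelD(1)[OF u] mollifierD(7)[OF \<phi>]
  define \<eta> where "\<eta> x = \<phi> (x - x0)" for x
  have \<eta>: "integrable lborel \<eta>"
    unfolding \<eta>_def using lborel_integrable_translate[OF mollifierD(4)[OF \<phi>], of "- x0"] by simp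
  obtain N where N: "bounded_borel N \<eta>"
    using test_function_bounded_borel[OF mollifierD(6)[OF \<phi>, of x0 UNIV]] unfolding \<eta>_def by auto
  note U = mollify_bounded_borel[OF \<phi> u]
  note k = trunc_kernel_integrable[OF r]
  have i1: "integrable lborel (\<lambda>x. u x * (trunc_avg r \<eta> x))"
    by (rule integrable_bounded_mult[OF u average_integrable[OF \<eta> r]])
  have i2: "integrable lborel (\<lambda>x. u x * \<eta> x)" by (rule integrable_bounded_mult[OF u \<eta>])
  have Ux: "(LBINT x. u x * \<eta> x) = mollify \<phi> u x0"
    unfolding \<eta>_def mollify_alt[OF \<phi> u] ..
  have Us: "(LBINT x. u (x - z) * \<eta> x) = mollify \<phi> u (x0 - z)" for z
  proof -
    have "(LBINT x. u (x - z) * \<eta> x) = (LBINT x. u ((z + x) - z) * \<eta> (z + x))"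
      unfolding \<eta>_def by (rule lborel_integral_translate[symmetric]) measurable
    then show ?thesis unfolding \<eta>_def mollify_alt[OF \<phi> u] by (simp add: algebra_simps)
  qed
  have refl: "(LBINT z. mollify \<phi> u (x0 - z) * trunc_kernel r z) = (LBINT z. mollify \<phi> u (x0 + z) * trunc_kernel r z)"
  proof -
    note [measurable] = bounded_borelD(1)[OF U]
    have "(LBINT z. mollify \<phi> u (x0 + - z) * trunc_kernel r (- z)) = (LBINT z. mollify \<phi> u (x0 + z) * trunc_kernel r z)"
      by (rule lborel_integral_reflect) measurable
    then show ?thesis by (simp add: trunc_kernel_sym)
  qed
  have "(LBINT x. u x * trunc_op r \<eta> x) = (LBINT x. u x * \<eta> x * mass r - u x * (trunc_avg r \<eta> x))"
    unfolding trunc_op_eq[OF N r] by (simp add: algebra_simps)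
  also have "\<dots> = (LBINT x. u x * \<eta> x) * mass r - (LBINT x. u x * (trunc_avg r \<eta> x))"
    using i1 i2 by simp
  also have "\<dots> = trunc_op r (mollify \<phi> u) x0"
    unfolding trunc_op_eq[OF U r] convolution_Fubini(1)[OF u \<eta> k] Us refl Ux ..
  finally show ?thesis unfolding \<eta>_def .
qed

lemma mollify_solves:
  assumes \<phi>: "mollifier e \<phi>" and u: "bounded_borel M u" and ws: "weak_solution u f"
    and sub: "cball x0 e \<subseteq> ball 0 1"
  shows "(\<lambda>n. trunc_op (1 / real (Suc n)) (mollify \<phi> u) x0) \<longlonglongrightarrow>
     (LBINT z. indicator (ball 0 1) z * (f z * \<phi> (z - x0)))"
proof -
  have t: "test_function (ball 0 1) (\<lambda>x. \<phi> (x - x0))" using \<phi> sub by (rule mollifierD(6))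
  have "(\<lambda>n. LBINT x. u x * trunc_op (1 / real (Suc n)) (\<lambda>x. \<phi> (x - x0)) x) \<longlonglongrightarrow>
     (LBINT x. u x * sym_op (\<lambda>x. \<phi> (x - x0)) x)"
    by (rule trunc_pairing_tendsto[OF t u u tendsto_const]) (simp, simp, rule LIMSEQ_Suc[OF lim_1_over_n])
  then show ?thesis
    using ws t unfolding weak_solution_def by (simp add: trunc_op_mollify[OF \<phi> u])
qed

text \<open>
  Suppose that \<open>g\<close> exceeds \<open>\<tau>\<close> at \<open>x\<close>. Subtracting a steep paraboloid centred at \<open>x\<close> produces a maximum
  \<open>x0\<close> nearby at which \<open>g\<close> still exceeds \<open>\<tau>\<close> and has a one-sided bound on second differences. There the
  jumps longer than \<open>d\<close> contribute at least \<open>\<tau> * mass d\<close> up to an error controlled by the weighted norm.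
  Now \<open>d\<close> is chosen first, to make \<open>\<tau> * mass d\<close> large, and the bound \<open>\<kappa>\<close> on the norm afterwards.
\<close>

lemma interior_maximum_bound:
  assumes M: "0 \<le> M" and r: "0 < r" "r < 1" and \<tau>: "0 < \<tau>" and C: "0 \<le> C"
  shows "\<exists>\<kappa>>0. \<forall>g. bounded_borel M g \<longrightarrow> continuous_on UNIV g \<longrightarrow>
     (\<forall>x. norm x \<le> (1 + r) / 2 \<longrightarrow> (\<exists>l. op_tendsto g x l \<and> l \<le> C)) \<longrightarrow>
     (weighted_norm g) < \<kappa> \<longrightarrow> (\<forall>x. norm x \<le> r \<longrightarrow> g x \<le> \<tau>)"
proof -
  define e where "e = (1 - r) / 2"
  have e: "0 < e" unfolding e_def using r by simp
  \<comment> \<open>The paraboloid reaches \<open>2 * M\<close> at distance \<open>e\<close>, so the maximum cannot lie further away.\<close>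
  define A where "A = 2 * M / e\<^sup>2"
  have A: "0 \<le> A" unfolding A_def using M by simp
  obtain d where d: "0 < d" "d \<le> 1" and md: "(C + A * moment 1 + 1) / \<tau> \<le> mass d"
    using mass_unbounded by blast
  show ?thesis
  proof (intro exI[of _ "1 / (dom_const d + 1)"] conjI allI impI)
    show "0 < 1 / (dom_const d + 1)" using dom_const_nonneg[of d] by simp
    fix g :: "'a \<Rightarrow> real" and x :: 'a
    assume g: "bounded_borel M g" and cont: "continuous_on UNIV g"
      and lim: "\<forall>x. norm x \<le> (1 + r) / 2 \<longrightarrow> (\<exists>l. op_tendsto g x l \<and> l \<le> C)"
      and small: "(weighted_norm g) < 1 / (dom_const d + 1)" and x: "norm x \<le> r"
    show "g x \<le> \<tau>"
    proof (rule ccontr)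
      assume "\<not> g x \<le> \<tau>"
      then have gx: "\<tau> < g x" by simp
      define h where "h y = g y - A * (norm (y - x))\<^sup>2" for y
      have "\<exists>x0\<in>cball x e. \<forall>y\<in>cball x e. h y \<le> h x0"
      proof (rule continuous_attains_sup)
        show "continuous_on (cball x e) h" unfolding h_def
          by (intro continuous_intros continuous_on_subset[OF cont]) auto
      qed (use e in auto)
      then obtain x0 where x0: "x0 \<in> cball x e" and mx: "\<And>y. y \<in> cball x e \<Longrightarrow> h y \<le> h x0" by blast
      have hx: "\<tau> < h x0" using mx[of x] gx e by (simp add: h_def)
      have gmax: "h y \<le> h x0" for y
      proof (cases "y \<in> cball x e")
        case False
        then have "e \<le> norm (y - x)" by (simp add: dist_norm norm_minus_commute)
        then have "e\<^sup>2 \<le> (norm (y - x))\<^sup>2" using e by (intro power_mono) auto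
        then have "A * e\<^sup>2 \<le> A * (norm (y - x))\<^sup>2" using A by (rule mult_left_mono)
        moreover have "A * e\<^sup>2 = 2 * M" unfolding A_def using e by simp
        ultimately have "h y \<le> M - 2 * M" using bounded_borelD(2)[OF g, of y] by (simp add: h_def abs_le_iff)
        then show ?thesis using M \<tau> hx by linarith
      qed (rule mx)
      have gx0: "\<tau> < g x0"
      proof -
        have "h x0 \<le> g x0" using A by (simp add: h_def)
        then show ?thesis using hx by simp
      qed
      have nx0: "norm x0 \<le> (1 + r) / 2"
      proof -
        have "norm x0 \<le> norm x + norm (x0 - x)" using norm_triangle_ineq[of x "x0 - x"] by simp
        also have "\<dots> \<le> r + e" using x x0 by (intro add_mono) (auto simp: dist_norm norm_minus_commute)
        finally show ?thesis unfolding e_def by (simp add: field_simps)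
      qed
      then obtain l where l: "op_tendsto g x0 l" "l \<le> C" using lim by blast
      have sd: "g (x0 + z) + g (x0 - z) - 2 * g x0 \<le> 2 * A * (norm z)\<^sup>2" for z
      proof -
        have "(norm (x0 + z - x))\<^sup>2 + (norm (x0 - z - x))\<^sup>2 - 2 * (norm (x0 - x))\<^sup>2 = 2 * (norm z)\<^sup>2"
          by (simp add: power2_norm_eq_inner inner_simps inner_commute)
        then have "A * (norm (x0 + z - x))\<^sup>2 + A * (norm (x0 - z - x))\<^sup>2 - 2 * (A * (norm (x0 - x))\<^sup>2) = 2 * A * (norm z)\<^sup>2"
          by (simp add: distrib_left[symmetric] right_diff_distrib[symmetric] mult.left_commute)
        then show ?thesis using gmax[of "x0 + z"] gmax[of "x0 - z"] unfolding h_def by linarith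
      qed
      obtain n0 where n0: "1 / real (Suc n0) < d" using nat_approx_posE[OF d(1)] by blast
      have "trunc_op d g x0 - A * moment d \<le> l"
      proof (rule Lim_bounded2[OF l(1)])
        show "\<forall>n\<ge>n0. trunc_op d g x0 - A * moment d \<le> trunc_op (1 / real (Suc n)) g x0"
        proof (intro allI impI)
          fix n assume "n0 \<le> n"
          then have "1 / real (Suc n) \<le> 1 / real (Suc n0)" by (simp add: frac_le)
          then show "trunc_op d g x0 - A * moment d \<le> trunc_op (1 / real (Suc n)) g x0"
            using n0 d sd A by (intro trunc_op_touching[OF g]) auto
        qed
      qed
      moreover have "A * moment d \<le> A * moment 1" using moment_mono[of d 1] d A by (intro mult_left_mono) auto
      moreover have "\<tau> * mass d \<le> g x0 * mass d" using gx0 mass_nonneg by (intro mult_right_mono) auto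
      moreover have "C + A * moment 1 + 1 \<le> \<tau> * mass d" using md \<tau> by (simp add: field_simps)
      moreover have "\<bar>trunc_avg d g x0\<bar> < 1"
      proof -
        have "\<bar>trunc_avg d g x0\<bar> \<le> dom_const d * (weighted_norm g)"
          using nx0 r by (intro trunc_integral_le_weighted[OF g d(1)]) simp
        also have "\<dots> \<le> dom_const d * (1 / (dom_const d + 1))"
          using small dom_const_nonneg by (intro mult_left_mono) auto
        also have "\<dots> < 1" using dom_const_nonneg[of d] by (simp add: field_simps)
        finally show ?thesis .
      qed
      ultimately show False using l(2) unfolding trunc_op_eq[OF g d(1)] by linarith
    qed
  qed
qed

section \<open>The continuous representative and the touching inequality\<close>

lemma trunc_op_diff:
  assumes v: "bounded_borel M v" and w: "bounded_borel M' w" and d: "0 < d"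
  shows "trunc_op d (\<lambda>x. v x - w x) x = trunc_op d v x - trunc_op d w x"
  using trunc_avg_integrable[OF v d]
    trunc_avg_integrable[OF w d]
  unfolding trunc_op_eq[OF v d] trunc_op_eq[OF w d] trunc_op_eq[OF bounded_borel_diff[OF v w] d]
  by (simp add: left_diff_distrib)

text \<open>
  What is retained of the mollifications. The notion is invariant under a simultaneous change of sign
  of \<open>f\<close>, \<open>w\<close> and \<open>U\<close>, so that touching from below reduces to touching from above.
\<close>

definition approximates :: "real \<Rightarrow> ('a \<Rightarrow> real) \<Rightarrow> ('a \<Rightarrow> real) \<Rightarrow> (nat \<Rightarrow> 'a \<Rightarrow> real) \<Rightarrow> bool" where
  "approximates M f w U \<longleftrightarrow>
     bounded_borel M w \<and> (\<forall>j. bounded_borel M (U j)) \<and> (\<forall>j. continuous_on UNIV (U j)) \<and>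
     (\<lambda>j. weighted_norm (\<lambda>z. U j z - w z)) \<longlonglongrightarrow> 0 \<and>
     (\<forall>r<1. uniform_limit (cball 0 r) U w sequentially) \<and>
     (\<forall>y\<in>ball 0 1. \<forall>\<epsilon>>0. \<exists>\<delta>>0. \<forall>\<^sub>F j in sequentially. \<forall>x\<in>ball y \<delta>.
        \<exists>l. op_tendsto (U j) x l \<and> \<bar>l - f y\<bar> \<le> \<epsilon>)"

lemma approximates_uminus:
  assumes "approximates M f w U"
  shows "approximates M (\<lambda>x. - f x) (\<lambda>x. - w x) (\<lambda>j x. - U j x)"
proof -
  have a: "\<bar>- U j z - - w z\<bar> = \<bar>U j z - w z\<bar>" for j z by (simp add: abs_minus_commute)
  have "\<exists>\<delta>>0. \<forall>\<^sub>F j in sequentially. \<forall>x\<in>ball y \<delta>.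
        \<exists>l. op_tendsto (\<lambda>x. - U j x) x l \<and> \<bar>l - - f y\<bar> \<le> \<epsilon>"
    if "y \<in> ball 0 1" "\<epsilon> > 0" for y \<epsilon>
  proof -
    from assms that obtain \<delta> where \<delta>: "\<delta> > 0" and ev: "\<forall>\<^sub>F j in sequentially. \<forall>x\<in>ball y \<delta>.
        \<exists>l. op_tendsto (U j) x l \<and> \<bar>l - f y\<bar> \<le> \<epsilon>"
      unfolding approximates_def by blast
    from ev have "\<forall>\<^sub>F j in sequentially. \<forall>x\<in>ball y \<delta>.
        \<exists>l. op_tendsto (\<lambda>x. - U j x) x l \<and> \<bar>l - - f y\<bar> \<le> \<epsilon>"
    proof eventually_elim
      case (elim j)
      show ?case
      proof
        fix x assume "x \<in> ball y \<delta>"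
        then obtain l where l: "op_tendsto (U j) x l" "\<bar>l - f y\<bar> \<le> \<epsilon>" using elim by blast
        from l(1) have "op_tendsto (\<lambda>x. - U j x) x (- l)"
          unfolding trunc_op_uminus by (rule tendsto_minus)
        moreover have "\<bar>- l - - f y\<bar> \<le> \<epsilon>" using l(2) by simp
        ultimately show "\<exists>l. op_tendsto (\<lambda>x. - U j x) x l \<and> \<bar>l - - f y\<bar> \<le> \<epsilon>" by blast
      qed
    qed
    with \<delta> show ?thesis by blast
  qed
  with assms show ?thesis
    unfolding approximates_def a
    by (auto intro: bounded_borel_uminus continuous_on_minus uniform_limit_uminus)
qed

text \<open>
  The mollifications converge to \<open>u\<close> in the weighted norm because translations are continuous there.
  Applied to their differences, \<open>interior_maximum_bound\<close> upgrades this to uniform convergence on smaller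
  balls; outside the unit ball \<open>w\<close> is defined to be \<open>u\<close>.
\<close>

lemma weak_solution_approximation:
  assumes u: "bounded_borel M u" and f: "continuous_on (ball 0 1) f" and ws: "weak_solution u f"
  obtains w U where "approximates M f w U" "AE x in lborel. w x = u x" "continuous_on (ball 0 1) w"
proof -
  define e where "e j = 1 / real (Suc j)" for j
  have e0: "0 < e j" for j unfolding e_def by simp
  have elim: "e \<longlonglongrightarrow> 0" unfolding e_def[abs_def] by (rule LIMSEQ_Suc[OF lim_1_over_n])
  have e_small: "\<forall>\<^sub>F j in sequentially. e j < d" if "0 < d" for d
    using order_tendstoD(2)[OF elim that] .
  have "\<exists>\<phi> :: nat \<Rightarrow> 'a \<Rightarrow> real. \<forall>j. mollifier (e j) (\<phi> j)" using ex_mollifier[OF e0] by metis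
  then obtain \<phi> :: "nat \<Rightarrow> 'a \<Rightarrow> real" where \<phi>: "\<And>j. mollifier (e j) (\<phi> j)" by blast
  define U where "U j = mollify (\<phi> j) u" for j
  have Ub: "bounded_borel M (U j)" for j unfolding U_def by (rule mollify_bounded_borel[OF \<phi> u])
  have Uc: "continuous_on UNIV (U j)" for j unfolding U_def by (rule mollify_continuous[OF \<phi> u])
  have int: "integrable lborel (\<lambda>z. \<bar>U j z - u z\<bar> * weight z)" for j
  proof (rule integrable_bounded_mult[OF _ weight_integrable])
    show "bounded_borel (M + M) (\<lambda>z. \<bar>U j z - u z\<bar>)"
      by (rule bounded_borel_abs[OF bounded_borel_diff[OF Ub u]])
  qed
  define nm where "nm j = (weighted_norm (\<lambda>z. U j z - u z))" for j
  have nm0: "0 \<le> nm j" for j unfolding nm_def using weight_nonneg by simp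
  have nm: "nm \<longlonglongrightarrow> 0"
  proof (rule tendstoI)
    fix \<sigma> :: real assume "0 < \<sigma>"
    then obtain d where d: "d > 0" "\<And>a. norm a < d \<Longrightarrow> shift_modulus u a < \<sigma> / 2"
      using shift_modulus_small[OF u, of "\<sigma> / 2"] by auto
    show "\<forall>\<^sub>F j in sequentially. dist (nm j) 0 < \<sigma>"
      using e_small[OF d(1)]
    proof eventually_elim
      case (elim j)
      have "nm j \<le> \<sigma> / 2" unfolding nm_def U_def
        by (rule mollify_weighted_close[OF \<phi> u]) (use d(2) elim in \<open>force intro: less_imp_le\<close>)
      then show ?case using nm0[of j] \<open>0 < \<sigma>\<close> by simp
    qed
  qed
  have sub: "cball x (e j) \<subseteq> ball 0 1" if "norm x + e j < 1" for x :: 'a and j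
    using that by (simp add: cball_subset_ball_iff dist_norm)
  have lims: "(\<lambda>n. trunc_op (1 / real (Suc n)) (U j) x) \<longlonglongrightarrow>
     (LBINT z. indicator (ball 0 1) z * (f z * \<phi> j (z - x)))" if "norm x + e j < 1" for x j
    unfolding U_def by (rule mollify_solves[OF \<phi> u ws sub[OF that]])
  have loc: "\<exists>\<delta>>0. \<forall>\<^sub>F j in sequentially. \<forall>x\<in>ball y \<delta>.
        \<exists>l. op_tendsto (U j) x l \<and> \<bar>l - f y\<bar> \<le> \<epsilon>"
    if y: "y \<in> ball 0 1" and \<epsilon>: "\<epsilon> > 0" for y \<epsilon>
  proof -
    obtain \<delta>1 where \<delta>1: "\<delta>1 > 0" "\<And>z. z \<in> ball 0 1 \<Longrightarrow> dist z y < \<delta>1 \<Longrightarrow> dist (f z) (f y) < \<epsilon>"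
      using f y \<epsilon> unfolding continuous_on_iff by metis
    define \<delta> where "\<delta> = min \<delta>1 (1 - norm y) / 2"
    have \<delta>: "\<delta> > 0" unfolding \<delta>_def using \<delta>1(1) y by simp
    have dl: "2 * \<delta> \<le> \<delta>1" "2 * \<delta> \<le> 1 - norm y" unfolding \<delta>_def by auto
    have "\<forall>\<^sub>F j in sequentially. \<forall>x\<in>ball y \<delta>.
        \<exists>l. op_tendsto (U j) x l \<and> \<bar>l - f y\<bar> \<le> \<epsilon>"
      using e_small[OF \<delta>]
    proof eventually_elim
      case (elim j)
      show ?case
      proof
        fix x assume "x \<in> ball y \<delta>"
        then have x: "dist y x < \<delta>" by simp
        have "norm x \<le> norm y + dist y x" using norm_triangle_ineq[of y "x - y"] by (simp add: dist_norm norm_minus_commute)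
        then have nx: "norm x + e j < 1" using x elim dl by linarith
        have "\<bar>(LBINT z. indicator (ball 0 1) z * (f z * \<phi> j (z - x))) - f y\<bar> \<le> \<epsilon>"
        proof (rule mollified_average_near[OF \<phi> f])
          show s: "ball x (e j) \<subseteq> ball 0 1" using sub[OF nx] ball_subset_cball by blast
          fix z assume z: "z \<in> ball x (e j)"
          then have "dist x z < e j" by simp
          then have "dist z y < \<delta>1" using x elim dl dist_triangle[of z y x] by (simp add: dist_commute)
          then show "\<bar>f z - f y\<bar> \<le> \<epsilon>" using \<delta>1(2)[of z] s z by (auto simp: dist_real_def)
        qed (use \<epsilon> in simp)
        then show "\<exists>l. op_tendsto (U j) x l \<and> \<bar>l - f y\<bar> \<le> \<epsilon>"
          using lims[OF nx] by blast
      qed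
    qed
    with \<delta> show ?thesis by blast
  qed
  have bdd: "\<exists>C\<ge>0. \<forall>\<^sub>F j in sequentially. \<forall>x. norm x \<le> R \<longrightarrow>
        (\<exists>l. op_tendsto (U j) x l \<and> \<bar>l\<bar> \<le> C)" if R: "R < 1" for R
  proof -
    have "compact (f ` cball 0 ((1 + R) / 2))"
      using R by (intro compact_continuous_image continuous_on_subset[OF f]) (auto simp: cball_subset_ball_iff)
    then have "bounded (f ` cball 0 ((1 + R) / 2))" by (rule compact_imp_bounded)
    then obtain C where "\<forall>y\<in>f ` cball 0 ((1 + R) / 2). norm y \<le> C" unfolding bounded_iff by blast
    then have C: "\<bar>f z\<bar> \<le> C" if "norm z \<le> (1 + R) / 2" for z using that by simp
    have "(1 - R) / 2 > 0" using R by simp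
    from e_small[OF this] have "\<forall>\<^sub>F j in sequentially. \<forall>x. norm x \<le> R \<longrightarrow>
        (\<exists>l. op_tendsto (U j) x l \<and> \<bar>l\<bar> \<le> \<bar>C\<bar>)"
    proof eventually_elim
      case (elim j)
      show ?case
      proof (intro allI impI)
        fix x :: 'a assume x: "norm x \<le> R"
        have nx: "norm x + e j < 1" using x elim R by (simp add: field_simps)
        have "\<bar>(LBINT z. indicator (ball 0 1) z * (f z * \<phi> j (z - x))) - 0\<bar> \<le> \<bar>C\<bar>"
        proof (rule mollified_average_near[OF \<phi> f])
          show "ball x (e j) \<subseteq> ball 0 1" using sub[OF nx] ball_subset_cball by blast
          fix z assume "z \<in> ball x (e j)"
          then have "dist x z < e j" by simp
          moreover have "norm z \<le> norm x + dist x z" using norm_triangle_ineq[of x "z - x"] by (simp add: dist_norm norm_minus_commute)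
          ultimately have "norm z \<le> (1 + R) / 2" using x elim by (simp add: field_simps)
          from C[OF this] show "\<bar>f z - 0\<bar> \<le> \<bar>C\<bar>" by simp
        qed simp
        then show "\<exists>l. op_tendsto (U j) x l \<and> \<bar>l\<bar> \<le> \<bar>C\<bar>"
          using lims[OF nx] by auto
      qed
    qed
    then show ?thesis by (intro exI[of _ "\<bar>C\<bar>"]) simp
  qed
  have cauchy: "uniformly_Cauchy_on (cball 0 r) U" if r: "0 < r" "r < 1" for r
    unfolding uniformly_Cauchy_on_def
  proof (intro allI impI)
    fix \<epsilon> :: real assume \<epsilon>: "0 < \<epsilon>"
    have R: "(1 + r) / 2 < 1" using r by simp
    obtain C where C: "C \<ge> 0" and ev1: "\<forall>\<^sub>F j in sequentially. \<forall>x. norm x \<le> (1 + r) / 2 \<longrightarrow>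
        (\<exists>l. op_tendsto (U j) x l \<and> \<bar>l\<bar> \<le> C)" using bdd[OF R] by blast
    have "0 \<le> M + M" "0 < \<epsilon> / 2" "0 \<le> C + C" using bounded_borel_nonneg[OF u] \<epsilon> C by auto
    from interior_maximum_bound[OF this(1) r this(2,3)] obtain \<kappa> where \<kappa>: "\<kappa> > 0" 
      and im: "\<And>g x. bounded_borel (M + M) g \<Longrightarrow> continuous_on UNIV g \<Longrightarrow>
        (\<forall>x. norm x \<le> (1 + r) / 2 \<longrightarrow> (\<exists>l. op_tendsto g x l \<and> l \<le> C + C)) \<Longrightarrow>
       (weighted_norm g) < \<kappa> \<Longrightarrow> norm x \<le> r \<Longrightarrow> g x \<le> \<epsilon> / 2" by blast
    have "\<forall>\<^sub>F j in sequentially. nm j < \<kappa> / 2" using order_tendstoD(2)[OF nm, of "\<kappa> / 2"] \<kappa> by simp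
    from eventually_conj[OF ev1 this] obtain J where
      J: "\<And>j. j \<ge> J \<Longrightarrow> nm j < \<kappa> / 2" 
        "\<And>j x. j \<ge> J \<Longrightarrow> norm x \<le> (1 + r) / 2 \<Longrightarrow> \<exists>l. op_tendsto (U j) x l \<and> \<bar>l\<bar> \<le> C"
      unfolding eventually_sequentially by blast
    have le: "U j x - U k x \<le> \<epsilon> / 2" if jk: "j \<ge> J" "k \<ge> J" and x: "norm x \<le> r" for j k x
    proof (rule im[where g="\<lambda>x. U j x - U k x", OF bounded_borel_diff[OF Ub Ub] _ _ _ x])
      show "continuous_on UNIV (\<lambda>x. U j x - U k x)" by (intro continuous_on_diff Uc)
      show "\<forall>x. norm x \<le> (1 + r) / 2 \<longrightarrow> (\<exists>l. op_tendsto (\<lambda>x. U j x - U k x) x l \<and> l \<le> C + C)"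
      proof (intro allI impI)
        fix x :: 'a assume x: "norm x \<le> (1 + r) / 2"
        obtain l where l: "op_tendsto (U j) x l" "\<bar>l\<bar> \<le> C" using J(2)[OF jk(1) x] by blast
        obtain l' where l': "op_tendsto (U k) x l'" "\<bar>l'\<bar> \<le> C" using J(2)[OF jk(2) x] by blast
        have "op_tendsto (\<lambda>x. U j x - U k x) x (l - l')"
          using tendsto_diff[OF l(1) l'(1)] by (subst trunc_op_diff[OF Ub Ub]) auto
        moreover have "l - l' \<le> C + C" using l(2) l'(2) by linarith
        ultimately show "\<exists>l. op_tendsto (\<lambda>x. U j x - U k x) x l \<and> l \<le> C + C" by blast
      qed
      have "(weighted_norm (\<lambda>z. U j z - U k z)) \<le> (LBINT z. \<bar>U j z - u z\<bar> * weight z + \<bar>U k z - u z\<bar> * weight z)"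
      proof (rule integral_mono)
        have "bounded_borel (M + M) (\<lambda>z. \<bar>U j z - U k z\<bar>)"
          by (rule bounded_borel_abs[OF bounded_borel_diff[OF Ub Ub]])
        then show "integrable lborel (\<lambda>z. \<bar>U j z - U k z\<bar> * weight z)" by (rule integrable_bounded_mult[OF _ weight_integrable])
        show "integrable lborel (\<lambda>z. \<bar>U j z - u z\<bar> * weight z + \<bar>U k z - u z\<bar> * weight z)"
          by (rule Bochner_Integration.integrable_add[OF int int])
        show "\<bar>U j z - U k z\<bar> * weight z \<le> \<bar>U j z - u z\<bar> * weight z + \<bar>U k z - u z\<bar> * weight z" for z
          unfolding distrib_right[symmetric] by (rule mult_right_mono[OF _ weight_nonneg]) linarith
      qed
      also have "\<dots> = nm j + nm k" unfolding nm_def by (rule Bochner_Integration.integral_add[OF int int])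
      also have "\<dots> < \<kappa>" using J(1)[OF jk(1)] J(1)[OF jk(2)] by linarith
      finally show "(weighted_norm (\<lambda>z. U j z - U k z)) < \<kappa>" .
    qed
    show "\<exists>N. \<forall>x\<in>cball 0 r. \<forall>m\<ge>N. \<forall>n\<ge>N. dist (U m x) (U n x) < \<epsilon>"
    proof (intro exI[of _ J] ballI allI impI)
      fix x :: 'a and m n assume "x \<in> cball 0 r" "m \<ge> J" "n \<ge> J"
      then show "dist (U m x) (U n x) < \<epsilon>"
        using le[of m n x] le[of n m x] \<epsilon> by (simp add: dist_real_def)
    qed
  qed
  define w where "w x = (if x \<in> ball 0 1 then lim (\<lambda>j. U j x) else u x)" for x
  have ul: "uniform_limit (cball 0 r) U w sequentially" if r: "0 < r" "r < 1" for r
  proof -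
    obtain l where l: "uniform_limit (cball 0 r) U l sequentially"
      using Cauchy_uniformly_convergent[OF cauchy[OF r]] unfolding uniformly_convergent_on_def by blast
    have "l x = w x" if x: "x \<in> cball 0 r" for x
    proof -
      have "(\<lambda>j. U j x) \<longlonglongrightarrow> l x" using l x by (rule tendsto_uniform_limitI)
      then have "lim (\<lambda>j. U j x) = l x" by (rule limI)
      moreover have "x \<in> ball 0 1" using x r by simp
      ultimately show ?thesis by (simp add: w_def)
    qed
    with l show ?thesis by (metis (no_types, lifting) uniform_limit_cong')
  qed
  have ul': "uniform_limit (cball 0 r) U w sequentially" if "r < 1" for r
  proof (rule uniform_limit_on_subset)
    show "uniform_limit (cball 0 (max r (1/2))) U w sequentially" using that by (intro ul) auto
    show "cball 0 r \<subseteq> cball (0::'a) (max r (1/2))" by (rule subset_cball) simp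
  qed
  have pt: "(\<lambda>j. U j x) \<longlonglongrightarrow> w x" if x: "x \<in> ball 0 1" for x
    by (rule tendsto_uniform_limitI[OF ul'[of "norm x"]]) (use x in auto)
  have wb: "bounded_borel M w"
    unfolding bounded_borel_def
  proof (intro conjI allI)
    note [measurable] = bounded_borelD(1)[OF Ub] bounded_borelD(1)[OF u]
    have [measurable]: "(\<lambda>x. lim (\<lambda>j. U j x)) \<in> borel_measurable borel" by (rule borel_measurable_lim_metric) measurable
    have [measurable]: "ball (0::'a) 1 \<in> sets borel" by simp
    show "w \<in> borel_measurable borel" unfolding w_def by measurable
    show "\<bar>w x\<bar> \<le> M" for x
    proof (cases "x \<in> ball 0 1")
      case True
      have "(\<lambda>j. \<bar>U j x\<bar>) \<longlonglongrightarrow> \<bar>w x\<bar>" by (intro tendsto_rabs pt True)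
      then show ?thesis by (rule Lim_bounded) (use bounded_borelD(2)[OF Ub] in auto)
    next
      case False
      then show ?thesis using bounded_borelD(2)[OF u] by (simp add: w_def)
    qed
  qed
  have wc: "continuous_on (ball 0 1) w"
  proof (intro continuous_at_imp_continuous_on ballI)
    fix x :: 'a assume x: "x \<in> ball 0 1"
    define r where "r = (1 + norm x) / 2"
    have r: "norm x < r" "r < 1" unfolding r_def using x by auto
    have "continuous_on (cball 0 r) w"
      by (rule uniform_limit_theorem[OF _ ul'[OF r(2)]]) (auto intro!: always_eventually continuous_on_subset[OF Uc])
    then have "continuous_on (ball 0 r) w" using ball_subset_cball by (rule continuous_on_subset)
    then show "isCont w x" using r x by (simp add: continuous_on_eq_continuous_at)
  qed
  have ae: "AE x in lborel. w x = u x"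
  proof -
    let ?g = "\<lambda>h x. indicator (ball 0 1) x * (\<bar>h x - u x\<bar> * weight x)"
    have gb: "integrable lborel (?g h)" if "bounded_borel M h" for h
    proof -
      have "bounded_borel (M + M) (\<lambda>z. \<bar>h z - u z\<bar>)"
        by (rule bounded_borel_abs[OF bounded_borel_diff[OF that u]])
      then have "integrable lborel (\<lambda>z. \<bar>h z - u z\<bar> * weight z)" by (rule integrable_bounded_mult[OF _ weight_integrable])
      moreover have "bounded_borel 1 (indicator (ball (0::'a) 1))"
        unfolding bounded_borel_def by (intro conjI borel_measurable_indicator) (auto simp: indicator_def)
      ultimately show ?thesis using integrable_bounded_mult by blast
    qed
    have "(\<lambda>j. integral\<^sup>L lborel (?g (U j))) \<longlonglongrightarrow> integral\<^sup>L lborel (?g w)"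
    proof (rule integral_dominated_convergence[where w="\<lambda>x. (M + M) * weight x"])
      show "AE x in lborel. (\<lambda>j. ?g (U j) x) \<longlonglongrightarrow> ?g w x"
      proof (rule AE_I2)
        fix x show "(\<lambda>j. ?g (U j) x) \<longlonglongrightarrow> ?g w x"
        proof (cases "x \<in> ball 0 1")
          case True
          then show ?thesis by (intro tendsto_intros pt)
        qed simp
      qed
      show "AE x in lborel. norm (?g (U j) x) \<le> (M + M) * weight x" for j
      proof (rule AE_I2)
        fix x
        have "\<bar>U j x - u x\<bar> * weight x \<le> (M + M) * weight x"
          using bounded_borelD(2)[OF bounded_borel_diff[OF Ub[of j] u], of x] by (rule mult_right_mono[OF _ weight_nonneg])
        then show "norm (?g (U j) x) \<le> (M + M) * weight x"
          using weight_nonneg[of x] bounded_borel_nonneg[OF u] by (simp add: indicator_def abs_mult)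
      qed
    qed (use gb[OF wb] gb[OF Ub] weight_integrable in \<open>auto dest: borel_measurable_integrable\<close>)
    moreover have "(\<lambda>j. integral\<^sup>L lborel (?g (U j))) \<longlonglongrightarrow> 0"
    proof (rule tendsto_sandwich[OF _ _ tendsto_const nm])
      show "\<forall>\<^sub>F j in sequentially. 0 \<le> integral\<^sup>L lborel (?g (U j))"
        using weight_nonneg by (intro always_eventually allI integral_nonneg_AE AE_I2) auto
      show "\<forall>\<^sub>F j in sequentially. integral\<^sup>L lborel (?g (U j)) \<le> nm j"
        unfolding nm_def using weight_nonneg 
        by (intro always_eventually allI integral_mono gb Ub int) (auto simp: indicator_def)
    qed
    ultimately have "integral\<^sup>L lborel (?g w) = 0" by (rule LIMSEQ_unique)
    then have "AE x in lborel. ?g w x = 0"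
      using integral_nonneg_eq_0_iff_AE[OF gb[OF wb]] weight_nonneg by auto
    then show ?thesis
    proof eventually_elim
      case (elim x)
      then show ?case using weight_pos[of x] by (cases "x \<in> ball 0 1") (auto simp: w_def)
    qed
  qed
  have "(weighted_norm (\<lambda>z. U j z - w z)) = nm j" for j
    unfolding nm_def
  proof (rule integral_cong_AE)
    note [measurable] = bounded_borelD(1)[OF Ub] bounded_borelD(1)[OF u] bounded_borelD(1)[OF wb]
    show "(\<lambda>z. \<bar>U j z - w z\<bar> * weight z) \<in> borel_measurable lborel" by measurable
    show "(\<lambda>z. \<bar>U j z - u z\<bar> * weight z) \<in> borel_measurable lborel" by measurable
    show "AE z in lborel. \<bar>U j z - w z\<bar> * weight z = \<bar>U j z - u z\<bar> * weight z"
      using ae by eventually_elim simp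
  qed
  then have "approximates M f w U"
    unfolding approximates_def using wb Ub Uc nm ul' loc by simp
  with ae wc show ?thesis using that by blast
qed

text \<open>
  Adding \<open>(norm (x - x0))\<^sup>2\<close> to \<open>\<psi>\<close> makes \<open>x0\<close> the strict maximum of the difference with \<open>w\<close>, so by uniform
  convergence the maxima \<open>y\<close> of the difference with \<open>U j\<close> tend to \<open>x0\<close>. At \<open>y\<close> the second difference of
  \<open>U j\<close> is bounded by that of the perturbed \<open>\<psi>\<close>; the perturbation accounts for \<open>A + 1\<close> in place of \<open>A\<close>.
\<close>

lemma touching_inequality:
  assumes ap: "approximates M f w U" and wc: "continuous_on (ball 0 1) w"
    and d0: "0 < d0" "cball x0 d0 \<subseteq> ball 0 1"
    and \<psi>: "continuous_on (cball x0 d0) \<psi>" "\<And>x. x \<in> cball x0 d0 \<Longrightarrow> w x \<le> \<psi> x" "\<psi> x0 = w x0"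
    and sd: "\<And>x z. x + z \<in> cball x0 d0 \<Longrightarrow> x - z \<in> cball x0 d0 \<Longrightarrow> \<psi> (x + z) + \<psi> (x - z) - 2 * \<psi> x \<le> 2 * A * (norm z)\<^sup>2"
    and A: "0 \<le> A" and d: "0 < d" "d \<le> d0 / 2"
  shows "trunc_op d w x0 \<le> f x0 + (A + 1) * moment d"
proof -
  have wb: "bounded_borel M w" and Ub: "\<And>j. bounded_borel M (U j)" and Uc: "\<And>j. continuous_on UNIV (U j)"
    and nm: "(\<lambda>j. weighted_norm (\<lambda>z. U j z - w z)) \<longlonglongrightarrow> 0"
    and ul: "\<And>r. r < 1 \<Longrightarrow> uniform_limit (cball 0 r) U w sequentially"
    and loc: "\<And>y \<epsilon>. y \<in> ball 0 1 \<Longrightarrow> \<epsilon> > 0 \<Longrightarrow> \<exists>\<delta>>0. \<forall>\<^sub>F j in sequentially. \<forall>x\<in>ball y \<delta>.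
        \<exists>l. op_tendsto (U j) x l \<and> \<bar>l - f y\<bar> \<le> \<epsilon>"
    using ap unfolding approximates_def by blast+
  have "x0 \<in> cball x0 d0" using d0(1) by simp
  then have x0: "x0 \<in> ball 0 1" using d0(2) by blast
  have n0: "norm x0 + d0 < 1" using d0 by (simp add: cball_subset_ball_iff dist_norm)
  have d1: "d \<le> 1" using n0 d norm_ge_zero[of x0] by linarith
  define r where "r = norm x0 + d0"
  have r: "r < 1" and cr: "cball x0 d0 \<subseteq> cball 0 r" using n0 by (auto simp: r_def cball_subset_cball_iff dist_norm)
  have main: "trunc_op d w x0 \<le> f x0 + (A + 1) * moment d + (2 * mass d + 2 * dom_const d + 1) * \<epsilon>" if \<epsilon>: "0 < \<epsilon>" for \<epsilon>
  proof -
    obtain \<delta>1 where \<delta>1: "\<delta>1 > 0" and ev1: "\<forall>\<^sub>F j in sequentially. \<forall>x\<in>ball x0 \<delta>1.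
        \<exists>l. op_tendsto (U j) x l \<and> \<bar>l - f x0\<bar> \<le> \<epsilon>" using loc[OF x0 \<epsilon>] by blast
    obtain \<delta>2 where \<delta>2: "\<delta>2 > 0" "\<And>a. norm a < \<delta>2 \<Longrightarrow> shift_modulus w a < \<epsilon>" using shift_modulus_small[OF wb \<epsilon>] by blast
    obtain \<delta>3 where \<delta>3: "\<delta>3 > 0" "\<And>x. x \<in> ball 0 1 \<Longrightarrow> dist x x0 < \<delta>3 \<Longrightarrow> dist (w x) (w x0) < \<epsilon>"
      using wc x0 \<epsilon> unfolding continuous_on_iff by metis
    define \<delta> where "\<delta> = min (min \<delta>1 \<delta>2) (min \<delta>3 (d0 / 2))"
    have \<delta>: "0 < \<delta>" "\<delta> \<le> \<delta>1" "\<delta> \<le> \<delta>2" "\<delta> \<le> \<delta>3" "\<delta> \<le> d0 / 2" unfolding \<delta>_def using \<delta>1 \<delta>2 \<delta>3 d0 by auto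
    define \<rho> where "\<rho> = min \<epsilon> (\<delta>\<^sup>2 / 4)"
    have \<rho>: "0 < \<rho>" "\<rho> \<le> \<epsilon>" "\<rho> \<le> \<delta>\<^sup>2 / 4" unfolding \<rho>_def using \<epsilon> \<delta>(1) by auto
    have ev2: "\<forall>\<^sub>F j in sequentially. \<forall>x\<in>cball 0 r. dist (U j x) (w x) < \<rho>"
      using uniform_limitD[OF ul[OF r] \<rho>(1)] .
    have ev3: "\<forall>\<^sub>F j in sequentially. (weighted_norm (\<lambda>z. U j z - w z)) < \<epsilon>"
      using order_tendstoD(2)[OF nm \<epsilon>] .
    from eventually_conj[OF ev1 eventually_conj[OF ev2 ev3]] obtain j where
      j1: "\<And>x. x \<in> ball x0 \<delta>1 \<Longrightarrow> \<exists>l. op_tendsto (U j) x l \<and> \<bar>l - f x0\<bar> \<le> \<epsilon>"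
      and j2: "\<And>x. x \<in> cball 0 r \<Longrightarrow> dist (U j x) (w x) < \<rho>" and j3: "(weighted_norm (\<lambda>z. U j z - w z)) < \<epsilon>"
      unfolding eventually_sequentially by blast
    define h where "h x = U j x - \<psi> x - (norm (x - x0))\<^sup>2" for x
    have "\<exists>y\<in>cball x0 d0. \<forall>x\<in>cball x0 d0. h x \<le> h y"
    proof (rule continuous_attains_sup)
      show "continuous_on (cball x0 d0) h" unfolding h_def
        by (intro continuous_intros \<psi>(1) continuous_on_subset[OF Uc]) auto
    qed (use d0 in auto)
    then obtain y where y: "y \<in> cball x0 d0" and mx: "\<And>x. x \<in> cball x0 d0 \<Longrightarrow> h x \<le> h y" by blast
    have jw: "\<bar>U j x - w x\<bar> < \<rho>" if "x \<in> cball x0 d0" for x using j2[of x] cr that by (auto simp: dist_real_def)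
    have yn: "norm (y - x0) < \<delta>"
    proof (rule ccontr)
      assume "\<not> norm (y - x0) < \<delta>"
      then have "\<delta>\<^sup>2 \<le> (norm (y - x0))\<^sup>2" using \<delta>(1) by (intro power_mono) auto
      moreover have "h x0 \<le> h y" using mx[of x0] d0 by simp
      moreover have "- \<rho> < h x0" using jw[of x0] d0 \<psi>(3) by (simp add: h_def abs_less_iff)
      moreover have "h y \<le> \<rho> - (norm (y - x0))\<^sup>2" using jw[OF y] \<psi>(2)[OF y] by (simp add: h_def abs_less_iff)
      moreover have "\<delta>\<^sup>2 > 0" using \<delta>(1) by simp
      ultimately show False using \<rho>(3) by linarith
    qed
    have yb: "y \<in> ball 0 1" using y d0(2) by blast
    have sdU: "U j (y + z) + U j (y - z) - 2 * U j y \<le> 2 * (A + 1) * (norm z)\<^sup>2" if z: "norm z \<le> d" for z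
    proof -
      have in1: "y + z \<in> cball x0 d0" "y - z \<in> cball x0 d0"
      proof -
        have "norm ((y + z) - x0) \<le> d0" "norm ((y - z) - x0) \<le> d0"
          using yn z d \<delta>(5) norm_triangle_ineq[of "y - x0" z] norm_triangle_ineq4[of "y - x0" z]
          by (simp_all add: algebra_simps)
        then show "y + z \<in> cball x0 d0" "y - z \<in> cball x0 d0"
          by (simp_all add: dist_norm norm_minus_commute[of x0])
      qed
      have "(norm (y + z - x0))\<^sup>2 + (norm (y - z - x0))\<^sup>2 - 2 * (norm (y - x0))\<^sup>2 = 2 * (norm z)\<^sup>2"
        by (simp add: power2_norm_eq_inner inner_simps inner_commute)
      then show ?thesis using mx[OF in1(1)] mx[OF in1(2)] sd[OF in1] unfolding h_def
        by (simp add: distrib_left distrib_right)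
    qed
    have "y \<in> ball x0 \<delta>1" using yn \<delta>(2) by (simp add: dist_norm norm_minus_commute)
    then obtain l where l: "op_tendsto (U j) y l" "\<bar>l - f x0\<bar> \<le> \<epsilon>" using j1 by blast
    obtain n0 where n0: "1 / real (Suc n0) < d" using nat_approx_posE[OF d(1)] by blast
    have "trunc_op d (U j) y - (A + 1) * moment d \<le> l"
    proof (rule Lim_bounded2[OF l(1)])
      show "\<forall>n\<ge>n0. trunc_op d (U j) y - (A + 1) * moment d \<le> trunc_op (1 / real (Suc n)) (U j) y"
      proof (intro allI impI)
        fix n assume "n0 \<le> n"
        then have "1 / real (Suc n) \<le> 1 / real (Suc n0)" by (simp add: frac_le)
        then show "trunc_op d (U j) y - (A + 1) * moment d \<le> trunc_op (1 / real (Suc n)) (U j) y"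
          using n0 d1 sdU A by (intro trunc_op_touching[OF Ub]) auto
      qed
    qed
    then have 1: "trunc_op d (U j) y \<le> f x0 + \<epsilon> + (A + 1) * moment d" using l(2) by linarith
    have Uy: "w x0 - 2 * \<epsilon> \<le> U j y"
    proof -
      have "\<bar>w y - w x0\<bar> < \<epsilon>" using \<delta>3(2)[OF yb] yn \<delta>(4) by (simp add: dist_norm)
      then show ?thesis using jw[OF y] \<rho>(2) by linarith
    qed
    have I1: "\<bar>(trunc_avg d (U j) y) - (trunc_avg d w y)\<bar> \<le> dom_const d * \<epsilon>"
    proof -
      have "(trunc_avg d (U j) y) - (trunc_avg d w y) = (LBINT z. (U j (y + z) - w (y + z)) * trunc_kernel d z)"
        using trunc_avg_integrable[OF Ub d(1)]
          trunc_avg_integrable[OF wb d(1)]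
        by (simp add: left_diff_distrib)
      also have "\<bar>\<dots>\<bar> \<le> dom_const d * (weighted_norm (\<lambda>z. U j z - w z))"
        using yb by (intro trunc_integral_le_weighted[OF bounded_borel_diff[OF Ub wb] d(1)]) simp
      also have "\<dots> \<le> dom_const d * \<epsilon>" using j3 dom_const_nonneg by (intro mult_left_mono) auto
      finally show ?thesis .
    qed
    have I2: "\<bar>(trunc_avg d w y) - (trunc_avg d w x0)\<bar> \<le> dom_const d * \<epsilon>"
    proof -
      have "\<bar>(trunc_avg d w y) - (trunc_avg d w x0)\<bar> \<le> dom_const d * shift_modulus w (y - x0)"
        using x0 by (intro trunc_integral_shift_le[OF wb d(1)]) simp
      also have "\<dots> \<le> dom_const d * \<epsilon>"
        using \<delta>2(2)[of "y - x0"] yn \<delta>(3) dom_const_nonneg by (intro mult_left_mono) auto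
      finally show ?thesis .
    qed
    have "(w x0 - 2 * \<epsilon>) * mass d \<le> U j y * mass d" using Uy mass_nonneg by (rule mult_right_mono)
    then have "w x0 * mass d - 2 * mass d * \<epsilon> \<le> U j y * mass d" by (simp add: algebra_simps)
    then show ?thesis using 1 I1 I2 unfolding trunc_op_eq[OF Ub d(1)] trunc_op_eq[OF wb d(1)]
      by (simp add: distrib_right mult.commute[of \<epsilon>])
  qed
  define B where "B = 2 * mass d + 2 * dom_const d + 1"
  have B: "B > 0" unfolding B_def using mass_nonneg[of d] dom_const_nonneg[of d] by linarith
  show ?thesis
  proof (rule field_le_epsilon)
    fix \<epsilon> :: real assume "0 < \<epsilon>"
    then have "0 < \<epsilon> / B" using B by simp
    from main[OF this] show "trunc_op d w x0 \<le> f x0 + (A + 1) * moment d + \<epsilon>"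
      using B unfolding B_def[symmetric] by simp
  qed
qed

section \<open>Penalized truncated equations and doubling of variables\<close>

text \<open>
  The viscosity condition for touching from above by a paraboloid in a ball that is continued by \<open>w\<close>
  itself, written out: the value of the operator at such a test function is
  \<open>trunc_op \<delta> w x - a * moment \<delta>\<close>.
\<close>

definition paraboloid_subsolution :: "('a \<Rightarrow> real) \<Rightarrow> ('a \<Rightarrow> real) \<Rightarrow> bool" where
  "paraboloid_subsolution w f \<longleftrightarrow>
     (\<forall>x \<delta> a q. x \<in> ball 0 1 \<longrightarrow> 0 < \<delta> \<longrightarrow> ball x \<delta> \<subseteq> ball 0 1 \<longrightarrow> 0 \<le> a \<longrightarrow>
        (\<forall>h. norm h < \<delta> \<longrightarrow> w (x + h) \<le> w x + q \<bullet> h + a * (norm h)\<^sup>2) \<longrightarrow>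
        trunc_op \<delta> w x \<le> f x + a * moment \<delta>)"

lemma paraboloid_subsolutionD:
  assumes "paraboloid_subsolution w f" "x \<in> ball 0 1" "0 < \<delta>" "ball x \<delta> \<subseteq> ball 0 1" "0 \<le> a"
    and "\<And>h. norm h < \<delta> \<Longrightarrow> w (x + h) \<le> w x + q \<bullet> h + a * (norm h)\<^sup>2"
  shows "trunc_op \<delta> w x \<le> f x + a * moment \<delta>"
  using assms unfolding paraboloid_subsolution_def by blast

text \<open>
  The coefficient of the penalty blows up at the sphere \<open>norm x = r\<close>. This prescribes the values \<open>w\<close> outside the ball
  without creating a jump across the sphere, which the truncated equation alone would do.
\<close>

definition penalized_solution :: "real \<Rightarrow> real \<Rightarrow> ('a \<Rightarrow> real) \<Rightarrow> ('a \<Rightarrow> real) \<Rightarrow> ('a \<Rightarrow> real) \<Rightarrow> bool" where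
  "penalized_solution \<rho> r w f v \<longleftrightarrow>
     (\<exists>M. bounded_borel M v) \<and> continuous_on (ball 0 1) v \<and> (\<forall>x. r \<le> norm x \<longrightarrow> v x = w x) \<and>
     (\<forall>x. norm x < r \<longrightarrow> trunc_op \<rho> v x = f x - (v x - w x) / (r - norm x))"

lemma penalized_solution_uminus:
  assumes "penalized_solution \<rho> r w f v"
  shows "penalized_solution \<rho> r (\<lambda>x. - w x) (\<lambda>x. - f x) (\<lambda>x. - v x)"
proof -
  have "trunc_op \<rho> (\<lambda>x. - v x) x = - f x - (- v x - - w x) / (r - norm x)" if "norm x < r" for x
  proof -
    have e: "- v x - - w x = - (v x - w x)" by simp
    have "(- v x - - w x) / (r - norm x) = - ((v x - w x) / (r - norm x))"
      unfolding e by (rule minus_divide_left[symmetric])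
    moreover have "trunc_op \<rho> v x = f x - (v x - w x) / (r - norm x)"
      using assms that unfolding penalized_solution_def by blast
    ultimately show ?thesis unfolding trunc_op_uminus by linarith
  qed
  then show ?thesis using assms bounded_borel_uminus
    unfolding penalized_solution_def by (auto intro: continuous_on_minus)
qed

text \<open>
  Multiplied by \<open>r - norm x\<close>, the equation for \<open>g = v - w\<close> becomes a fixed point equation on bounded
  continuous functions. Because \<open>r - norm x \<le> 1\<close>, its Lipschitz constant is at most
  \<open>c / (1 + c)\<close>, where \<open>c\<close> is the mass of the truncated kernel.
\<close>

lemma penalized_solution_exists:
  assumes w: "bounded_borel M w" and wc: "continuous_on (ball 0 1) w" and fc: "continuous_on (ball 0 1) f"
    and r: "0 < r" "r < 1" and \<rho>: "0 < \<rho>"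
  shows "\<exists>v. penalized_solution \<rho> r w f v"
proof -
  define c where "c = mass \<rho>"
  have c: "0 \<le> c" unfolding c_def by (rule mass_nonneg)
  define \<theta> where "\<theta> x = max 0 (r - norm x)" for x :: 'a
  have \<theta>: "0 \<le> \<theta> x" "\<theta> x \<le> 1" for x
  proof -
    have "r - norm x \<le> 1" using r norm_ge_zero[of x] by linarith
    then show "0 \<le> \<theta> x" "\<theta> x \<le> 1" by (auto simp: \<theta>_def)
  qed
  have den: "0 < 1 + \<theta> x * c" for x using \<theta>(1)[of x] c by (simp add: add_pos_nonneg)
  define G where "G g x = \<theta> x / (1 + \<theta> x * c) * (f x - trunc_op \<rho> w x + (trunc_avg \<rho> g x))"
    for g :: "'a \<Rightarrow> real" and x
  have bc: "bounded_borel (norm g) (apply_bcontfun g)" for g :: "'a \<Rightarrow>\<^sub>C real"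
    unfolding bounded_borel_def using norm_bounded[of g]
    by (auto intro: borel_measurable_continuous_onI)
  have tc: "continuous_on (ball 0 1) (trunc_op \<rho> w)"
  proof -
    have "continuous_on (ball 0 1) (\<lambda>x. w x * mass \<rho> - (trunc_avg \<rho> w x))"
      by (intro continuous_intros wc trunc_integral_continuous[OF w \<rho>])
    then show ?thesis unfolding trunc_op_eq[OF w \<rho>, symmetric] .
  qed
  have Gz: "G g x = 0" if "r \<le> norm x" for g x using that by (simp add: G_def \<theta>_def)
  have Gc: "continuous_on UNIV (G (apply_bcontfun g))" for g
  proof -
    have 1: "continuous_on (ball 0 1) (G (apply_bcontfun g))"
      unfolding G_def \<theta>_def
      by (intro continuous_intros fc tc trunc_integral_continuous[OF bc \<rho>]) (use den in \<open>auto simp: \<theta>_def less_imp_neq[THEN not_sym]\<close>)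
    have "continuous_on (- cball 0 r) (\<lambda>_::'a. 0::real)" by simp
    then have 2: "continuous_on (- cball 0 r) (G (apply_bcontfun g))"
      by (rule continuous_on_eq) (simp add: Gz)
    have "continuous_on (ball 0 1 \<union> - cball 0 r) (G (apply_bcontfun g))"
      by (rule continuous_on_open_Un[OF _ _ 1 2]) auto
    moreover have "ball 0 1 \<union> - cball (0::'a) r = UNIV" using r by auto
    ultimately show ?thesis by simp
  qed
  have Gb: "G (apply_bcontfun g) \<in> bcontfun" for g
  proof -
    have "compact (G (apply_bcontfun g) ` cball 0 r)"
      by (intro compact_continuous_image continuous_on_subset[OF Gc]) auto
    then have "bounded (G (apply_bcontfun g) ` cball 0 r)" by (rule compact_imp_bounded)
    then obtain B where B: "\<forall>y\<in>G (apply_bcontfun g) ` cball 0 r. norm y \<le> B" unfolding bounded_iff by blast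
    show ?thesis
    proof (rule bcontfun_normI[OF Gc])
      show "norm (G (apply_bcontfun g) x) \<le> \<bar>B\<bar>" for x
      proof (cases "x \<in> cball 0 r")
        case True
        then have "norm (G (apply_bcontfun g) x) \<le> B" using B by blast
        then show ?thesis by linarith
      qed (simp add: Gz)
    qed
  qed
  define T where "T g = Bcontfun (G (apply_bcontfun g))" for g
  have T: "apply_bcontfun (T g) = G (apply_bcontfun g)" for g
    unfolding T_def by (rule Bcontfun_inverse[OF Gb])
  have "\<exists>!g. T g = g"
  proof (rule banach_fix_type)
    show "0 \<le> c / (1 + c)" "c / (1 + c) < 1" using c by auto
    show "\<forall>g g'. dist (T g) (T g') \<le> c / (1 + c) * dist g g'"
    proof (intro allI dist_bound)
      fix g g' :: "'a \<Rightarrow>\<^sub>C real" and x :: 'a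
      have b: "bounded_borel (dist g g') (\<lambda>z. g z - g' z)"
        unfolding bounded_borel_def
      proof (intro conjI allI)
        show "(\<lambda>z. g z - g' z) \<in> borel_measurable borel"
          using bounded_borelD(1)[OF bc[of g]] bounded_borelD(1)[OF bc[of g']] by measurable
        show "\<bar>g z - g' z\<bar> \<le> dist g g'" for z using dist_bounded[of g z g'] by (simp add: dist_real_def)
      qed
      note k = trunc_kernel_integrable[OF \<rho>]
      have "T g x - T g' x = \<theta> x / (1 + \<theta> x * c) *
          ((trunc_avg \<rho> g x) - (trunc_avg \<rho> g' x))"
        unfolding T G_def by (simp add: right_diff_distrib distrib_left)
      also have "\<dots> = \<theta> x / (1 + \<theta> x * c) * (LBINT z. (g (x + z) - g' (x + z)) * trunc_kernel \<rho> z)"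
        using integrable_bounded_mult[OF bounded_borel_translate[OF bc] k] by (simp add: left_diff_distrib)
      finally have "\<bar>T g x - T g' x\<bar> = \<theta> x / (1 + \<theta> x * c) * \<bar>LBINT z. (g (x + z) - g' (x + z)) * trunc_kernel \<rho> z\<bar>"
        using \<theta>(1)[of x] den[of x] by (simp add: abs_mult)
      also have "\<dots> \<le> 1 / (1 + c) * (dist g g' * c)"
      proof (rule mult_mono)
        have "\<theta> x * (1 + c) \<le> 1 + \<theta> x * c" using \<theta>(2)[of x] by (simp add: distrib_left)
        then show "\<theta> x / (1 + \<theta> x * c) \<le> 1 / (1 + c)" using den[of x] c by (simp add: divide_simps)
        show "\<bar>LBINT z. (g (x + z) - g' (x + z)) * trunc_kernel \<rho> z\<bar> \<le> dist g g' * c"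
          unfolding c_def mass_def
          by (rule integral_abs_bounded_mult_le[OF bounded_borel_translate[OF b, of x] k trunc_kernel_nonneg])
      qed (use c in auto)
      finally show "dist (T g x) (T g' x) \<le> c / (1 + c) * dist g g'" by (simp add: dist_real_def mult.commute)
    qed
  qed
  then obtain g where g: "T g = g" by blast
  have gG: "g x = G (apply_bcontfun g) x" for x using T[of g] unfolding g by metis
  define v where "v x = w x + g x" for x
  have "bounded_borel (M + norm g) v" unfolding v_def by (rule bounded_borel_add[OF w bc])
  moreover have "continuous_on (ball 0 1) v" unfolding v_def by (intro continuous_on_add wc) simp
  moreover have "v x = w x" if "r \<le> norm x" for x using gG[of x] Gz[OF that] by (simp add: v_def)
  moreover have "trunc_op \<rho> v x = f x - (v x - w x) / (r - norm x)" if "norm x < r" for x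
  proof -
    have \<theta>x: "\<theta> x = r - norm x" "0 < \<theta> x" using that by (auto simp: \<theta>_def)
    let ?I = "trunc_avg \<rho> g x"
    have "g x * (1 + \<theta> x * c) = \<theta> x * (f x - trunc_op \<rho> w x + ?I)"
      using gG[of x] den[of x] unfolding G_def by (simp add: field_simps)
    then have "g x * c - ?I = f x - trunc_op \<rho> w x - g x / \<theta> x"
      using \<theta>x(2) by (simp add: field_simps)
    moreover have "trunc_op \<rho> v x = trunc_op \<rho> w x + (g x * c - ?I)"
    proof -
      have "trunc_op \<rho> v x = trunc_op \<rho> (\<lambda>x. w x - - g x) x" by (simp add: v_def[abs_def])
      also have "\<dots> = trunc_op \<rho> w x - trunc_op \<rho> (\<lambda>x. - g x) x"
        by (rule trunc_op_diff[OF w bounded_borel_uminus[OF bc] \<rho>])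
      finally show ?thesis unfolding trunc_op_uminus trunc_op_eq[OF bc \<rho>] c_def by simp
    qed
    ultimately show ?thesis unfolding \<theta>x(1) v_def by simp
  qed
  ultimately show ?thesis unfolding penalized_solution_def by blast
qed

text \<open>
  Let \<open>(x, y)\<close> maximize \<open>w x - v y - (norm (x - y))\<^sup>2 / \<epsilon>\<close> and let the maximum \<open>m\<close> exceed \<open>\<tau>\<close>. If \<open>norm y \<ge> r\<close>,
  then \<open>v y = w y\<close> and continuity of \<open>w\<close> is violated. Otherwise the paraboloid inequality for \<open>w\<close> at \<open>x\<close>
  and the equation for \<open>v\<close> at \<open>y\<close> are subtracted. Maximality makes the contribution of jumps within the
  ball nonnegative; the others lead to points where \<open>v\<close> agrees with \<open>w\<close>, so that they cost at most a
  modulus of continuity of \<open>w\<close> in the mean. The penalty contributes at least \<open>m\<close> up to a small error,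
  a contradiction. The radius \<open>\<rho>\<close> is chosen after \<open>\<epsilon>\<close>, since the short jumps cost \<open>moment \<rho> / \<epsilon>\<close>.
\<close>

lemma penalized_comparison:
  assumes w: "bounded_borel M w" and wc: "continuous_on (ball 0 1) w" and fc: "continuous_on (ball 0 1) f"
    and r: "0 < r" "r < 1" and sub: "paraboloid_subsolution w f" and \<tau>: "0 < \<tau>"
  shows "\<exists>\<rho>0>0. \<forall>\<rho> v. 0 < \<rho> \<longrightarrow> \<rho> < \<rho>0 \<longrightarrow> penalized_solution \<rho> r w f v \<longrightarrow> (\<forall>x. w x - v x \<le> \<tau>)"
proof -
  define R where "R = (1 + r) / 2"
  define D where "D = (R - r) / 2"
  have R: "r < R" "R < 1" "0 < D" "D \<le> 1" "r + D = R - D" unfolding R_def D_def using r by (auto simp: field_simps)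
  define t where "t = \<tau> / 4"
  have t: "0 < t" "\<tau> = 4 * t" unfolding t_def using \<tau> by auto
  have cb: "cball 0 R \<subseteq> ball (0::'a) 1" using R by auto
  have "uniformly_continuous_on (cball 0 R) w" "uniformly_continuous_on (cball 0 R) f"
    by (auto intro!: compact_uniformly_continuous continuous_on_subset[OF wc cb] continuous_on_subset[OF fc cb])
  then obtain \<delta>1 \<delta>2 where \<delta>1: "\<delta>1 > 0" "\<And>x y. x \<in> cball 0 R \<Longrightarrow> y \<in> cball 0 R \<Longrightarrow> dist x y < \<delta>1 \<Longrightarrow> dist (w x) (w y) < t"
    and \<delta>2: "\<delta>2 > 0" "\<And>x y. x \<in> cball 0 R \<Longrightarrow> y \<in> cball 0 R \<Longrightarrow> dist x y < \<delta>2 \<Longrightarrow> dist (f x) (f y) < t"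
    unfolding uniformly_continuous_on_def using t(1) by metis
  have "0 < t / (dom_const D + 1)" using t dom_const_nonneg[of D] by simp
  from shift_modulus_small[OF w this] obtain \<delta>3 where
    \<delta>3: "\<delta>3 > 0" "\<And>a. norm a < \<delta>3 \<Longrightarrow> shift_modulus w a < t / (dom_const D + 1)" by blast
  define \<delta> where "\<delta> = min (min \<delta>1 \<delta>2) (min \<delta>3 D)"
  have \<delta>: "0 < \<delta>" "\<delta> \<le> \<delta>1" "\<delta> \<le> \<delta>2" "\<delta> \<le> \<delta>3" "\<delta> \<le> D" unfolding \<delta>_def using \<delta>1 \<delta>2 \<delta>3 R by auto
  have M: "0 \<le> M" using w by (rule bounded_borel_nonneg)
  \<comment> \<open>At the maximum \<open>(norm (x - y))\<^sup>2 / \<epsilon> \<le> 2 * M\<close>, and this choice turns that into \<open>norm (x - y) < \<delta>\<close>.\<close>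
  define \<epsilon> where "\<epsilon> = \<delta>\<^sup>2 / (2 * M + 1)"
  have \<epsilon>: "0 < \<epsilon>" unfolding \<epsilon>_def using \<delta> M by simp
  have "\<forall>\<^sub>F \<rho> in at_right 0. moment \<rho> < t * \<epsilon>"
    using order_tendstoD(2)[OF moment_tendsto_0, of "t * \<epsilon>"] t \<epsilon> by simp
  then obtain \<rho>1 where \<rho>1: "\<rho>1 > 0" "\<And>\<rho>. 0 < \<rho> \<Longrightarrow> \<rho> < \<rho>1 \<Longrightarrow> moment \<rho> < t * \<epsilon>"
    unfolding eventually_at_right_field by auto
  show ?thesis
  proof (intro exI[of _ "min \<rho>1 D"] conjI allI impI)
    show "0 < min \<rho>1 D" using \<rho>1 R by simp
    fix \<rho> v xh
    assume \<rho>: "0 < \<rho>" "\<rho> < min \<rho>1 D" and ps: "penalized_solution \<rho> r w f v"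
    then obtain M' where v: "bounded_borel M' v" and vc: "continuous_on (ball 0 1) v"
      and vw: "\<And>x. r \<le> norm x \<Longrightarrow> v x = w x"
      and veq: "\<And>x. norm x < r \<Longrightarrow> trunc_op \<rho> v x = f x - (v x - w x) / (r - norm x)"
      unfolding penalized_solution_def by blast
    show "w xh - v xh \<le> \<tau>"
    proof (rule ccontr)
      assume "\<not> w xh - v xh \<le> \<tau>"
      then have xh: "\<tau> < w xh - v xh" by simp
      then have "norm xh < r" using vw[of xh] \<tau> by force
      then have xhB: "xh \<in> cball 0 R" using R by simp
      define P where "P p = w (fst p) - v (snd p) - (norm (fst p - snd p))\<^sup>2 / \<epsilon>" for p
      have "\<exists>p\<in>cball 0 R \<times> cball 0 R. \<forall>q\<in>cball 0 R \<times> cball 0 R. P q \<le> P p"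
      proof (rule continuous_attains_sup)
        show "compact (cball (0::'a) R \<times> cball (0::'a) R)" by (intro compact_Times compact_cball)
        show "cball (0::'a) R \<times> cball (0::'a) R \<noteq> {}" using xhB by (metis SigmaI empty_iff)
        show "continuous_on (cball 0 R \<times> cball 0 R) P"
          unfolding P_def using cb \<epsilon>
          by (intro continuous_intros continuous_on_compose2[OF wc] continuous_on_compose2[OF vc]) auto
      qed
      then obtain x y where xB: "x \<in> cball 0 R" and yB: "y \<in> cball 0 R"
        and mx': "\<And>q. q \<in> cball 0 R \<times> cball 0 R \<Longrightarrow> P q \<le> P (x, y)" by auto
      have mx: "w a - v b - (norm (a - b))\<^sup>2 / \<epsilon> \<le> w x - v y - (norm (x - y))\<^sup>2 / \<epsilon>"
        if "a \<in> cball 0 R" "b \<in> cball 0 R" for a b using mx'[of "(a, b)"] that by (simp add: P_def)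
      define m where "m = w x - v y - (norm (x - y))\<^sup>2 / \<epsilon>"
      have m: "\<tau> < m" using mx[OF xhB xhB] xh unfolding m_def by simp
      have sq: "0 \<le> (norm (x - y))\<^sup>2 / \<epsilon>" using \<epsilon> by simp
      have "(norm (x - y))\<^sup>2 / \<epsilon> \<le> w x - w y" using mx[OF yB yB] by simp
      also have "\<dots> \<le> 2 * M" using bounded_borelD(2)[OF w, of x] bounded_borelD(2)[OF w, of y] by (simp add: abs_le_iff)
      finally have "(norm (x - y))\<^sup>2 \<le> 2 * M * \<epsilon>" using \<epsilon> by (simp add: field_simps)
      also have "\<dots> < \<delta>\<^sup>2"
      proof -
        have "2 * M * \<delta>\<^sup>2 < \<delta>\<^sup>2 * (2 * M + 1)" using \<delta>(1) by (simp add: algebra_simps)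
        then show ?thesis unfolding \<epsilon>_def using M by (simp add: field_simps)
      qed
      finally have xy: "norm (x - y) < \<delta>" using \<delta>(1) by (simp add: power2_less_imp_less)
      have wxy: "\<bar>w x - w y\<bar> < t" using \<delta>1(2)[OF xB yB] xy \<delta>(2) by (simp add: dist_norm)
      have fxy: "\<bar>f x - f y\<bar> < t" using \<delta>2(2)[OF xB yB] xy \<delta>(3) by (simp add: dist_norm)
      have yr: "norm y < r"
      proof (rule ccontr)
        assume "\<not> norm y < r"
        then have "m \<le> w x - w y" using vw[of y] sq by (simp add: m_def)
        then show False using m wxy t by linarith
      qed
      have nx: "norm x \<le> R - D" using norm_triangle_ineq[of "x - y" y] xy yr \<delta>(5) R(5) by simp
      have inB: "x + h \<in> cball 0 R" if "norm h < \<rho>" for h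
        using norm_triangle_ineq[of x h] nx that \<rho> by simp
      have "trunc_op \<rho> w x \<le> f x + (1 / \<epsilon>) * moment \<rho>"
      proof -
        have "ball x \<rho> \<subseteq> ball 0 1"
        proof
          fix u assume "u \<in> ball x \<rho>"
          then have "x + (u - x) \<in> cball 0 R" by (intro inB) (simp add: dist_norm norm_minus_commute)
          then show "u \<in> ball 0 1" using cb by auto
        qed
        moreover have "w (x + h) \<le> w x + ((2 / \<epsilon>) *\<^sub>R (x - y)) \<bullet> h + (1 / \<epsilon>) * (norm h)\<^sup>2" if "norm h < \<rho>" for h
        proof -
          have "(norm (x + h - y))\<^sup>2 = (norm (x - y))\<^sup>2 + 2 * ((x - y) \<bullet> h) + (norm h)\<^sup>2"
            by (simp add: power2_norm_eq_inner inner_simps inner_commute)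
          then have "(norm (x + h - y))\<^sup>2 / \<epsilon> = (norm (x - y))\<^sup>2 / \<epsilon> + ((2 / \<epsilon>) *\<^sub>R (x - y)) \<bullet> h + (1 / \<epsilon>) * (norm h)\<^sup>2"
            by (simp add: add_divide_distrib)
          then show ?thesis using mx[OF inB[OF that] yB] by linarith
        qed
        moreover have "x \<in> ball 0 1" using xB cb by blast
        ultimately show ?thesis using \<rho>(1) \<epsilon>
          by (intro paraboloid_subsolutionD[OF sub, where q="(2 / \<epsilon>) *\<^sub>R (x - y)"]) auto
      qed
      moreover have "(1 / \<epsilon>) * moment \<rho> < t" using \<rho>1(2)[of \<rho>] \<rho> \<epsilon> by (simp add: field_simps)
      ultimately have up: "trunc_op \<rho> w x < f x + t" by linarith
      have lo: "f y - t + m \<le> trunc_op \<rho> v y"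
      proof -
        have le: "v y - w y \<le> t - m" using wxy sq unfolding m_def by linarith
        then have neg: "v y - w y \<le> 0" using m t by linarith
        have "0 < r - norm y" "r - norm y \<le> 1" using yr r norm_ge_zero[of y] by linarith+
        then have "(v y - w y) / (r - norm y) \<le> v y - w y" using neg by (simp add: divide_simps mult_le_cancel_left1)
        then show ?thesis using veq[OF yr] le by linarith
      qed
      have diff: "- t \<le> trunc_op \<rho> w x - trunc_op \<rho> v y"
      proof -
        define g where "g z = \<bar>w ((x - y) + z) - w z\<bar>" for z
        have g: "bounded_borel (M + M) g" unfolding g_def
          by (rule bounded_borel_abs[OF bounded_borel_diff[OF bounded_borel_translate[OF w] w]])
        have gxy: "g (y + z) = \<bar>w (x + z) - w (y + z)\<bar>" for z by (simp add: g_def)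
        have ig: "integrable lborel (\<lambda>z. g (y + z) * trunc_kernel D z)"
          by (rule trunc_avg_integrable[OF g R(3)])
        note k = trunc_kernel_integrable[OF \<rho>(1)]
        have c1: "integrable lborel (\<lambda>z. (w x - w (x + z)) * trunc_kernel \<rho> z)"
          using integrable_bounded_mult[OF bounded_borel_translate[OF w] k] k by (simp add: left_diff_distrib)
        have c2: "integrable lborel (\<lambda>z. (v y - v (y + z)) * trunc_kernel \<rho> z)"
          using integrable_bounded_mult[OF bounded_borel_translate[OF v] k] k by (simp add: left_diff_distrib)
        have "(trunc_avg D g y) \<le> dom_const D * (weighted_norm g)"
          using trunc_integral_le_weighted[OF g R(3), of y] yr r by (simp add: abs_le_iff)
        also have "\<dots> = dom_const D * shift_modulus w (x - y)" by (simp add: g_def shift_modulus_def)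
        also have "\<dots> \<le> dom_const D * (t / (dom_const D + 1))"
          using \<delta>3(2)[of "x - y"] xy \<delta>(4) dom_const_nonneg[of D] by (intro mult_left_mono) auto
        also have "\<dots> \<le> t" using t dom_const_nonneg[of D] by (simp add: field_simps)
        finally have "- t \<le> - (trunc_avg D g y)" by simp
        also have "\<dots> = (LBINT z. - (g (y + z) * trunc_kernel D z))" by simp
        also have "\<dots> \<le> (LBINT z. (w x - w (x + z)) * trunc_kernel \<rho> z - (v y - v (y + z)) * trunc_kernel \<rho> z)"
        proof (rule integral_mono)
          show "integrable lborel (\<lambda>z. - (g (y + z) * trunc_kernel D z))" using ig by simp
          show "integrable lborel (\<lambda>z. (w x - w (x + z)) * trunc_kernel \<rho> z - (v y - v (y + z)) * trunc_kernel \<rho> z)"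
            by (rule Bochner_Integration.integrable_diff[OF c1 c2])
          fix z
          have gn: "0 \<le> g (y + z) * trunc_kernel D z" using trunc_kernel_nonneg by (simp add: gxy)
          show "- (g (y + z) * trunc_kernel D z) \<le> (w x - w (x + z)) * trunc_kernel \<rho> z - (v y - v (y + z)) * trunc_kernel \<rho> z"
          proof (cases "x + z \<in> cball 0 R \<and> y + z \<in> cball 0 R")
            case True
            then have "0 \<le> (w x - w (x + z)) - (v y - v (y + z))" using mx[of "x + z" "y + z"] by simp
            then have "0 \<le> ((w x - w (x + z)) - (v y - v (y + z))) * trunc_kernel \<rho> z"
              using trunc_kernel_nonneg by simp
            then show ?thesis using gn by (simp add: left_diff_distrib)
          next
            case False
            have "norm (x + z) \<le> norm (y + z) + norm (x - y)" using norm_triangle_ineq[of "y + z" "x - y"] by (simp add: add.commute)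
            then have yz: "R - D < norm (y + z)" using False xy \<delta>(5) R(3) by auto
            then have "v (y + z) = w (y + z)" using R by (intro vw) linarith
            then have "- g (y + z) \<le> (w x - w (x + z)) - (v y - v (y + z))"
              using m \<tau> sq unfolding m_def gxy by linarith
            then have "- g (y + z) * trunc_kernel \<rho> z \<le> ((w x - w (x + z)) - (v y - v (y + z))) * trunc_kernel \<rho> z"
              by (rule mult_right_mono[OF _ trunc_kernel_nonneg])
            moreover have "D < norm z" using yz norm_triangle_ineq[of y z] yr R(5) by linarith
            then have "trunc_kernel \<rho> z = trunc_kernel D z" using \<rho> by (simp add: trunc_kernel_def)
            ultimately show ?thesis by (simp add: left_diff_distrib)
          qed
        qed
        also have "\<dots> = trunc_op \<rho> w x - trunc_op \<rho> v y"
          unfolding trunc_op_def by (rule Bochner_Integration.integral_diff[OF c1 c2])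
        finally show ?thesis .
      qed
      show False using up lo diff fxy m t by linarith
    qed
  qed
qed

lemma trunc_pairing_symmetric:
  assumes u: "bounded_borel M u" and \<eta>: "bounded_borel N \<eta>" "integrable lborel \<eta>" and r: "0 < r"
  shows "(LBINT x. u x * trunc_op r \<eta> x) = (LBINT x. trunc_op r u x * \<eta> x)"
proof -
  note [measurable] = bounded_borelD(1)[OF u]
  note k = trunc_kernel_integrable[OF r]
  have i1: "integrable lborel (\<lambda>x. u x * (trunc_avg r \<eta> x))"
    by (rule integrable_bounded_mult[OF u average_integrable[OF \<eta>(2) r]])
  have i2: "integrable lborel (\<lambda>x. u x * \<eta> x)" by (rule integrable_bounded_mult[OF u \<eta>(2)])
  have refl: "(LBINT z. u (x - z) * trunc_kernel r z) = (trunc_avg r u x)" for x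
  proof -
    have "(LBINT z. u (x + - z) * trunc_kernel r (- z)) = (trunc_avg r u x)"
      by (rule lborel_integral_reflect) measurable
    then show ?thesis by (simp add: trunc_kernel_sym)
  qed
  have "bounded_borel (M * mass r) (\<lambda>x. trunc_avg r u x)"
    unfolding bounded_borel_def
  proof (intro conjI allI)
    show "(\<lambda>x. trunc_avg r u x) \<in> borel_measurable borel" by measurable
    show "\<bar>trunc_avg r u x\<bar> \<le> M * mass r" for x
      unfolding mass_def
      by (rule integral_abs_bounded_mult_le[OF bounded_borel_translate[OF u, of x] k trunc_kernel_nonneg])
  qed
  from integrable_bounded_mult[OF this \<eta>(2)]
  have i3: "integrable lborel (\<lambda>x. (trunc_avg r u x) * \<eta> x)" .
  have "(LBINT x. u x * trunc_op r \<eta> x) = (LBINT x. u x * \<eta> x * mass r - u x * (trunc_avg r \<eta> x))"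
    unfolding trunc_op_eq[OF \<eta>(1) r] by (simp add: algebra_simps)
  also have "\<dots> = (LBINT x. u x * \<eta> x) * mass r - (LBINT x. u x * (trunc_avg r \<eta> x))"
    using i1 i2 by simp
  also have "(LBINT x. u x * (trunc_avg r \<eta> x)) = (LBINT x. (trunc_avg r u x) * \<eta> x)"
    using convolution_Fubini[OF u \<eta>(2) k] by (simp add: refl)
  also have "(LBINT x. u x * \<eta> x) * mass r - \<dots> = (LBINT x. u x * \<eta> x * mass r - (trunc_avg r u x) * \<eta> x)"
    using i2 i3 by simp
  also have "\<dots> = (LBINT x. trunc_op r u x * \<eta> x)"
    unfolding trunc_op_eq[OF u r] by (simp add: algebra_simps)
  finally show ?thesis .
qed

lemma test_function_support_radius:
  assumes "test_function (ball 0 1) (\<eta> :: 'a \<Rightarrow> real)"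
  obtains r where "0 < r" "r < 1" "\<And>x. r \<le> norm x \<Longrightarrow> \<eta> x = 0"
proof -
  define C where "C = closure {x. \<eta> x \<noteq> 0}"
  have C: "compact C" "C \<subseteq> ball 0 1" using assms unfolding test_function_def C_def by auto
  have z0: "\<eta> x = 0" if "x \<notin> C" for x
    using that subsetD[OF closure_subset, of x "{x. \<eta> x \<noteq> 0}"] by (auto simp: C_def)
  show ?thesis
  proof (cases "C = {}")
    case True
    then show ?thesis using that[of "1/2"] z0 by simp
  next
    case False
    have "\<exists>x\<in>C. \<forall>y\<in>C. norm y \<le> norm x"
      by (rule continuous_attains_sup[OF C(1) False]) (intro continuous_intros)
    then obtain x where x: "x \<in> C" "\<And>y. y \<in> C \<Longrightarrow> norm y \<le> norm x" by blast
    have nx: "norm x < 1" using x(1) C(2) by auto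
    then have half: "0 < (1 + norm x) / 2" "(1 + norm x) / 2 < 1" using norm_ge_zero[of x] by (simp_all add: add_pos_nonneg)
    show ?thesis
    proof (rule that[of "(1 + norm x) / 2"])
      fix y :: 'a assume "(1 + norm x) / 2 \<le> norm y"
      then have "norm x < norm y" using nx by (simp add: field_simps)
      then show "\<eta> y = 0" using x(2)[of y] z0[of y] by force
    qed (rule half)+
  qed
qed

text \<open>
  By comparison from both sides the penalized solutions converge uniformly to \<open>w\<close>. On the support of a
  test function the weight \<open>1 / (r - norm x)\<close> of the penalty is bounded, so the penalty disappears in the
  limit.
\<close>

lemma paraboloid_solution_weak:
  assumes w: "bounded_borel M w" and wc: "continuous_on (ball 0 1) w" and fc: "continuous_on (ball 0 1) f"
    and sub: "paraboloid_subsolution w f" and super: "paraboloid_subsolution (\<lambda>x. - w x) (\<lambda>x. - f x)"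
  shows "weak_solution w f"
  unfolding weak_solution_def
proof (intro allI impI)
  fix \<eta> :: "'a \<Rightarrow> real" assume t: "test_function (ball 0 1) \<eta>"
  obtain r' where r': "0 < r'" "r' < 1" "\<And>x. r' \<le> norm x \<Longrightarrow> \<eta> x = 0"
    using test_function_support_radius[OF t] by blast
  define r where "r = (1 + r') / 2"
  have r: "0 < r" "r < 1" "r' < r" unfolding r_def using r' by auto
  obtain N where N: "bounded_borel N \<eta>" using test_function_bounded_borel[OF t] .
  note [measurable] = bounded_borelD(1)[OF N] bounded_borelD(1)[OF w]
  have \<eta>i: "integrable lborel \<eta>"
  proof -
    have "integrable lborel (indicator (ball (0::'a) 1) :: 'a \<Rightarrow> real)"
      using emeasure_lborel_ball_finite[of "0::'a" 1] by (intro integrable_real_indicator) auto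
    from integrable_bounded_mult[OF N this]
    have "integrable lborel (\<lambda>x. \<eta> x * indicator (ball 0 1) x)" .
    moreover have "\<eta> x * indicator (ball 0 1) x = \<eta> x" for x
      using r'(3)[of x] r' by (cases "norm x < 1") auto
    ultimately show ?thesis by simp
  qed
  define \<rho> where "\<rho> n = 1 / real (Suc n)" for n
  have \<rho>: "0 < \<rho> n" "\<rho> n \<le> 1" "\<rho> \<longlonglongrightarrow> 0" for n
    unfolding \<rho>_def[abs_def] by (simp, simp, rule LIMSEQ_Suc[OF lim_1_over_n])
  have "\<exists>v. \<forall>n. penalized_solution (\<rho> n) r w f (v n)"
    using penalized_solution_exists[OF w wc fc r(1,2) \<rho>(1)] by metis
  then obtain v where v: "\<And>n. penalized_solution (\<rho> n) r w f (v n)" by blast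
  have conv: "\<forall>\<^sub>F n in sequentially. \<forall>x. \<bar>v n x - w x\<bar> \<le> \<tau>" if \<tau>: "0 < \<tau>" for \<tau>
  proof -
    obtain a where a: "a > 0" "\<And>\<rho> v x. 0 < \<rho> \<Longrightarrow> \<rho> < a \<Longrightarrow> penalized_solution \<rho> r w f v \<Longrightarrow> w x - v x \<le> \<tau>"
      using penalized_comparison[OF w wc fc r(1,2) sub \<tau>] by blast
    obtain b where b: "b > 0" "\<And>\<rho> v x. 0 < \<rho> \<Longrightarrow> \<rho> < b \<Longrightarrow> penalized_solution \<rho> r (\<lambda>x. - w x) (\<lambda>x. - f x) v \<Longrightarrow> - w x - v x \<le> \<tau>"
      using penalized_comparison[OF bounded_borel_uminus[OF w] continuous_on_minus[OF wc] continuous_on_minus[OF fc] r(1,2) super \<tau>] by blast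
    have "0 < min a b" using a b by simp
    from order_tendstoD(2)[OF \<rho>(3) this] show ?thesis
    proof eventually_elim
      case (elim n)
      show ?case
      proof
        fix x
        have "w x - v n x \<le> \<tau>" using a(2)[OF \<rho>(1) _ v] elim by simp
        moreover have "- w x - - v n x \<le> \<tau>" using b(2)[OF \<rho>(1) _ penalized_solution_uminus[OF v]] elim by simp
        ultimately show "\<bar>v n x - w x\<bar> \<le> \<tau>" by linarith
      qed
    qed
  qed
  obtain n0 where n0: "\<And>n x. n \<ge> n0 \<Longrightarrow> \<bar>v n x - w x\<bar> \<le> 1" using conv[of 1] unfolding eventually_sequentially by auto
  have vb: "bounded_borel (M + 1) (v (n + n0))" for n
    unfolding bounded_borel_def
  proof (intro conjI allI)
    show "v (n + n0) \<in> borel_measurable borel" using v[of "n + n0"] bounded_borelD(1) unfolding penalized_solution_def by blast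
    show "\<bar>v (n + n0) x\<bar> \<le> M + 1" for x using n0[of "n + n0" x] bounded_borelD(2)[OF w, of x] by linarith
  qed
  have vlim: "(\<lambda>n. v (n + n0) x) \<longlonglongrightarrow> w x" for x
  proof (rule LIMSEQ_ignore_initial_segment, rule tendstoI)
    fix e :: real assume "0 < e"
    then show "\<forall>\<^sub>F n in sequentially. dist (v n x) (w x) < e"
    proof -
      have "\<forall>\<^sub>F n in sequentially. \<forall>x. \<bar>v n x - w x\<bar> \<le> e / 2" using conv[of "e / 2"] \<open>0 < e\<close> by simp
      then show ?thesis
      proof eventually_elim
        case (elim n)
        have "\<bar>v n x - w x\<bar> \<le> e / 2" using elim by blast
        then show ?case using \<open>0 < e\<close> unfolding dist_real_def by linarith
      qed
    qed
  qed
  have lhs: "(\<lambda>n. LBINT x. v (n + n0) x * trunc_op (\<rho> (n + n0)) \<eta> x) \<longlonglongrightarrow> (LBINT x. w x * sym_op \<eta> x)"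
  proof (rule trunc_pairing_tendsto[OF t _ vb vlim \<rho>(1,2)])
    show "bounded_borel (M + 1) w" using w unfolding bounded_borel_def by (auto intro: order_trans)
    show "(\<lambda>n. \<rho> (n + n0)) \<longlonglongrightarrow> 0" by (rule LIMSEQ_ignore_initial_segment[OF \<rho>(3)])
  qed
  let ?rhs = "LBINT x. indicator (ball 0 1) x * (f x * \<eta> x)"
  define F where "F n x = (v n x - w x) / (r - norm x) * \<eta> x" for n x
  have fi: "integrable lborel (\<lambda>x. indicator (ball 0 1) x * (f x * \<eta> x))"
  proof -
    define h where "h x = indicator (cball 0 r) x *\<^sub>R f x" for x
    have "compact (f ` cball 0 r)" using r by (intro compact_continuous_image continuous_on_subset[OF fc]) auto
    then have "bounded (f ` cball 0 r)" by (rule compact_imp_bounded)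
    then obtain B where B: "\<forall>y\<in>f ` cball 0 r. norm y \<le> B" unfolding bounded_iff by blast
    have "bounded_borel \<bar>B\<bar> h"
      unfolding bounded_borel_def
    proof (intro conjI allI)
      show "h \<in> borel_measurable borel" unfolding h_def
        using r by (intro borel_measurable_continuous_on_indicator continuous_on_subset[OF fc]) auto
      show "\<bar>h x\<bar> \<le> \<bar>B\<bar>" for x
      proof (cases "x \<in> cball 0 r")
        case True
        then have "norm (f x) \<le> B" using B by blast
        then show ?thesis using True by (simp add: h_def)
      qed (simp add: h_def)
    qed
    from integrable_bounded_mult[OF this \<eta>i] have "integrable lborel (\<lambda>x. h x * \<eta> x)" .
    moreover have "h x * \<eta> x = indicator (ball 0 1) x * (f x * \<eta> x)" for x
      using r'(3)[of x] r by (cases "norm x < r'") (auto simp: h_def indicator_def)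
    ultimately show ?thesis by simp
  qed
  have Fle: "\<bar>F n x\<bar> \<le> \<tau> / (r - r') * \<bar>\<eta> x\<bar>" if "\<And>x. \<bar>v n x - w x\<bar> \<le> \<tau>" for n x \<tau>
  proof (cases "norm x < r'")
    case True
    have "\<bar>v n x - w x\<bar> / (r - norm x) \<le> \<tau> / (r - r')"
      using that[of x] True r by (intro frac_le) auto
    then show ?thesis using True r unfolding F_def abs_mult abs_divide by (intro mult_right_mono) auto
  next
    case False
    then show ?thesis using r'(3)[of x] by (simp add: F_def)
  qed
  have Fi: "integrable lborel (F (n + n0))" for n
  proof (rule Bochner_Integration.integrable_bound)
    show "integrable lborel (\<lambda>x. 1 / (r - r') * \<bar>\<eta> x\<bar>)" using \<eta>i by simp
    have [measurable]: "v (n + n0) \<in> borel_measurable borel" by (rule bounded_borelD(1)[OF vb])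
    show "F (n + n0) \<in> borel_measurable lborel" unfolding F_def by measurable
    show "AE x in lborel. norm (F (n + n0) x) \<le> norm (1 / (r - r') * \<bar>\<eta> x\<bar>)"
    proof (rule AE_I2)
      fix x
      have "\<bar>F (n + n0) x\<bar> \<le> 1 / (r - r') * \<bar>\<eta> x\<bar>" by (rule Fle) (rule n0, simp)
      then show "norm (F (n + n0) x) \<le> norm (1 / (r - r') * \<bar>\<eta> x\<bar>)" using r by simp
    qed
  qed
  have eq: "(LBINT x. v (n + n0) x * trunc_op (\<rho> (n + n0)) \<eta> x) = ?rhs - integral\<^sup>L lborel (F (n + n0))" for n
  proof -
    have "(LBINT x. v (n + n0) x * trunc_op (\<rho> (n + n0)) \<eta> x) = (LBINT x. trunc_op (\<rho> (n + n0)) (v (n + n0)) x * \<eta> x)"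
      by (rule trunc_pairing_symmetric[OF vb N \<eta>i \<rho>(1)])
    also have "\<dots> = (LBINT x. indicator (ball 0 1) x * (f x * \<eta> x) - F (n + n0) x)"
    proof (rule Bochner_Integration.integral_cong[OF refl])
      fix x
      show "trunc_op (\<rho> (n + n0)) (v (n + n0)) x * \<eta> x = indicator (ball 0 1) x * (f x * \<eta> x) - F (n + n0) x"
      proof (cases "norm x < r'")
        case True
        then have "trunc_op (\<rho> (n + n0)) (v (n + n0)) x = f x - (v (n + n0) x - w x) / (r - norm x)"
          using v[of "n + n0"] r unfolding penalized_solution_def by auto
        then show ?thesis using True r by (simp add: F_def left_diff_distrib)
      next
        case False
        then show ?thesis using r'(3)[of x] by (simp add: F_def)
      qed
    qed
    also have "\<dots> = ?rhs - integral\<^sup>L lborel (F (n + n0))" by (rule Bochner_Integration.integral_diff[OF fi Fi])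
    finally show ?thesis .
  qed
  have "(\<lambda>n. integral\<^sup>L lborel (F (n + n0))) \<longlonglongrightarrow> (\<integral>x. 0 \<partial>(lborel :: 'a measure))"
  proof (rule integral_dominated_convergence)
    show "integrable lborel (\<lambda>x. 1 / (r - r') * \<bar>\<eta> x\<bar>)" using \<eta>i by simp
    show "AE x in lborel. (\<lambda>n. F (n + n0) x) \<longlonglongrightarrow> 0"
    proof (rule AE_I2)
      fix x
      have "(\<lambda>n. (v (n + n0) x - w x) / (r - norm x) * \<eta> x) \<longlonglongrightarrow> (w x - w x) / (r - norm x) * \<eta> x"
        unfolding divide_inverse by (intro tendsto_intros vlim)
      then show "(\<lambda>n. F (n + n0) x) \<longlonglongrightarrow> 0" by (simp add: F_def)
    qed
    show "AE x in lborel. norm (F (n + n0) x) \<le> 1 / (r - r') * \<bar>\<eta> x\<bar>" for n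
      unfolding real_norm_def by (rule AE_I2, rule Fle) (rule n0, simp)
  qed (use Fi in \<open>auto dest: borel_measurable_integrable\<close>)
  then have "(\<lambda>n. ?rhs - integral\<^sup>L lborel (F (n + n0))) \<longlonglongrightarrow> ?rhs - 0" by (intro tendsto_diff tendsto_const) simp
  then show "(LBINT x. w x * sym_op \<eta> x) = ?rhs"
    using lhs unfolding eq by (simp add: LIMSEQ_unique)
qed

end

section \<open>Nonlocal operators on viscosity test functions\<close>

lemma ereal_integral_cong_AE:
  assumes "AE x in M. g x = h x"
  shows "ereal_integral M g = ereal_integral M h"
proof -
  have "(\<integral>\<^sup>+ x. ennreal (g x) \<partial>M) = (\<integral>\<^sup>+ x. ennreal (h x) \<partial>M)"
    "(\<integral>\<^sup>+ x. ennreal (- g x) \<partial>M) = (\<integral>\<^sup>+ x. ennreal (- h x) \<partial>M)"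
    using assms by (auto intro!: nn_integral_cong_AE)
  then show ?thesis by (simp add: ereal_integral_def)
qed

lemma ereal_integral_lebesgue: "ereal_integral lebesgue g = ereal_integral lborel g"
  by (simp add: ereal_integral_def nn_integral_completion)

definition trunc_integral :: "('a::euclidean_space \<Rightarrow> real) \<Rightarrow> ('a \<Rightarrow> real) \<Rightarrow> 'a \<Rightarrow> real \<Rightarrow> ereal" where
  "trunc_integral K v x \<epsilon> =
     ereal_integral lebesgue (\<lambda>y. indicator {y. \<epsilon> < norm y} y * ((v x - v (x + y)) * K y))"

lemma nonlocal_op_eqI:
  assumes "(trunc_integral K v x \<longlongrightarrow> l) (at_right 0)"
  shows "nonlocal_op K v x = l"
  unfolding nonlocal_op_def using tendsto_Lim[OF _ assms] unfolding trunc_integral_def[abs_def] by simp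

context levy_kernel
begin

lemma trunc_integral_cong:
  assumes K0: "AE y in lborel. K0 y = K y" and v: "AE y in lborel. v y = v' y" "v x = v' x"
  shows "trunc_integral K0 v x \<epsilon> = ereal_integral lborel (\<lambda>y. (v' x - v' (x + y)) * trunc_kernel \<epsilon> y)"
  unfolding trunc_integral_def ereal_integral_lebesgue
proof (rule ereal_integral_cong_AE)
  show "AE y in lborel. indicator {y. \<epsilon> < norm y} y * ((v x - v (x + y)) * K0 y) = (v' x - v' (x + y)) * trunc_kernel \<epsilon> y"
    using K0 AE_lborel_translate[OF v(1), of x]
    by eventually_elim (simp add: v(2) trunc_kernel_def)
qed

lemma trunc_integral_bounded:
  assumes K0: "AE y in lborel. K0 y = K y" and v: "bounded_borel M v" and e: "0 < \<epsilon>"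
  shows "trunc_integral K0 v x \<epsilon> = ereal (trunc_op \<epsilon> v x)"
proof -
  have "integrable lborel (\<lambda>y. (v x - v (x + y)) * trunc_kernel \<epsilon> y)"
    by (rule trunc_op_integrable[OF v e])
  then show ?thesis
    using trunc_integral_cong[OF K0, of v v x \<epsilon>] unfolding trunc_op_def by (simp add: ereal_integral_eq_integral)
qed

lemma nonlocal_op_test_function:
  assumes K0: "AE y in lborel. K0 y = K y" and t: "test_function \<Omega> \<eta>"
  shows "nonlocal_op K0 \<eta> x = ereal (sym_op \<eta> x)"
proof (rule nonlocal_op_eqI)
  obtain M where M: "bounded_borel M \<eta>" using test_function_bounded_borel[OF t] .
  have "((\<lambda>r. ereal (trunc_op r \<eta> x)) \<longlongrightarrow> ereal (sym_op \<eta> x)) (at_right 0)"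
    using trunc_op_test_tendsto[OF t] by (rule tendsto_ereal)
  then show "(trunc_integral K0 \<eta> x \<longlongrightarrow> ereal (sym_op \<eta> x)) (at_right 0)"
    by (rule Lim_transform_eventually)
      (use trunc_integral_bounded[OF K0 M] in \<open>auto simp: eventually_at_filter\<close>)
qed

lemma distributional_solution_iff_weak:
  assumes K0: "AE y in lborel. K0 y = K y" and u: "AE x in lborel. u x = u' x" "u \<in> borel_measurable lebesgue"
    and u': "bounded_borel M u'" and f: "continuous_on (ball 0 1) f"
  shows "distributional_solution K0 u f \<longleftrightarrow> weak_solution u' f"
proof -
  have "(LINT x|lebesgue. u x * real_of_ereal (nonlocal_op K0 \<eta> x)) = (LBINT x. u' x * sym_op \<eta> x) \<and>
    (LINT x:ball 0 1|lebesgue. f x * \<eta> x) = (LBINT x. indicator (ball 0 1) x * (f x * \<eta> x))"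
    if t: "test_function (ball 0 1) \<eta>" for \<eta>
  proof
    obtain N where N: "bounded_borel N \<eta>" using test_function_bounded_borel[OF t] .
    note [measurable] = bounded_borelD(1)[OF N] bounded_borelD(1)[OF u']
    have m: "sym_op \<eta> \<in> borel_measurable borel" unfolding sym_op_def[abs_def] by measurable
    then have m': "(\<lambda>x. u' x * sym_op \<eta> x) \<in> borel_measurable lborel" by measurable
    have "(LINT x|lebesgue. u x * real_of_ereal (nonlocal_op K0 \<eta> x)) = (\<integral>x. u x * sym_op \<eta> x \<partial>lebesgue)"
      by (simp add: nonlocal_op_test_function[OF K0 t])
    also have "\<dots> = (\<integral>x. u' x * sym_op \<eta> x \<partial>lebesgue)"
    proof (rule integral_cong_AE)
      show "(\<lambda>x. u x * sym_op \<eta> x) \<in> borel_measurable lebesgue"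
        using u(2) m by (intro borel_measurable_times) (auto intro: measurable_completion)
      show "(\<lambda>x. u' x * sym_op \<eta> x) \<in> borel_measurable lebesgue" by (rule measurable_completion[OF m'])
      show "AE x in lebesgue. u x * sym_op \<eta> x = u' x * sym_op \<eta> x"
        unfolding AE_completion_iff using u(1) by eventually_elim simp
    qed
    also have "\<dots> = (LBINT x. u' x * sym_op \<eta> x)" by (rule integral_completion[OF m'])
    finally show "(LINT x|lebesgue. u x * real_of_ereal (nonlocal_op K0 \<eta> x)) = (LBINT x. u' x * sym_op \<eta> x)" .
    have "(\<lambda>x. indicator (ball 0 1) x *\<^sub>R (f x * \<eta> x)) \<in> borel_measurable borel"
      by (intro borel_measurable_continuous_on_indicator continuous_on_mult f
          continuous_on_subset[OF test_function_basics(1)[OF t]]) auto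
    then have "(\<integral>x. indicator (ball 0 1) x *\<^sub>R (f x * \<eta> x) \<partial>lebesgue) = (LBINT x. indicator (ball 0 1) x *\<^sub>R (f x * \<eta> x))"
      by (intro integral_completion) simp
    then show "(LINT x:ball 0 1|lebesgue. f x * \<eta> x) = (LBINT x. indicator (ball 0 1) x * (f x * \<eta> x))"
      unfolding set_lebesgue_integral_def by simp
  qed
  then show ?thesis unfolding distributional_solution_def weak_solution_def by auto
qed

text \<open>
  A test function touching from above may fail to be integrable away from the point; then every
  truncated integral is \<open>-\<infinity>\<close>. Otherwise the contribution of the long jumps is a fixed real
  number and that of the short jumps converges by the bound on second differences. The integrals of
  \<open>- v\<close> are included because negation commutes with extended-valued integrals only when one part is
  finite, which is known here.
\<close>

lemma nonlocal_op_touching: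
  assumes K0: "AE y in lborel. K0 y = K y" and w: "bounded_borel M w"
    and N: "open N" "x0 \<in> N" and C2: "Ck_on 2 N v" and out: "\<And>x. x \<notin> N \<Longrightarrow> v x = w x"
    and eq: "v x0 = w x0" and ge: "\<And>x. w x \<le> v x"
    and d0: "0 < d0" and le: "\<And>d. 0 < d \<Longrightarrow> d \<le> d0 \<Longrightarrow> trunc_op d w x0 \<le> fx + B * moment d"
  shows "\<exists>l. (trunc_integral K0 v x0 \<longlongrightarrow> l) (at_right 0) \<and>
     (trunc_integral K0 (\<lambda>x. - v x) x0 \<longlongrightarrow> - l) (at_right 0) \<and> l \<le> ereal fx"
proof -
  obtain r' A where r': "r' > 0" "A \<ge> 0" "cball x0 r' \<subseteq> N"
    and sd': "\<And>x z. x + z \<in> cball x0 r' \<Longrightarrow> x - z \<in> cball x0 r' \<Longrightarrow> \<bar>v (x + z) + v (x - z) - 2 * v x\<bar> \<le> A * (norm z)\<^sup>2"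
    using C2_second_difference_local[OF N C2] by blast
  define r where "r = min r' (min d0 1)"
  have r: "0 < r" "r \<le> r'" "r \<le> d0" "r \<le> 1" unfolding r_def using r' d0 by auto
  have rN: "cball x0 r \<subseteq> N" using r'(3) r(2) by (meson order_trans subset_cball)
  have vc: "continuous_on N v" using C2 unfolding Ck_on_2_iff
    by (intro continuous_at_imp_continuous_on) (auto intro: differentiable_imp_continuous_within)
  have [measurable]: "w \<in> borel_measurable borel" by (rule bounded_borelD(1)[OF w])
  have vm [measurable]: "v \<in> borel_measurable borel"
  proof -
    have "(\<lambda>x. if x \<in> N then indicator N x *\<^sub>R v x else w x) \<in> borel_measurable borel"
      using N(1) by (intro measurable_If_set borel_measurable_continuous_on_indicator vc) auto
    moreover have "(\<lambda>x. if x \<in> N then indicator N x *\<^sub>R v x else w x) = v" using out by (auto simp: fun_eq_iff)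
    ultimately show ?thesis by simp
  qed
  define g where "g \<epsilon> y = (v x0 - v (x0 + y)) * trunc_kernel \<epsilon> y" for \<epsilon> y
  have gm [measurable]: "g \<epsilon> \<in> borel_measurable borel" for \<epsilon> unfolding g_def by measurable
  have I: "trunc_integral K0 v x0 \<epsilon> = ereal_integral lborel (g \<epsilon>)" for \<epsilon>
    using trunc_integral_cong[OF K0, of v v x0 \<epsilon>] by (simp add: g_def[abs_def])
  have I': "trunc_integral K0 (\<lambda>x. - v x) x0 \<epsilon> = ereal_integral lborel (\<lambda>y. - g \<epsilon> y)" for \<epsilon>
    using trunc_integral_cong[OF K0, of "\<lambda>x. - v x" "\<lambda>x. - v x" x0 \<epsilon>] by (simp add: g_def[abs_def] algebra_simps)
  have wi: "integrable lborel (\<lambda>y. (w x0 - w (x0 + y)) * trunc_kernel \<epsilon> y)" if "0 < \<epsilon>" for \<epsilon>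
    by (rule trunc_op_integrable[OF w that])
  have gw: "g \<epsilon> y \<le> (w x0 - w (x0 + y)) * trunc_kernel \<epsilon> y" for \<epsilon> y
    unfolding g_def using ge[of "x0 + y"] eq by (intro mult_right_mono trunc_kernel_nonneg) simp
  have Pfin: "(\<integral>\<^sup>+ y. ennreal (g \<epsilon> y) \<partial>lborel) < \<infinity>" if "0 < \<epsilon>" for \<epsilon>
  proof -
    have "(\<integral>\<^sup>+ y. ennreal (g \<epsilon> y) \<partial>lborel) \<le> (\<integral>\<^sup>+ y. ennreal (norm ((w x0 - w (x0 + y)) * trunc_kernel \<epsilon> y)) \<partial>lborel)"
      using order_trans[OF gw abs_ge_self] by (intro nn_integral_mono ennreal_leI) simp
    also have "\<dots> < \<infinity>" using wi[OF that] unfolding integrable_iff_bounded by blast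
    finally show ?thesis .
  qed
  have neg: "trunc_integral K0 (\<lambda>x. - v x) x0 \<epsilon> = - trunc_integral K0 v x0 \<epsilon>" if "0 < \<epsilon>" for \<epsilon>
  proof -
    have "enn2ereal (\<integral>\<^sup>+ y. ennreal (g \<epsilon> y) \<partial>lborel) \<noteq> \<infinity>"
      using Pfin[OF that] by (simp add: enn2ereal_eq_top_iff less_top)
    moreover have "enn2ereal (\<integral>\<^sup>+ y. ennreal (g \<epsilon> y) \<partial>lborel) \<noteq> - \<infinity>" by simp
    ultimately show ?thesis unfolding I I' ereal_integral_def by (simp add: ereal_minus_diff_eq)
  qed
  have "\<exists>l. (trunc_integral K0 v x0 \<longlongrightarrow> l) (at_right 0) \<and> l \<le> ereal fx"
  proof (cases "integrable lborel (g r)")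
    case True
    \<comment> \<open>Freezing \<open>v\<close> outside the ball isolates the short jumps in a bounded function.\<close>
    define b where "b y = (if y \<in> cball x0 r then v y else v x0)" for y
    have b: "\<exists>M'. bounded_borel M' b"
    proof -
      have "compact (v ` cball x0 r)" by (intro compact_continuous_image continuous_on_subset[OF vc rN]) auto
      then have "bounded (v ` cball x0 r)" by (rule compact_imp_bounded)
      then obtain B where B: "\<forall>y\<in>v ` cball x0 r. norm y \<le> B" unfolding bounded_iff by blast
      have "\<bar>b y\<bar> \<le> max B \<bar>v x0\<bar>" for y
      proof (cases "y \<in> cball x0 r")
        case True
        then have "norm (v y) \<le> B" using B by blast
        then show ?thesis using True by (simp add: b_def)
      qed (simp add: b_def)
      moreover have "b \<in> borel_measurable borel" unfolding b_def[abs_def] by (intro measurable_If_set) auto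
      ultimately show ?thesis unfolding bounded_borel_def by blast
    qed
    then obtain M' where b: "bounded_borel M' b" by blast
    have b0: "b x0 = v x0" using r by (simp add: b_def)
    have sdb: "\<bar>b (x0 + z) + b (x0 - z) - 2 * b x0\<bar> \<le> 2 * (A / 2) * (norm z)\<^sup>2" for z
    proof (cases "norm z \<le> r")
      case True
      then have "\<bar>v (x0 + z) + v (x0 - z) - 2 * v x0\<bar> \<le> A * (norm z)\<^sup>2" using r(2) by (intro sd') (auto simp: dist_norm)
      then show ?thesis using True by (simp add: b_def b0 dist_norm)
    next
      case False
      then show ?thesis using r'(2) by (simp add: b_def b0 dist_norm)
    qed
    have lim: "((\<lambda>\<epsilon>. trunc_op \<epsilon> b x0) \<longlongrightarrow> sym_op b x0) (at_right 0)"
    proof -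
      have "\<forall>\<^sub>F \<epsilon> in at_right 0. \<epsilon> \<in> {0<..<1::real}" by (rule eventually_at_right_real) simp
      then have "\<forall>\<^sub>F \<epsilon> in at_right 0. norm (trunc_op \<epsilon> b x0 - sym_op b x0) \<le> (A / 2) * moment \<epsilon>"
      proof eventually_elim
        case (elim \<epsilon>)
        then show ?case using trunc_op_approximates[OF b _ _ sdb, of \<epsilon>] by simp
      qed
      moreover have "((\<lambda>\<epsilon>. (A / 2) * moment \<epsilon>) \<longlongrightarrow> 0) (at_right 0)" by (intro tendsto_mult_right_zero moment_tendsto_0)
      ultimately have "((\<lambda>\<epsilon>. trunc_op \<epsilon> b x0 - sym_op b x0) \<longlongrightarrow> 0) (at_right 0)" by (rule Lim_null_comparison)
      then show ?thesis by (simp add: LIM_zero_iff)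
    qed
    define J where "J \<epsilon> = integral\<^sup>L lborel (g r) + trunc_op \<epsilon> b x0" for \<epsilon>
    have ev: "\<forall>\<^sub>F \<epsilon> in at_right 0. trunc_integral K0 v x0 \<epsilon> = ereal (J \<epsilon>) \<and> J \<epsilon> \<le> fx + B * moment \<epsilon>"
    proof -
      have "\<forall>\<^sub>F \<epsilon> in at_right 0. \<epsilon> \<in> {0<..<r}" by (rule eventually_at_right_real) (rule r)
      then show ?thesis
      proof eventually_elim
        case (elim \<epsilon>)
        then have \<epsilon>: "0 < \<epsilon>" "\<epsilon> < r" by auto
        have split: "g \<epsilon> y = g r y + (b x0 - b (x0 + y)) * trunc_kernel \<epsilon> y" for y
        proof (cases "norm y \<le> r")
          case True
          then show ?thesis by (simp add: g_def b_def b0 trunc_kernel_def dist_norm)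
        next
          case False
          then show ?thesis using \<epsilon> r by (simp add: g_def b_def b0 trunc_kernel_def dist_norm)
        qed
        have bi: "integrable lborel (\<lambda>y. (b x0 - b (x0 + y)) * trunc_kernel \<epsilon> y)"
          by (rule trunc_op_integrable[OF b \<epsilon>(1)])
        have gi: "integrable lborel (g \<epsilon>)"
          using Bochner_Integration.integrable_add[OF True bi] by (simp add: split[abs_def])
        have "integral\<^sup>L lborel (g \<epsilon>) = J \<epsilon>"
          unfolding J_def trunc_op_def using Bochner_Integration.integral_add[OF True bi] by (simp add: split[abs_def])
        moreover have "integral\<^sup>L lborel (g \<epsilon>) \<le> trunc_op \<epsilon> w x0"
          unfolding trunc_op_def by (rule integral_mono[OF gi wi[OF \<epsilon>(1)] gw])
        moreover have "trunc_op \<epsilon> w x0 \<le> fx + B * moment \<epsilon>" using \<epsilon> r by (intro le) auto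
        ultimately show ?case using gi by (simp add: I ereal_integral_eq_integral)
      qed
    qed
    define l where "l = integral\<^sup>L lborel (g r) + sym_op b x0"
    have Jl: "(J \<longlongrightarrow> l) (at_right 0)" unfolding J_def[abs_def] l_def by (intro tendsto_add tendsto_const lim)
    have "l \<le> fx + B * 0"
    proof (rule tendsto_le[OF _ _ Jl])
      show "((\<lambda>\<epsilon>. fx + B * moment \<epsilon>) \<longlongrightarrow> fx + B * 0) (at_right 0)" by (intro tendsto_intros moment_tendsto_0)
      show "\<forall>\<^sub>F \<epsilon> in at_right 0. J \<epsilon> \<le> fx + B * moment \<epsilon>" using ev by eventually_elim simp
    qed simp
    moreover have "(trunc_integral K0 v x0 \<longlongrightarrow> ereal l) (at_right 0)"
    proof (rule Lim_transform_eventually[OF tendsto_ereal[OF Jl]])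
      show "\<forall>\<^sub>F \<epsilon> in at_right 0. ereal (J \<epsilon>) = trunc_integral K0 v x0 \<epsilon>" using ev by eventually_elim simp
    qed
    ultimately show ?thesis by (intro exI[of _ "ereal l"]) simp
  next
    case False
    have inf: "(\<integral>\<^sup>+ y. ennreal (- g r y) \<partial>lborel) = \<infinity>"
    proof (rule ccontr)
      assume "(\<integral>\<^sup>+ y. ennreal (- g r y) \<partial>lborel) \<noteq> \<infinity>"
      then have "integrable lborel (g r)" using Pfin[OF r(1)] by (simp add: real_integrable_def)
      then show False using False by simp
    qed
    have ev: "\<forall>\<^sub>F \<epsilon> in at_right 0. - \<infinity> = trunc_integral K0 v x0 \<epsilon>"
    proof -
      have "\<forall>\<^sub>F \<epsilon> in at_right 0. \<epsilon> \<in> {0<..<r}" by (rule eventually_at_right_real) (rule r)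
      then show ?thesis
      proof eventually_elim
        case (elim \<epsilon>)
        then have \<epsilon>: "0 < \<epsilon>" "\<epsilon> < r" by auto
        have "ennreal (- g r y) \<le> ennreal (- g \<epsilon> y)" for y
        proof (cases "r < norm y")
          case True
          then have "g r y = g \<epsilon> y" using \<epsilon> by (simp add: g_def trunc_kernel_def)
          then show ?thesis by simp
        next
          case False
          then show ?thesis by (simp add: g_def trunc_kernel_def)
        qed
        then have "\<infinity> \<le> (\<integral>\<^sup>+ y. ennreal (- g \<epsilon> y) \<partial>lborel)"
          unfolding inf[symmetric] by (intro nn_integral_mono) simp
        then have N': "(\<integral>\<^sup>+ y. ennreal (- g \<epsilon> y) \<partial>lborel) = top" by (simp add: top_unique)
        have "enn2ereal (\<integral>\<^sup>+ y. ennreal (g \<epsilon> y) \<partial>lborel) \<noteq> \<infinity>"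
          using Pfin[OF \<epsilon>(1)] by (simp add: enn2ereal_eq_top_iff less_top)
        then show ?case unfolding I ereal_integral_def N'
          by (cases "enn2ereal (\<integral>\<^sup>+ y. ennreal (g \<epsilon> y) \<partial>lborel)") auto
      qed
    qed
    have "(trunc_integral K0 v x0 \<longlongrightarrow> - \<infinity>) (at_right 0)"
      by (rule Lim_transform_eventually[OF tendsto_const ev])
    then show ?thesis by (intro exI[of _ "- \<infinity>"]) simp
  qed
  then obtain l where l: "(trunc_integral K0 v x0 \<longlongrightarrow> l) (at_right 0)" "l \<le> ereal fx" by blast
  have "(trunc_integral K0 (\<lambda>x. - v x) x0 \<longlongrightarrow> - l) (at_right 0)"
  proof (rule Lim_transform_eventually[OF tendsto_uminus_ereal[OF l(1)]])
    show "\<forall>\<^sub>F \<epsilon> in at_right 0. - trunc_integral K0 v x0 \<epsilon> = trunc_integral K0 (\<lambda>x. - v x) x0 \<epsilon>"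
      using neg by (auto simp: eventually_at_filter)
  qed
  with l show ?thesis by blast
qed

lemma nonlocal_op_paraboloid:
  assumes K0: "AE y in lborel. K0 y = K y" and w': "bounded_borel M w'" and ae: "AE y in lborel. w y = w' y"
    and wx: "w x = w' x" and \<delta>: "0 < \<delta>" "\<delta> \<le> 1"
  shows "nonlocal_op K0 (\<lambda>y. if y \<in> ball x \<delta> then w x + q \<bullet> (y - x) + a * (norm (y - x))\<^sup>2 else w y) x
     = ereal (trunc_op \<delta> w' x - a * moment \<delta>)" (is "nonlocal_op K0 ?V x = _")
proof (rule nonlocal_op_eqI)
  \<comment> \<open>Only the even part of the paraboloid survives the symmetrization at the origin.\<close>
  define b :: "'a \<Rightarrow> real" where "b z = (if z \<in> cball 0 \<delta> then q \<bullet> z + a * (norm z)\<^sup>2 else 0)" for z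
  have b: "bounded_borel (norm q + \<bar>a\<bar>) b"
    unfolding bounded_borel_def
  proof (intro conjI allI)
    show "b \<in> borel_measurable borel" unfolding b_def[abs_def] by (intro measurable_If_set) auto
    fix z show "\<bar>b z\<bar> \<le> norm q + \<bar>a\<bar>"
    proof (cases "z \<in> cball 0 \<delta>")
      case True
      then have z: "norm z \<le> 1" using \<delta> by simp
      have "\<bar>q \<bullet> z\<bar> \<le> norm q * norm z" by (rule Cauchy_Schwarz_ineq2)
      also have "\<dots> \<le> norm q * 1" using z by (intro mult_left_mono) auto
      finally have 1: "\<bar>q \<bullet> z\<bar> \<le> norm q" by simp
      have "\<bar>a * (norm z)\<^sup>2\<bar> \<le> \<bar>a\<bar> * 1" unfolding abs_mult using z by (intro mult_left_mono) (auto simp: power_le_one)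
      then show ?thesis using True 1 unfolding b_def by auto
    qed (simp add: b_def)
  qed
  have bt: "trunc_op \<epsilon> b 0 = - a * (moment \<delta> - moment \<epsilon>)" if \<epsilon>: "0 < \<epsilon>" "\<epsilon> < \<delta>" for \<epsilon>
  proof -
    have "(2 * b 0 - b (0 + z) - b (0 - z)) * trunc_kernel \<epsilon> z =
       (- 2 * a) * (indicator (cball 0 \<delta>) z * (norm z)\<^sup>2 * K z - indicator (cball 0 \<epsilon>) z * (norm z)\<^sup>2 * K z)" for z
      using \<epsilon> by (auto simp: b_def trunc_kernel_def indicator_def)
    then have "trunc_op \<epsilon> b 0 = (LBINT z. (- 2 * a) * (indicator (cball 0 \<delta>) z * (norm z)\<^sup>2 * K z - indicator (cball 0 \<epsilon>) z * (norm z)\<^sup>2 * K z)) / 2"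
      unfolding trunc_op_symmetrized[OF b \<epsilon>(1)] by (simp only:)
    also have "\<dots> = - a * (LBINT z. indicator (cball 0 \<delta>) z * (norm z)\<^sup>2 * K z - indicator (cball 0 \<epsilon>) z * (norm z)\<^sup>2 * K z)"
      by (subst integral_mult_right_zero) simp
    also have "\<dots> = - a * (moment \<delta> - moment \<epsilon>)"
      unfolding moment_def using \<epsilon> \<delta>
      by (subst Bochner_Integration.integral_diff) (auto intro: moment_integrable)
    finally show ?thesis .
  qed
  define L where "L \<epsilon> = trunc_op \<delta> w' x - a * (moment \<delta> - moment \<epsilon>)" for \<epsilon>
  have ev: "\<forall>\<^sub>F \<epsilon> in at_right 0. ereal (L \<epsilon>) = trunc_integral K0 ?V x \<epsilon>"
  proof -
    have "\<forall>\<^sub>F \<epsilon> in at_right 0. \<epsilon> \<in> {0<..<\<delta>}" by (rule eventually_at_right_real) (rule \<delta>)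
    then show ?thesis
    proof eventually_elim
      case (elim \<epsilon>)
      then have \<epsilon>: "0 < \<epsilon>" "\<epsilon> < \<delta>" by auto
      have i1: "integrable lborel (\<lambda>y. (w' x - w' (x + y)) * trunc_kernel \<delta> y)"
        by (rule trunc_op_integrable[OF w' \<delta>(1)])
      have i2: "integrable lborel (\<lambda>y. (b 0 - b (0 + y)) * trunc_kernel \<epsilon> y)"
        using integrable_bounded_mult[OF b trunc_kernel_integrable[OF \<epsilon>(1)]] trunc_kernel_integrable[OF \<epsilon>(1)]
        by (simp add: left_diff_distrib)
      have "sphere (0::'a) \<delta> \<in> null_sets lborel"
        using negligible_sphere[of "0::'a" \<delta>] unfolding negligible_iff_null_sets
        by (simp add: null_sets_completion_iff)
      then have sph: "AE y in lborel. y \<notin> sphere (0::'a) \<delta>" by (rule AE_not_in)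
      have "trunc_integral K0 ?V x \<epsilon> = ereal_integral lborel
         (\<lambda>y. (w' x - w' (x + y)) * trunc_kernel \<delta> y + (b 0 - b (0 + y)) * trunc_kernel \<epsilon> y)"
        unfolding trunc_integral_def ereal_integral_lebesgue
      proof (rule ereal_integral_cong_AE)
        show "AE y in lborel. indicator {y. \<epsilon> < norm y} y * ((?V x - ?V (x + y)) * K0 y) =
          (w' x - w' (x + y)) * trunc_kernel \<delta> y + (b 0 - b (0 + y)) * trunc_kernel \<epsilon> y"
          using K0 AE_lborel_translate[OF ae, of x] sph
        proof eventually_elim
          case (elim y)
          have ne: "norm y \<noteq> \<delta>" using elim(3) by simp
          show ?case
          proof (cases "norm y < \<delta>")
            case True
            then show ?thesis using elim \<delta> by (simp add: b_def trunc_kernel_def dist_norm algebra_simps)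
          next
            case False
            then have "\<delta> < norm y" using ne by simp
            then show ?thesis using elim \<delta> \<epsilon> wx by (simp add: b_def trunc_kernel_def dist_norm)
          qed
        qed
      qed
      also have "\<dots> = ereal (L \<epsilon>)"
        using i1 i2 bt[OF \<epsilon>] unfolding L_def
        by (subst ereal_integral_eq_integral) (simp_all add: trunc_op_def)
      finally show ?case by simp
    qed
  qed
  have "(L \<longlongrightarrow> trunc_op \<delta> w' x - a * (moment \<delta> - 0)) (at_right 0)"
    unfolding L_def[abs_def] by (intro tendsto_intros moment_tendsto_0)
  then have "((\<lambda>\<epsilon>. ereal (L \<epsilon>)) \<longlongrightarrow> ereal (trunc_op \<delta> w' x - a * moment \<delta>)) (at_right 0)"
    by (intro tendsto_ereal) simp
  then show "(trunc_integral K0 ?V x \<longlongrightarrow> ereal (trunc_op \<delta> w' x - a * moment \<delta>)) (at_right 0)"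
    by (rule Lim_transform_eventually) (rule ev)
qed

lemma weak_solution_is_viscosity:
  assumes K0: "AE y in lborel. K0 y = K y" and u: "AE x in lborel. u x = u' x" and u': "bounded_borel M u'"
    and f: "continuous_on (ball 0 1) f" and ws: "weak_solution u' f"
  shows "viscosity_solution K0 u f"
proof -
  obtain w U where ap: "approximates M f w U" and ae: "AE x in lborel. w x = u' x" and wc: "continuous_on (ball 0 1) w"
    using weak_solution_approximation[OF u' f ws] by blast
  have w: "bounded_borel M w" using ap unfolding approximates_def by blast
  \<comment> \<open>Applied to \<open>w\<close> and to \<open>- w\<close>, this gives both halves of the definition.\<close>
  have touch: "\<exists>l. (trunc_integral K0 v x0 \<longlongrightarrow> l) (at_right 0) \<and> (trunc_integral K0 (\<lambda>x. - v x) x0 \<longlongrightarrow> - l) (at_right 0) \<and> l \<le> ereal (g x0)"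
    if ap: "approximates M g w U" and wc: "continuous_on (ball 0 1) w"
      and N: "open N" "x0 \<in> N" "N \<subseteq> ball 0 1" "Ck_on 2 N v" and out: "\<And>x. x \<notin> N \<Longrightarrow> v x = w x"
      and eq: "v x0 = w x0" and ge: "\<And>x. w x \<le> v x" for g w U x0 N v
  proof -
    have w: "bounded_borel M w" using ap unfolding approximates_def by blast
    obtain r A where r: "r > 0" "A \<ge> 0" "cball x0 r \<subseteq> N"
      and sd: "\<And>x z. x + z \<in> cball x0 r \<Longrightarrow> x - z \<in> cball x0 r \<Longrightarrow> \<bar>v (x + z) + v (x - z) - 2 * v x\<bar> \<le> A * (norm z)\<^sup>2"
      using C2_second_difference_local[OF N(1,2,4)] by blast
    have vc: "continuous_on (cball x0 r) v"
    proof -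
      have "continuous_on N v" using N(4) unfolding Ck_on_2_iff
        by (intro continuous_at_imp_continuous_on) (auto intro: differentiable_imp_continuous_within)
      then show ?thesis using r(3) by (rule continuous_on_subset)
    qed
    show ?thesis
    proof (rule nonlocal_op_touching[OF K0 w N(1,2,4) out eq ge, where ?d0.0="r / 2" and B="A / 2 + 1"])
      fix d :: real assume d: "0 < d" "d \<le> r / 2"
      show "trunc_op d w x0 \<le> g x0 + (A / 2 + 1) * moment d"
      proof (rule touching_inequality[OF ap wc r(1) _ vc ge eq _ _ d])
        show "cball x0 r \<subseteq> ball 0 1" using r(3) N(3) by blast
        show "v (x + z) + v (x - z) - 2 * v x \<le> 2 * (A / 2) * (norm z)\<^sup>2"
          if "x + z \<in> cball x0 r" "x - z \<in> cball x0 r" for x z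
          using sd[OF that] by (simp add: abs_le_iff)
      qed (use r(2) in simp)
    qed (assumption, rule half_gt_zero[OF r(1)])
  qed
  have ae': "AE x in lebesgue. w x = u x" unfolding AE_completion_iff using ae u by eventually_elim simp
  have visc: "(\<forall>x. w x \<le> v x) \<longrightarrow> nonlocal_op K0 v x0 \<le> ereal (f x0)"
    "(\<forall>x. v x \<le> w x) \<longrightarrow> ereal (f x0) \<le> nonlocal_op K0 v x0"
    if N: "open N" "x0 \<in> N" "N \<subseteq> ball 0 1" "Ck_on 2 N v" and out: "\<And>x. x \<notin> N \<Longrightarrow> v x = w x" and eq: "v x0 = w x0" for x0 N v
  proof -
    show "(\<forall>x. w x \<le> v x) \<longrightarrow> nonlocal_op K0 v x0 \<le> ereal (f x0)"
    proof
      assume "\<forall>x. w x \<le> v x"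
      then have ge: "w x \<le> v x" for x by simp
      obtain l where "(trunc_integral K0 v x0 \<longlongrightarrow> l) (at_right 0)" "l \<le> ereal (f x0)"
        using touch[OF ap wc N out eq ge] by auto
      then show "nonlocal_op K0 v x0 \<le> ereal (f x0)" by (simp add: nonlocal_op_eqI)
    qed
    show "(\<forall>x. v x \<le> w x) \<longrightarrow> ereal (f x0) \<le> nonlocal_op K0 v x0"
    proof
      assume "\<forall>x. v x \<le> w x"
      then have le: "- w x \<le> - v x" for x by simp
      have out': "- v x = - w x" if "x \<notin> N" for x using out[OF that] by simp
      have eq': "- v x0 = - w x0" using eq by simp
      obtain l where l: "(trunc_integral K0 (\<lambda>x. - (- v x)) x0 \<longlongrightarrow> - l) (at_right 0)" "l \<le> ereal (- f x0)"
        using touch[OF approximates_uminus[OF ap] continuous_on_minus[OF wc] N(1-3) Ck_on_uminus[OF N(1,4)] out' eq' le] by auto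
      have "nonlocal_op K0 v x0 = - l" using l(1) by (simp add: nonlocal_op_eqI)
      moreover have "ereal (f x0) \<le> - l" using l(2) ereal_minus_le_minus[of "ereal (- f x0)" l] by simp
      ultimately show "ereal (f x0) \<le> nonlocal_op K0 v x0" by simp
    qed
  qed
  show ?thesis
    unfolding viscosity_solution_def
  proof (rule exI[of _ w], rule conjI[OF ae' conjI[OF wc]], intro ballI allI impI)
    fix x0 N v
    assume "open N \<and> x0 \<in> N \<and> N \<subseteq> ball 0 1 \<and> Ck_on 2 N v \<and> (\<forall>x. x \<notin> N \<longrightarrow> v x = w x) \<and> v x0 = w x0"
    then have N: "open N" "x0 \<in> N" "N \<subseteq> ball 0 1" "Ck_on 2 N v" "\<And>x. x \<notin> N \<Longrightarrow> v x = w x" "v x0 = w x0" by auto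
    show "((\<forall>x. w x \<le> v x) \<longrightarrow> nonlocal_op K0 v x0 \<le> ereal (f x0)) \<and>
        ((\<forall>x. v x \<le> w x) \<longrightarrow> ereal (f x0) \<le> nonlocal_op K0 v x0)"
      by (rule conjI[OF visc(1)[OF N] visc(2)[OF N]])
  qed
qed

lemma viscosity_solution_is_weak:
  assumes K0: "AE y in lborel. K0 y = K y" and u: "AE x in lborel. u x = u' x" and u': "bounded_borel M u'"
    and f: "continuous_on (ball 0 1) f" and vs: "viscosity_solution K0 u f"
  shows "weak_solution u' f"
proof -
  obtain w where ae: "AE x in lebesgue. w x = u x" and wc: "continuous_on (ball 0 1) w"
    and W: "\<forall>x0\<in>ball 0 1. \<forall>N v. open N \<and> x0 \<in> N \<and> N \<subseteq> ball 0 1 \<and> Ck_on 2 N v \<and>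
       (\<forall>x. x \<notin> N \<longrightarrow> v x = w x) \<and> v x0 = w x0 \<longrightarrow>
       ((\<forall>x. w x \<le> v x) \<longrightarrow> nonlocal_op K0 v x0 \<le> ereal (f x0)) \<and> ((\<forall>x. v x \<le> w x) \<longrightarrow> ereal (f x0) \<le> nonlocal_op K0 v x0)"
    using vs unfolding viscosity_solution_def by (elim exE conjE) (rule that)
  have visc: "((\<forall>x. w x \<le> v x) \<longrightarrow> nonlocal_op K0 v x0 \<le> ereal (f x0)) \<and> ((\<forall>x. v x \<le> w x) \<longrightarrow> ereal (f x0) \<le> nonlocal_op K0 v x0)"
    if x0: "x0 \<in> ball 0 1" and "open N" "x0 \<in> N" "N \<subseteq> ball 0 1" "Ck_on 2 N v" "\<And>x. x \<notin> N \<Longrightarrow> v x = w x" "v x0 = w x0"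
    for x0 N v
    by (rule W[THEN bspec, OF x0, THEN spec, THEN spec, THEN mp, of N v]) (use that in simp)
  have ae': "AE x in lborel. w x = u' x" using ae u unfolding AE_completion_iff by eventually_elim simp
  \<comment> \<open>Outside the ball \<open>w\<close> may be unbounded on a null set; \<open>w'\<close> is bounded everywhere and Borel.\<close>
  define w' where "w' x = (if x \<in> ball 0 1 then w x else u' x)" for x
  have wle: "\<bar>w x\<bar> \<le> M" if x: "x \<in> ball 0 1" for x
  proof (rule ccontr)
    assume nle: "\<not> \<bar>w x\<bar> \<le> M"
    define S where "S = {y \<in> ball 0 1. \<bar>w y\<bar> \<in> {M<..}}"
    have "open S" unfolding S_def
      using continuous_open_preimage[OF continuous_on_rabs[OF wc] open_ball open_greaterThan, of M]
      by (simp add: vimage_def Int_def conj_commute)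
    moreover have "negligible S"
    proof -
      have "AE y in lborel. y \<notin> S"
        using ae' by eventually_elim (use bounded_borelD(2)[OF u'] in \<open>auto simp: S_def not_less\<close>)
      then have "AE y in lebesgue. y \<notin> S" unfolding AE_completion_iff .
      moreover have "S \<in> sets lebesgue" using \<open>open S\<close> by simp
      ultimately show ?thesis unfolding negligible_iff_null_sets by (simp add: AE_iff_null_sets)
    qed
    ultimately have "S = {}" using open_not_negligible by blast
    then show False using x nle by (auto simp: S_def)
  qed
  have w': "bounded_borel M w'"
    unfolding bounded_borel_def
  proof (intro conjI allI)
    have "(\<lambda>x. if x \<in> ball 0 1 then indicator (ball 0 1) x *\<^sub>R w x else u' x) \<in> borel_measurable borel"
      by (intro measurable_If_set borel_measurable_continuous_on_indicator wc bounded_borelD(1)[OF u']) auto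
    moreover have "(\<lambda>x. if x \<in> ball 0 1 then indicator (ball 0 1) x *\<^sub>R w x else u' x) = w'" by (auto simp: w'_def fun_eq_iff)
    ultimately show "w' \<in> borel_measurable borel" by simp
    show "\<bar>w' x\<bar> \<le> M" for x using wle[of x] bounded_borelD(2)[OF u', of x] by (simp add: w'_def)
  qed
  have w'u: "AE x in lborel. w' x = u' x" using ae' by eventually_elim (simp add: w'_def)
  have ww': "AE x in lborel. w x = w' x" using ae' by eventually_elim (simp add: w'_def)
  have w'c: "continuous_on (ball 0 1) w'" using wc by (rule continuous_on_eq) (simp add: w'_def)
  let ?V = "\<lambda>x \<delta> q a y. if y \<in> ball x \<delta> then w x + q \<bullet> (y - x) + a * (norm (y - x))\<^sup>2 else w y"
  have V: "nonlocal_op K0 (?V x \<delta> q a) x = ereal (trunc_op \<delta> w' x - a * moment \<delta>) \<and>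
     ((\<forall>y. w y \<le> ?V x \<delta> q a y) \<longrightarrow> nonlocal_op K0 (?V x \<delta> q a) x \<le> ereal (f x)) \<and>
     ((\<forall>y. ?V x \<delta> q a y \<le> w y) \<longrightarrow> ereal (f x) \<le> nonlocal_op K0 (?V x \<delta> q a) x)"
    if x: "x \<in> ball 0 1" and \<delta>: "0 < \<delta>" "ball x \<delta> \<subseteq> ball 0 1" for x \<delta> q a
  proof (intro conjI)
    have "norm x + \<delta> \<le> 1" using \<delta> by (auto simp: ball_subset_ball_iff dist_norm)
    then have \<delta>1: "\<delta> \<le> 1" using norm_ge_zero[of x] by linarith
    show "nonlocal_op K0 (?V x \<delta> q a) x = ereal (trunc_op \<delta> w' x - a * moment \<delta>)"
      by (rule nonlocal_op_paraboloid[OF K0 w' ww' _ \<delta>(1) \<delta>1]) (use x in \<open>simp add: w'_def\<close>)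
    have "Ck_on 2 (ball x \<delta>) (?V x \<delta> q a)"
      using Ck_on_cong[of "ball x \<delta>" "\<lambda>y. w x + q \<bullet> (y - x) + a * (norm (y - x))\<^sup>2" "?V x \<delta> q a" 2]
        Ck_on_2_paraboloid[of "ball x \<delta>" "w x" q x a] by simp
    from visc[OF x open_ball _ \<delta>(2) this] \<delta>(1)
    show "(\<forall>y. w y \<le> ?V x \<delta> q a y) \<longrightarrow> nonlocal_op K0 (?V x \<delta> q a) x \<le> ereal (f x)"
      "(\<forall>y. ?V x \<delta> q a y \<le> w y) \<longrightarrow> ereal (f x) \<le> nonlocal_op K0 (?V x \<delta> q a) x" by simp_all
  qed
  have "weak_solution w' f"
  proof (rule paraboloid_solution_weak[OF w' w'c f])
    show "paraboloid_subsolution w' f" unfolding paraboloid_subsolution_def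
    proof (intro allI impI)
      fix x \<delta> a q
      assume a: "x \<in> ball 0 1" "0 < \<delta>" "ball x \<delta> \<subseteq> ball 0 1"
        and h: "\<forall>h. norm h < \<delta> \<longrightarrow> w' (x + h) \<le> w' x + q \<bullet> h + a * (norm h)\<^sup>2"
      have "w y \<le> ?V x \<delta> q a y" for y
      proof (cases "y \<in> ball x \<delta>")
        case True
        then have "w' y \<le> w' x + q \<bullet> (y - x) + a * (norm (y - x))\<^sup>2"
          using h[rule_format, of "y - x"] by (simp add: dist_norm norm_minus_commute)
        moreover have "y \<in> ball 0 1" using True a(3) by blast
        ultimately show ?thesis using True a(1) by (simp add: w'_def)
      qed simp
      then have "ereal (trunc_op \<delta> w' x - a * moment \<delta>) \<le> ereal (f x)" using V[OF a, of q a] by metis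
      then show "trunc_op \<delta> w' x \<le> f x + a * moment \<delta>" by simp
    qed
    show "paraboloid_subsolution (\<lambda>x. - w' x) (\<lambda>x. - f x)" unfolding paraboloid_subsolution_def
    proof (intro allI impI)
      fix x \<delta> a q
      assume a: "x \<in> ball 0 1" "0 < \<delta>" "ball x \<delta> \<subseteq> ball 0 1"
        and h: "\<forall>h. norm h < \<delta> \<longrightarrow> - w' (x + h) \<le> - w' x + q \<bullet> h + a * (norm h)\<^sup>2"
      have "?V x \<delta> (- q) (- a) y \<le> w y" for y
      proof (cases "y \<in> ball x \<delta>")
        case True
        then have "- w' y \<le> - w' x + q \<bullet> (y - x) + a * (norm (y - x))\<^sup>2"
          using h[rule_format, of "y - x"] by (simp add: dist_norm norm_minus_commute)
        moreover have "y \<in> ball 0 1" using True a(3) by blast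
        ultimately show ?thesis using True a(1) by (simp add: w'_def)
      qed simp
      then have "ereal (f x) \<le> ereal (trunc_op \<delta> w' x - (- a) * moment \<delta>)" using V[OF a, of "- q" "- a"] by metis
      then show "trunc_op \<delta> (\<lambda>x. - w' x) x \<le> - f x + a * moment \<delta>" unfolding trunc_op_uminus by simp
    qed
  qed
  moreover have "(LBINT x. w' x * sym_op \<eta> x) = (LBINT x. u' x * sym_op \<eta> x)"
    if t: "test_function (ball 0 1) \<eta>" for \<eta>
  proof (rule integral_cong_AE)
    obtain N where N: "bounded_borel N \<eta>" using test_function_bounded_borel[OF t] .
    note [measurable] = bounded_borelD(1)[OF N] bounded_borelD(1)[OF u'] bounded_borelD(1)[OF w']
    show "(\<lambda>x. w' x * sym_op \<eta> x) \<in> borel_measurable lborel" unfolding sym_op_def by measurable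
    show "(\<lambda>x. u' x * sym_op \<eta> x) \<in> borel_measurable lborel" unfolding sym_op_def by measurable
    show "AE x in lborel. w' x * sym_op \<eta> x = u' x * sym_op \<eta> x" using w'u by eventually_elim simp
  qed
  ultimately show ?thesis unfolding weak_solution_def by simp
qed

end

section \<open>The equivalence\<close>

lemma Linfty_bounded_borel_representative:
  assumes "Linfty (u :: 'a::euclidean_space \<Rightarrow> real)"
  obtains u' M where "bounded_borel M u'" "AE x in lborel. u x = u' x"
proof -
  have "u \<in> borel_measurable (completion lborel)" using assms unfolding Linfty_def by simp
  from completion_ex_borel_measurable_real[OF this]
  obtain g where g: "g \<in> borel_measurable lborel" "AE x in lborel. u x = g x" by blast
  obtain C where C: "AE x in lebesgue. \<bar>u x\<bar> \<le> C" using assms unfolding Linfty_def by blast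
  define u' where "u' x = max (- \<bar>C\<bar>) (min \<bar>C\<bar> (g x))" for x
  have "u' \<in> borel_measurable borel" using g(1) unfolding u'_def[abs_def] by measurable
  then have "bounded_borel \<bar>C\<bar> u'" unfolding bounded_borel_def by (auto simp: u'_def)
  moreover have "AE x in lborel. u x = u' x"
    using g(2) C unfolding AE_completion_iff by eventually_elim (auto simp: u'_def)
  ultimately show ?thesis by (rule that)
qed

text \<open>
  Symmetrizing and clipping a Borel version of the kernel restores symmetry and bounds at every point.
\<close>

lemma levy_kernel_representative:
  fixes K :: "'a::euclidean_space \<Rightarrow> real"
  assumes s: "0 < s" "s < 1" and K: "K \<in> borel_measurable lebesgue" and sym: "\<And>y. K y = K (- y)" and lam: "0 < lam"
    and bd: "\<And>y. y \<noteq> 0 \<Longrightarrow> lam \<le> norm y powr (real DIM('a) + 2 * s) * K y \<and> norm y powr (real DIM('a) + 2 * s) * K y \<le> Lam"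
  obtains K' where "levy_kernel K' s lam Lam" "AE y in lborel. K y = K' y"
proof -
  let ?p = "real DIM('a) + 2 * s"
  obtain k where k: "k \<in> borel_measurable lborel" "AE x in lborel. K x = k x"
    using completion_ex_borel_measurable_real[OF K] by blast
  have [measurable]: "k \<in> borel_measurable borel" using k(1) by simp
  define K' where "K' y = max (lam * norm y powr - ?p) (min (Lam * norm y powr - ?p) ((k y + k (- y)) / 2))" for y
  have ll: "lam \<le> Lam"
  proof -
    obtain b :: 'a where "b \<in> Basis" using nonempty_Basis by blast
    then have "b \<noteq> 0" by auto
    then show ?thesis using bd[of b] by linarith
  qed
  have "levy_kernel K' s lam Lam"
  proof
    show "K' \<in> borel_measurable borel" unfolding K'_def[abs_def] by measurable
    show "K' (- y) = K' y" for y by (simp add: K'_def add.commute)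
    show "lam * norm y powr - ?p \<le> K' y" for y by (simp add: K'_def)
    show "K' y \<le> Lam * norm y powr - ?p" for y using ll by (auto simp: K'_def intro: mult_right_mono)
  qed (use s lam in auto)
  moreover have "AE y in lborel. K y = K' y"
  proof -
    have "AE y in lborel. y \<noteq> (0::'a)" by (rule AE_lborel_singleton)
    with k(2) AE_lborel_reflect[OF k(2)] show ?thesis
    proof eventually_elim
      case (elim y)
      have "(k y + k (- y)) / 2 = K y" using elim sym[of y] by simp
      moreover have "lam * norm y powr - ?p \<le> K y" "K y \<le> Lam * norm y powr - ?p"
        using bd[OF elim(3)] elim(3) by (simp_all only: powr_minus) (simp_all add: field_simps)
      ultimately show ?case by (simp add: K'_def)
    qed
  qed
  ultimately show ?thesis by (rule that)
qed

theorem lemma4p5: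
  fixes s lam Lam :: real
    and u f K :: "real ^ 'n \<Rightarrow> real"
  assumes "0 < s" and "s < 1"
    and "Linfty u"
    and "continuous_on (ball 0 1) f"
    and "K \<in> borel_measurable lebesgue"
    and "\<And>y. K y = K (- y)"
    and "0 < lam"
    and "\<And>y. y \<noteq> 0 \<Longrightarrow>
           lam \<le> norm y powr (real CARD('n) + 2 * s) * K y \<and>
           norm y powr (real CARD('n) + 2 * s) * K y \<le> Lam"
  shows "distributional_solution K u f \<longleftrightarrow> viscosity_solution K u f"
proof -
  obtain u' M where u': "bounded_borel M u'" "AE x in lborel. u x = u' x"
    using Linfty_bounded_borel_representative[OF assms(3)] by blast
  have um: "u \<in> borel_measurable lebesgue" using assms(3) by (simp add: Linfty_def)
  obtain K' where K': "levy_kernel K' s lam Lam" and KK': "AE y in lborel. K y = K' y"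
    using levy_kernel_representative[of s K lam Lam] assms by auto
  interpret levy_kernel K' s lam Lam by (rule K')
  show ?thesis
    using distributional_solution_iff_weak[OF KK' u'(2) um u'(1) assms(4)]
      weak_solution_is_viscosity[OF KK' u'(2,1) assms(4)] viscosity_solution_is_weak[OF KK' u'(2,1) assms(4)]
    by blast
qed

end
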